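(* Let $\tau$ be a contractive normal completely positive map on a von Neumann algebra $\mathcal{A}\subseteq\mathscr{B}(\mathcal{H})$, where $\mathcal{H}$ is a complex separable Hilbert space. Let $q_\tau$ be the strong operator limit $q_\tau:=\mathrm{s.}\lim_{n\to\infty}\tau^n(1_{\mathcal{A}})$. Then the following are equivalent: (i) $q_\tau\neq 0$; (ii) $\tau$ has a non-trivial (i.e. nonzero) fixed point; (iii) the peripheral Poisson boundary $\mathcal{P}(\tau)$ is non-trivial, i.e. $\mathcal{P}(\tau)\neq\{0\}$; (iv) $\mathcal{P}(\tau)$, with the extended Choi–Effros product $\circ$, is a (nonzero) unital $C^*$-algebra. In such a case, $q_\tau$ is the unit of $(\mathcal{P}(\tau),\circ)$, and it is also the unique maximal Perron–Frobenius eigenvector of $\tau$.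
   Context: Perron–Frobenius eigenvectors. For a positive map $\tau$ on a von Neumann algebra $\mathcal{A}$, an element $x\in\mathcal{A}$ is a Perron–Frobenius eigenvector of $\tau$ if $x\ge 0$, $\|x\|=1$ and $\tau(x)=rx$, where $r$ is the spectral radius of $\tau$. It is a maximal Perron–Frobenius eigenvector if $y\le x$ for every Perron–Frobenius eigenvector $y$ of $\tau$. Peripheral spaces. For a normal contractive completely positive map $\sigma$ on a von Neumann algebra $\mathcal{M}$ and $\lambda\in\mathbb{T}=\{z\in\mathbb{C}:|z|=1\}$, put $E_\lambda(\sigma)=\{x\in\mathcal{M}:\sigma(x)=\lambda x\}$, let $E(\sigma)$ be the linear span of $\bigcup_{\lambda\in\mathbb{T}}E_\lambda(\sigma)$, and let $\mathcal{P}(\sigma)$ be the norm closure of $E(\sigma)$. Minimal dilation. For a Hilbert space $\mathcal{K}\supseteq\mathcal{H}$ with projection $p$ onto $\mathcal{H}$, operators $x\in\mathscr{B}(\mathcal{H})$ are identified with $pxp\in\mathscr{B}(\mathcal{K})$ (extended by $0$ on $\mathcal{H}^\perp$). The minimal dilation of $(\mathcal{H},\mathcal{A},\tau)$, known to exist and to be unique up to unitary equivalence, is a triple $(\mathcal{K},\mathcal{B},\theta)$ such that: (a) $\mathcal{K}\supseteq\mathcal{H}$ is a Hilbert space; (b) $\mathcal{B}\subseteq\mathscr{B}(\mathcal{K})$ is a von Neumann algebra with $\mathcal{A}=p\mathcal{B}p$; (c) $\theta:\mathcal{B}\to\mathcal{B}$ is a normal $*$-endomorphism (not necessarily unital); (d)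 $\tau^n(x)=p\theta^n(x)p$ for all $x\in\mathcal{A}$, $n\in\mathbb{Z}_+$; (e) $\mathcal{K}=\overline{\mathrm{span}}\{\theta^n(x_n)\theta^{n-1}(x_{n-1})\cdots\theta(x_1)h: h\in\mathcal{H},\ x_1,\dots,x_n\in\mathcal{A},\ n\ge 0\}$; (f) $\mathcal{B}$ is the von Neumann algebra generated by $\{\theta^n(x):n\in\mathbb{Z}_+,x\in\mathcal{A}\}$. When $\tau(1)\neq 1$ the minimal dilation is the one obtained by unitization: put $\tilde{\mathcal{H}}=\mathcal{H}\oplus\mathbb{C}$, $\tilde{\mathcal{A}}=\mathcal{A}\oplus\mathbb{C}$ and $\tilde\tau(x\oplus c)=[\tau(x)+c(1-\tau(1))]\oplus c$, a normal unital completely positive map; let $(\tilde{\mathcal{K}},\tilde{\mathcal{B}},\tilde\theta)$ be the minimal dilation of $(\tilde{\mathcal{H}},\tilde{\mathcal{A}},\tilde\tau)$ and $\mathcal{K}=(0\oplus\mathbb{C})^\perp\subseteq\tilde{\mathcal{K}}$; then $\tilde{\mathcal{B}}=\mathcal{B}\oplus\mathbb{C}$ and $\tilde\theta(b\oplus c)=[\theta(b)+c(1-\theta(1))]\oplus c$, and this defines $\mathcal{B}$ and $\theta$. Peripheral Poisson boundary. The compression $z\mapsto pzp$ restricts to an isometric linear bijection of $\mathcal{P}(\theta)$ (a $C^*$-subalgebra of $\mathcal{B}$) onto $\mathcal{P}(\tau)$; for $x\in\mathcal{P}(\tau)$ let $\widehat{x}$ be the unique element of $\mathcal{P}(\theta)$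 with $p\widehat{x}p=x$. The extended Choi–Effros product on $\mathcal{P}(\tau)$ is $x\circ y=p\,\widehat{x}\,\widehat{y}\,p$. With this product and the norm and involution of $\mathcal{A}$, $\mathcal{P}(\tau)$ is a $C^*$-algebra, called the peripheral Poisson boundary of $\tau$. *)

theory Defs
  imports "HOL-Analysis.Analysis"
begin

section \<open>Complex Hilbert spaces\<close>

class scaleC =
  fixes scaleC :: "complex \<Rightarrow> 'a \<Rightarrow> 'a"  (infixr \<open>*\<^sub>C\<close> 75)

class complex_normed_vector = real_normed_vector + scaleC +
  assumes scaleC_add_right: "a *\<^sub>C (x + y) = a *\<^sub>C x + a *\<^sub>C y"
    and scaleC_add_left: "(a + b) *\<^sub>C x = a *\<^sub>C x + b *\<^sub>C x"
    and scaleC_scaleC: "a *\<^sub>C (b *\<^sub>C x) = (a * b) *\<^sub>C x"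
    and scaleC_of_real: "of_real r *\<^sub>C x = r *\<^sub>R x"
    and norm_scaleC: "norm (a *\<^sub>C x) = cmod a * norm x"

text \<open>The inner product is linear in its second argument. Since
  \<open>inner\<close> is its real part, the norm of \<^class>\<open>real_inner\<close> is
  the Hilbert space norm.\<close>

class chilbert_space = complex_normed_vector + real_inner + complete_space +
  fixes cinner :: "'a \<Rightarrow> 'a \<Rightarrow> complex"
  assumes cinner_commute: "cinner x y = cnj (cinner y x)"
    and cinner_add_right: "cinner x (y + z) = cinner x y + cinner x z"
    and cinner_scaleC_right: "cinner x (c *\<^sub>C y) = c * cinner x y"
    and Re_cinner: "Re (cinner x y) = inner x y"

global_interpretation complex_vector:
  vector_space "scaleC :: complex \<Rightarrow> 'a \<Rightarrow> 'a::complex_normed_vector"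
  defines csubspace = complex_vector.subspace
    and cspan = complex_vector.span
proof
  show "1 *\<^sub>C x = x" for x :: 'a
    using scaleC_of_real[of 1 x] by simp
qed (simp_all add: scaleC_add_right scaleC_add_left scaleC_scaleC)

lemma scaleC_scaleR:
  "a *\<^sub>C (r *\<^sub>R x) = r *\<^sub>R (a *\<^sub>C (x::'a::complex_normed_vector))"
  by (metis mult.commute scaleC_of_real scaleC_scaleC)

lemma bounded_linear_scaleC:
  "bounded_linear (\<lambda>x::'a::complex_normed_vector. a *\<^sub>C x)"
  by (rule bounded_linear_intro[of _ "cmod a"])
    (simp_all add: scaleC_add_right scaleC_scaleR norm_scaleC mult.commute)

instantiation complex :: chilbert_space
begin

definition scaleC_complex :: "complex \<Rightarrow> complex \<Rightarrow> complex"
  where "scaleC_complex a x = a * x"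

definition cinner_complex :: "complex \<Rightarrow> complex \<Rightarrow> complex"
  where "cinner_complex x y = cnj x * y"

instance
  by standard
    (simp_all add: scaleC_complex_def cinner_complex_def algebra_simps norm_mult
      scaleR_conv_of_real inner_complex_def)

end

instantiation prod :: (complex_normed_vector, complex_normed_vector) complex_normed_vector
begin

definition scaleC_prod :: "complex \<Rightarrow> 'a \<times> 'b \<Rightarrow> 'a \<times> 'b"
  where "scaleC_prod a x = (a *\<^sub>C fst x, a *\<^sub>C snd x)"

instance
proof
  fix a :: complex and x :: "'a \<times> 'b"
  show "norm (a *\<^sub>C x) = cmod a * norm x"
    by (simp add: scaleC_prod_def norm_prod_def norm_scaleC power_mult_distrib
        distrib_left[symmetric] real_sqrt_mult)
qed (auto simp: scaleC_prod_def scaleC_add_right scaleC_add_left scaleC_scaleC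
      scaleC_of_real scaleR_prod_def)

end

instantiation prod :: (chilbert_space, chilbert_space) chilbert_space
begin

definition cinner_prod :: "'a \<times> 'b \<Rightarrow> 'a \<times> 'b \<Rightarrow> complex"
  where "cinner_prod x y = cinner (fst x) (fst y) + cinner (snd x) (snd y)"

instance
proof
  fix x y z :: "'a \<times> 'b" and c :: complex
  show "cinner x y = cnj (cinner y x)"
    using cinner_commute[of "fst x" "fst y"] cinner_commute[of "snd x" "snd y"]
    by (simp add: cinner_prod_def)
qed (simp_all add: cinner_prod_def scaleC_prod_def cinner_add_right cinner_scaleC_right
      Re_cinner inner_prod_def algebra_simps)

end


section \<open>Operators\<close>

text \<open>The type of bounded operators of the library consists of real linear maps; the complex
  linear ones form the subset \<open>clinear_ops\<close>, which for equal domain and codomain \<open>H\<close> is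
  the algebra \<open>B(H)\<close>.\<close>

instantiation blinfun :: (real_normed_vector, complex_normed_vector) complex_normed_vector
begin

definition scaleC_blinfun :: "complex \<Rightarrow> ('a \<Rightarrow>\<^sub>L 'b) \<Rightarrow> ('a \<Rightarrow>\<^sub>L 'b)"
  where "scaleC_blinfun a T = Blinfun (\<lambda>x. a *\<^sub>C T x)"

lemma scaleC_blinfun_apply: "blinfun_apply (a *\<^sub>C T) x = a *\<^sub>C T x"
  for T :: "'a \<Rightarrow>\<^sub>L 'b"
  unfolding scaleC_blinfun_def
  by (subst bounded_linear_Blinfun_apply)
    (rule bounded_linear_compose[OF bounded_linear_scaleC blinfun.bounded_linear_right], simp)

instance
proof
  fix a b :: complex and r :: real and S T :: "'a \<Rightarrow>\<^sub>L 'b"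
  show "a *\<^sub>C (S + T) = a *\<^sub>C S + a *\<^sub>C T"
    by (rule blinfun_eqI) (simp add: scaleC_blinfun_apply blinfun.add_left scaleC_add_right)
  show "(a + b) *\<^sub>C T = a *\<^sub>C T + b *\<^sub>C T"
    by (rule blinfun_eqI) (simp add: scaleC_blinfun_apply blinfun.add_left scaleC_add_left)
  show scale: "a *\<^sub>C (b *\<^sub>C T) = (a * b) *\<^sub>C T" for a b and T :: "'a \<Rightarrow>\<^sub>L 'b"
    by (rule blinfun_eqI) (simp add: scaleC_blinfun_apply scaleC_scaleC)
  show real: "of_real r *\<^sub>C T = r *\<^sub>R T" for r and T :: "'a \<Rightarrow>\<^sub>L 'b"
    by (rule blinfun_eqI) (simp add: scaleC_blinfun_apply blinfun.scaleR_left scaleC_of_real)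
  have le: "norm (a *\<^sub>C T) \<le> cmod a * norm T" for a and T :: "'a \<Rightarrow>\<^sub>L 'b"
  proof (rule norm_blinfun_bound)
    show "norm (blinfun_apply (a *\<^sub>C T) x) \<le> cmod a * norm T * norm x" for x
      by (simp add: scaleC_blinfun_apply norm_scaleC mult.assoc mult_left_mono norm_blinfun)
  qed simp
  show "norm (a *\<^sub>C T) = cmod a * norm T"
  proof (cases "a = 0")
    case True
    with le[of 0 T] show ?thesis by simp
  next
    case False
    have "norm T = norm (inverse a *\<^sub>C (a *\<^sub>C T))"
      using False real[of 1 T] by (simp add: scale)
    also have "\<dots> \<le> cmod (inverse a) * norm (a *\<^sub>C T)" by (rule le)
    finally have "cmod a * norm T \<le> norm (a *\<^sub>C T)"
      using False unfolding norm_inverse by (simp add: field_simps)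
    with le[of a T] show ?thesis by simp
  qed
qed

end

definition clinear_ops :: "('a::complex_normed_vector \<Rightarrow>\<^sub>L 'b::complex_normed_vector) set"
  where "clinear_ops = {T. \<forall>c x. blinfun_apply T (c *\<^sub>C x) = c *\<^sub>C blinfun_apply T x}"

definition op_adj :: "('a::chilbert_space \<Rightarrow>\<^sub>L 'b::chilbert_space) \<Rightarrow> ('b \<Rightarrow>\<^sub>L 'a)"
  where "op_adj T = (THE S. \<forall>x y. cinner (blinfun_apply S y) x = cinner y (blinfun_apply T x))"

definition op_positive :: "('h::chilbert_space \<Rightarrow>\<^sub>L 'h) \<Rightarrow> bool"
  where "op_positive T \<longleftrightarrow> T \<in> clinear_ops \<and> (\<forall>h. cinner h (T h) \<in> \<real>\<^sub>\<ge>\<^sub>0)"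

definition op_le :: "('h::chilbert_space \<Rightarrow>\<^sub>L 'h) \<Rightarrow> ('h \<Rightarrow>\<^sub>L 'h) \<Rightarrow> bool"
  where "op_le S T \<longleftrightarrow> op_positive (T - S)"

definition von_neumann_algebra :: "('h::chilbert_space \<Rightarrow>\<^sub>L 'h) set \<Rightarrow> bool"
  where "von_neumann_algebra M \<longleftrightarrow>
    M \<subseteq> clinear_ops \<and> csubspace M \<and> id_blinfun \<in> M \<and>
    (\<forall>x\<in>M. \<forall>y\<in>M. x o\<^sub>L y \<in> M) \<and> (\<forall>x\<in>M. op_adj x \<in> M) \<and>
    closedin strong_operator_topology M"

definition vn_generated :: "('h::chilbert_space \<Rightarrow>\<^sub>L 'h) set \<Rightarrow> ('h \<Rightarrow>\<^sub>L 'h) set"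
  where "vn_generated S = \<Inter>{M. von_neumann_algebra M \<and> S \<subseteq> M}"

text \<open>The \<open>\<sigma>\<close>-weak topology is the initial topology for the functionals
  \<open>T \<mapsto> (\<Sum>n. \<langle>\<xi> n, T (\<eta> n)\<rangle>)\<close> with square summable
  \<open>\<xi>\<close>, \<open>\<eta>\<close>.\<close>

definition sigma_weak_topology :: "('h::chilbert_space \<Rightarrow>\<^sub>L 'h) topology"
  where "sigma_weak_topology = topology_generated_by
    {{T. (\<Sum>n. cinner (\<xi> n) (blinfun_apply T (\<eta> n))) \<in> U} | \<xi> \<eta> U.
      summable (\<lambda>n::nat. (norm (\<xi> n))\<^sup>2) \<and> summable (\<lambda>n. (norm (\<eta> n))\<^sup>2) \<and> open U}"


section \<open>Maps on von Neumann algebras\<close>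

text \<open>A map on an algebra \<open>M\<close> is a function on all operators of which only the values
  on \<open>M\<close> matter.\<close>

definition clinear_on ::
    "'a::complex_normed_vector set \<Rightarrow> ('a \<Rightarrow> 'b::complex_normed_vector) \<Rightarrow> bool"
  where "clinear_on M f \<longleftrightarrow>
    (\<forall>x\<in>M. \<forall>y\<in>M. f (x + y) = f x + f y) \<and> (\<forall>c. \<forall>x\<in>M. f (c *\<^sub>C x) = c *\<^sub>C f x)"

definition normal_on ::
    "('h::chilbert_space \<Rightarrow>\<^sub>L 'h) set \<Rightarrow> (('h \<Rightarrow>\<^sub>L 'h) \<Rightarrow> ('h \<Rightarrow>\<^sub>L 'h)) \<Rightarrow> bool"
  where "normal_on M f \<longleftrightarrow>
    continuous_map (subtopology sigma_weak_topology M) sigma_weak_topology f"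

text \<open>Positivity of an \<open>n \<times> n\<close> operator matrix as an operator on the direct sum of
  \<open>n\<close> copies of \<open>H\<close>.\<close>

definition matrix_positive ::
    "nat \<Rightarrow> (nat \<Rightarrow> nat \<Rightarrow> ('h::chilbert_space \<Rightarrow>\<^sub>L 'h)) \<Rightarrow> bool"
  where "matrix_positive n a \<longleftrightarrow>
    (\<forall>h. (\<Sum>i<n. \<Sum>j<n. cinner (h i) (a i j (h j))) \<in> \<real>\<^sub>\<ge>\<^sub>0)"

definition completely_positive_on ::
    "('h::chilbert_space \<Rightarrow>\<^sub>L 'h) set \<Rightarrow> (('h \<Rightarrow>\<^sub>L 'h) \<Rightarrow> ('h \<Rightarrow>\<^sub>L 'h)) \<Rightarrow> bool"
  where "completely_positive_on M f \<longleftrightarrow>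
    (\<forall>n a. (\<forall>i<n. \<forall>j<n. a i j \<in> M) \<longrightarrow> matrix_positive n a \<longrightarrow>
      matrix_positive n (\<lambda>i j. f (a i j)))"

definition contractive_normal_cp ::
    "('h::chilbert_space \<Rightarrow>\<^sub>L 'h) set \<Rightarrow> (('h \<Rightarrow>\<^sub>L 'h) \<Rightarrow> ('h \<Rightarrow>\<^sub>L 'h)) \<Rightarrow> bool"
  where "contractive_normal_cp M f \<longleftrightarrow>
    f ` M \<subseteq> M \<and> clinear_on M f \<and> completely_positive_on M f \<and> normal_on M f \<and>
    (\<forall>x\<in>M. norm (f x) \<le> norm x)"

definition normal_star_endomorphism ::
    "('h::chilbert_space \<Rightarrow>\<^sub>L 'h) set \<Rightarrow> (('h \<Rightarrow>\<^sub>L 'h) \<Rightarrow> ('h \<Rightarrow>\<^sub>L 'h)) \<Rightarrow> bool"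
  where "normal_star_endomorphism M f \<longleftrightarrow>
    f ` M \<subseteq> M \<and> clinear_on M f \<and>
    (\<forall>x\<in>M. \<forall>y\<in>M. f (x o\<^sub>L y) = f x o\<^sub>L f y) \<and>
    (\<forall>x\<in>M. f (op_adj x) = op_adj (f x)) \<and> normal_on M f"


section \<open>Perron--Frobenius eigenvectors\<close>

text \<open>Spectrum and spectral radius of \<open>f\<close> as a bounded operator on the complex Banach
  space \<open>M\<close>.\<close>

definition bounded_clinear_on :: "'a::complex_normed_vector set \<Rightarrow> ('a \<Rightarrow> 'a) \<Rightarrow> bool"
  where "bounded_clinear_on M f \<longleftrightarrow>
    f ` M \<subseteq> M \<and> clinear_on M f \<and> (\<exists>K. \<forall>x\<in>M. norm (f x) \<le> K * norm x)"

definition spectrum_on :: "'a::complex_normed_vector set \<Rightarrow> ('a \<Rightarrow> 'a) \<Rightarrow> complex set"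
  where "spectrum_on M f = {z. \<not> (\<exists>g. bounded_clinear_on M g \<and>
    (\<forall>x\<in>M. g (f x - z *\<^sub>C x) = x \<and> f (g x) - z *\<^sub>C g x = x))}"

definition spectral_radius_on :: "'a::complex_normed_vector set \<Rightarrow> ('a \<Rightarrow> 'a) \<Rightarrow> real"
  where "spectral_radius_on M f = Sup (cmod ` spectrum_on M f)"

definition pf_eigenvector ::
    "('h::chilbert_space \<Rightarrow>\<^sub>L 'h) set \<Rightarrow> (('h \<Rightarrow>\<^sub>L 'h) \<Rightarrow> ('h \<Rightarrow>\<^sub>L 'h)) \<Rightarrow> ('h \<Rightarrow>\<^sub>L 'h) \<Rightarrow> bool"
  where "pf_eigenvector M f x \<longleftrightarrow>
    x \<in> M \<and> op_positive x \<and> norm x = 1 \<and> f x = spectral_radius_on M f *\<^sub>R x"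

definition maximal_pf_eigenvector ::
    "('h::chilbert_space \<Rightarrow>\<^sub>L 'h) set \<Rightarrow> (('h \<Rightarrow>\<^sub>L 'h) \<Rightarrow> ('h \<Rightarrow>\<^sub>L 'h)) \<Rightarrow> ('h \<Rightarrow>\<^sub>L 'h) \<Rightarrow> bool"
  where "maximal_pf_eigenvector M f x \<longleftrightarrow>
    pf_eigenvector M f x \<and> (\<forall>y. pf_eigenvector M f y \<longrightarrow> op_le y x)"


section \<open>Peripheral spaces\<close>

definition eigenspace_on ::
    "'a::complex_normed_vector set \<Rightarrow> ('a \<Rightarrow> 'a) \<Rightarrow> complex \<Rightarrow> 'a set"
  where "eigenspace_on M f z = {x\<in>M. f x = z *\<^sub>C x}"

definition peripheral_space :: "'a::complex_normed_vector set \<Rightarrow> ('a \<Rightarrow> 'a) \<Rightarrow> 'a set"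
  where "peripheral_space M f = closure (cspan (\<Union>z\<in>{z. cmod z = 1}. eigenspace_on M f z))"


section \<open>Minimal dilations\<close>

text \<open>The inclusion of \<open>H\<close> into \<open>K\<close> is represented by a complex linear isometry
  \<open>V\<close>. Then \<open>lift_op V x\<close> is the operator \<open>x\<close> extended by \<open>0\<close> on
  the orthogonal complement of \<open>H\<close>, and \<open>compress_op V z\<close> is the operator on
  \<open>H\<close> with which \<open>p z p\<close> is identified.\<close>

definition lift_op ::
    "('h::chilbert_space \<Rightarrow>\<^sub>L 'k::chilbert_space) \<Rightarrow> ('h \<Rightarrow>\<^sub>L 'h) \<Rightarrow> ('k \<Rightarrow>\<^sub>L 'k)"
  where "lift_op V x = V o\<^sub>L x o\<^sub>L op_adj V"

definition compress_op ::
    "('h::chilbert_space \<Rightarrow>\<^sub>L 'k::chilbert_space) \<Rightarrow> ('k \<Rightarrow>\<^sub>L 'k) \<Rightarrow> ('h \<Rightarrow>\<^sub>L 'h)"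
  where "compress_op V z = op_adj V o\<^sub>L z o\<^sub>L V"

text \<open>The vector \<open>\<theta>\<^sup>n(x\<^sub>n) \<dots> \<theta>(x\<^sub>1) h\<close>.\<close>

primrec dilation_vector ::
    "('h::chilbert_space \<Rightarrow>\<^sub>L 'k::chilbert_space) \<Rightarrow> (('k \<Rightarrow>\<^sub>L 'k) \<Rightarrow> ('k \<Rightarrow>\<^sub>L 'k)) \<Rightarrow>
     (nat \<Rightarrow> ('h \<Rightarrow>\<^sub>L 'h)) \<Rightarrow> 'h \<Rightarrow> nat \<Rightarrow> 'k"
  where
    "dilation_vector V \<theta> x h 0 = V h"
  | "dilation_vector V \<theta> x h (Suc n) =
      (\<theta> ^^ Suc n) (lift_op V (x (Suc n))) (dilation_vector V \<theta> x h n)"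

text \<open>\<open>K\<close> is the whole type. These conditions characterize the minimal dilation of a
  unital map; non-unital maps are treated in \<open>minimal_dilation\<close> below.\<close>

definition dilation_conditions ::
    "('h::chilbert_space \<Rightarrow>\<^sub>L 'h) set \<Rightarrow> (('h \<Rightarrow>\<^sub>L 'h) \<Rightarrow> ('h \<Rightarrow>\<^sub>L 'h)) \<Rightarrow>
     ('h \<Rightarrow>\<^sub>L 'k::chilbert_space) \<Rightarrow> ('k \<Rightarrow>\<^sub>L 'k) set \<Rightarrow> (('k \<Rightarrow>\<^sub>L 'k) \<Rightarrow> ('k \<Rightarrow>\<^sub>L 'k)) \<Rightarrow> bool"
  where "dilation_conditions A \<tau> V B \<theta> \<longleftrightarrow>
    V \<in> clinear_ops \<and> (\<forall>h. norm (V h) = norm h) \<and>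
    von_neumann_algebra B \<and> A = compress_op V ` B \<and>
    normal_star_endomorphism B \<theta> \<and>
    (\<forall>x\<in>A. \<forall>n. (\<tau> ^^ n) x = compress_op V ((\<theta> ^^ n) (lift_op V x))) \<and>
    closure (cspan {dilation_vector V \<theta> x h n | x h n. \<forall>i. x i \<in> A}) = UNIV \<and>
    B = vn_generated {(\<theta> ^^ n) (lift_op V x) | n x. x \<in> A}"

text \<open>The operator \<open>a \<oplus> c\<close> between the spaces \<open>H \<oplus> \<complex>\<close> and
  \<open>K \<oplus> \<complex>\<close>, and the extraction of its two components.\<close>

definition dsum ::
    "('a::complex_normed_vector \<Rightarrow>\<^sub>L 'b::complex_normed_vector) \<Rightarrow> complex \<Rightarrow>
     (('a \<times> complex) \<Rightarrow>\<^sub>L ('b \<times> complex))"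
  where "dsum a c = Blinfun (\<lambda>x. (a (fst x), c * snd x))"

definition op_part ::
    "(('a::complex_normed_vector \<times> complex) \<Rightarrow>\<^sub>L ('b::complex_normed_vector \<times> complex)) \<Rightarrow> ('a \<Rightarrow>\<^sub>L 'b)"
  where "op_part T = Blinfun (\<lambda>h. fst (T (h, 0)))"

definition scalar_part ::
    "(('a::complex_normed_vector \<times> complex) \<Rightarrow>\<^sub>L ('b::complex_normed_vector \<times> complex)) \<Rightarrow> complex"
  where "scalar_part T = snd (T (0, 1))"

lemma dsum_apply: "blinfun_apply (dsum a c) x = (a (fst x), c * snd x)"
  unfolding dsum_def
  by (subst bounded_linear_Blinfun_apply) (auto intro!: bounded_linear_intros)

lemma op_part_dsum [simp]: "op_part (dsum a c) = a"
  by (simp add: op_part_def dsum_apply blinfun_apply_inverse)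

lemma scalar_part_dsum [simp]: "scalar_part (dsum a c) = c"
  by (simp add: scalar_part_def dsum_apply)

definition unitized_algebra ::
    "('h::chilbert_space \<Rightarrow>\<^sub>L 'h) set \<Rightarrow> (('h \<times> complex) \<Rightarrow>\<^sub>L ('h \<times> complex)) set"
  where "unitized_algebra M = {dsum a c | a c. a \<in> M}"

definition unitized_map ::
    "(('h::chilbert_space \<Rightarrow>\<^sub>L 'h) \<Rightarrow> ('h \<Rightarrow>\<^sub>L 'h)) \<Rightarrow>
     (('h \<times> complex) \<Rightarrow>\<^sub>L ('h \<times> complex)) \<Rightarrow> (('h \<times> complex) \<Rightarrow>\<^sub>L ('h \<times> complex))"
  where "unitized_map f T =
    dsum (f (op_part T) + scalar_part T *\<^sub>C (id_blinfun - f id_blinfun)) (scalar_part T)"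

lemma unitized_map_dsum:
  "unitized_map f (dsum x c) = dsum (f x + c *\<^sub>C (id_blinfun - f id_blinfun)) c"
  by (simp add: unitized_map_def)

text \<open>For non-unital \<open>\<tau>\<close> the triple \<open>(K, B, \<theta>)\<close> is read off from a minimal
  dilation of the unitization: that dilation acts on \<open>K \<oplus> \<complex>\<close>, it contains
  \<open>H \<oplus> \<complex>\<close> through \<open>V \<oplus> 1\<close>, its algebra is \<open>B \<oplus> \<complex>\<close>
  and its endomorphism is the unitization of \<open>\<theta>\<close>.\<close>

definition minimal_dilation ::
    "('h::chilbert_space \<Rightarrow>\<^sub>L 'h) set \<Rightarrow> (('h \<Rightarrow>\<^sub>L 'h) \<Rightarrow> ('h \<Rightarrow>\<^sub>L 'h)) \<Rightarrow>
     ('h \<Rightarrow>\<^sub>L 'k::chilbert_space) \<Rightarrow> ('k \<Rightarrow>\<^sub>L 'k) set \<Rightarrow> (('k \<Rightarrow>\<^sub>L 'k) \<Rightarrow> ('k \<Rightarrow>\<^sub>L 'k)) \<Rightarrow> bool"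
  where "minimal_dilation A \<tau> V B \<theta> \<longleftrightarrow>
    (if \<tau> id_blinfun = id_blinfun
     then dilation_conditions A \<tau> V B \<theta>
     else dilation_conditions (unitized_algebra A) (unitized_map \<tau>)
            (dsum V 1) (unitized_algebra B) (unitized_map \<theta>))"


section \<open>The peripheral Poisson boundary\<close>

definition peripheral_lift ::
    "('h::chilbert_space \<Rightarrow>\<^sub>L 'k::chilbert_space) \<Rightarrow> ('k \<Rightarrow>\<^sub>L 'k) set \<Rightarrow>
     (('k \<Rightarrow>\<^sub>L 'k) \<Rightarrow> ('k \<Rightarrow>\<^sub>L 'k)) \<Rightarrow> ('h \<Rightarrow>\<^sub>L 'h) \<Rightarrow> ('k \<Rightarrow>\<^sub>L 'k)"
  where "peripheral_lift V B \<theta> x = (THE z. z \<in> peripheral_space B \<theta> \<and> compress_op V z = x)"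

definition choi_effros ::
    "('h::chilbert_space \<Rightarrow>\<^sub>L 'k::chilbert_space) \<Rightarrow> ('k \<Rightarrow>\<^sub>L 'k) set \<Rightarrow>
     (('k \<Rightarrow>\<^sub>L 'k) \<Rightarrow> ('k \<Rightarrow>\<^sub>L 'k)) \<Rightarrow> ('h \<Rightarrow>\<^sub>L 'h) \<Rightarrow> ('h \<Rightarrow>\<^sub>L 'h) \<Rightarrow> ('h \<Rightarrow>\<^sub>L 'h)"
  where "choi_effros V B \<theta> x y =
    compress_op V (peripheral_lift V B \<theta> x o\<^sub>L peripheral_lift V B \<theta> y)"

text \<open>\<open>P\<close> is a C*-algebra for the given product and involution, the ambient linear
  structure and the ambient norm.\<close>

definition cstar_algebra_on ::
    "'a::complex_normed_vector set \<Rightarrow> ('a \<Rightarrow> 'a \<Rightarrow> 'a) \<Rightarrow> ('a \<Rightarrow> 'a) \<Rightarrow> bool"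
  where "cstar_algebra_on P m s \<longleftrightarrow>
    csubspace P \<and> complete P \<and>
    (\<forall>x\<in>P. \<forall>y\<in>P. m x y \<in> P) \<and>
    (\<forall>x\<in>P. \<forall>y\<in>P. \<forall>z\<in>P. m (m x y) z = m x (m y z)) \<and>
    (\<forall>x\<in>P. clinear_on P (m x)) \<and> (\<forall>y\<in>P. clinear_on P (\<lambda>x. m x y)) \<and>
    (\<forall>x\<in>P. \<forall>y\<in>P. norm (m x y) \<le> norm x * norm y) \<and>
    (\<forall>x\<in>P. s x \<in> P \<and> s (s x) = x) \<and>
    (\<forall>x\<in>P. \<forall>y\<in>P. s (x + y) = s x + s y) \<and>
    (\<forall>c. \<forall>x\<in>P. s (c *\<^sub>C x) = cnj c *\<^sub>C s x) \<and>
    (\<forall>x\<in>P. \<forall>y\<in>P. s (m x y) = m (s y) (s x)) \<and>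
    (\<forall>x\<in>P. norm (m (s x) x) = (norm x)\<^sup>2)"

definition is_unit_on :: "'a set \<Rightarrow> ('a \<Rightarrow> 'a \<Rightarrow> 'a) \<Rightarrow> 'a \<Rightarrow> bool"
  where "is_unit_on P m u \<longleftrightarrow> u \<in> P \<and> (\<forall>x\<in>P. m u x = x \<and> m x u = x)"

definition sot_limit :: "(nat \<Rightarrow> ('h::chilbert_space \<Rightarrow>\<^sub>L 'h)) \<Rightarrow> ('h \<Rightarrow>\<^sub>L 'h)"
  where "sot_limit T = (THE q. limitin strong_operator_topology T q sequentially)"

end

theory Submission
  imports Defs
begin

text \<open>
Since \<open>\<tau>(1) \<le> 1\<close>, the operators \<open>\<tau>\<^sup>n(1)\<close> decrease, so they
converge strongly to some \<open>q\<close> in the algebra, and \<open>\<tau>(q) = q\<close> because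
\<open>\<tau>\<close> is normal. A single estimate controls all peripheral eigenvectors: complete positivity
of \<open>\<tau>\<^sup>n\<close>, applied to the positive matrix with diagonal \<open>\<parallel>x\<parallel>\<close> and
off-diagonal entries \<open>x\<close>, \<open>x\<^sup>*\<close>, bounds the modulus of \<open>\<langle>h, \<tau>\<^sup>n(x) k\<rangle>\<close> by
\<open>\<parallel>x\<parallel> (\<langle>h, \<tau>\<^sup>n(1) h\<rangle> + \<langle>k, \<tau>\<^sup>n(1) k\<rangle>)\<close>
(\<open>cmod_cinner_iter_le\<close>). If \<open>\<tau>(x) = z x\<close> with \<open>|z| = 1\<close>, this
modulus does not depend on \<open>n\<close>, and the limit \<open>n \<rightarrow> \<infinity>\<close> shows
that \<open>q = 0\<close> forces \<open>x = 0\<close>. So \<open>q \<noteq> 0\<close> is equivalent both to the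
existence of a nonzero fixed point and to nontriviality of the peripheral space.

When \<open>q \<noteq> 0\<close>, the number 1 is an eigenvalue of the contraction \<open>\<tau>\<close>, hence the
spectral radius. A positive fixed point \<open>y\<close> of norm at most 1 satisfies
\<open>y = \<tau>\<^sup>n(y) \<le> \<tau>\<^sup>n(1)\<close>, hence \<open>y \<le> q\<close>; this gives maximality, and
applied to \<open>q / \<parallel>q\<parallel>\<close> it gives \<open>\<parallel>q\<parallel> = 1\<close>.

For the product, let first \<open>\<tau>(1) = 1\<close>, and let \<open>p\<close> be the projection of the dilation
space \<open>K\<close> onto \<open>H\<close>. The projections \<open>P\<^sub>n = \<theta>\<^sup>n(p)\<close> increase, and
minimality says that they increase to 1. For \<open>z\<close> in the span of the peripheral eigenvectors of
\<open>\<theta>\<close>, the identity \<open>\<theta>\<^sup>n(p z p) = P\<^sub>n \<theta>\<^sup>n(z) P\<^sub>n\<close> together with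
simultaneous recurrence of the eigenvalues (\<open>\<theta>\<^sup>n(z)\<close> is close to \<open>z\<close> for
arbitrarily large \<open>n\<close>) gives \<open>\<parallel>z\<parallel> \<le> \<parallel>p z p\<parallel>\<close>, so the
compression is isometric. It is onto because an eigenvector \<open>x\<close> of \<open>\<tau>\<close> lifts to the
strong limit of \<open>z\<^sup>-\<^sup>n \<theta>\<^sup>n(x)\<close>, a bounded martingale for the
\<open>P\<^sub>n\<close>. The peripheral space of the \<open>*\<close>-endomorphism \<open>\<theta>\<close> is a norm closed
\<open>*\<close>-algebra of operators, and the compression carries its structure to the peripheral space of
\<open>\<tau>\<close>.

If \<open>\<tau>(1) \<noteq> 1\<close>, the same facts for the unitization restrict to the summand on
\<open>K\<close>. The unit is found as follows: the projections \<open>\<theta>\<^sup>n(1)\<close> decrease to a fixed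
point \<open>e\<close> of \<open>\<theta>\<close>, which acts as a unit on each eigenvector
\<open>x = z\<^sup>-\<^sup>n \<theta>\<^sup>n(x)\<close>, and the dilation property of the corner
\<open>0 \<oplus> 1\<close> says that \<open>\<theta>\<^sup>n(1)\<close> compresses to \<open>\<tau>\<^sup>n(1)\<close>, whence
\<open>e\<close> compresses to \<open>q\<close>.
\<close>

instance chilbert_space \<subseteq> banach ..

section \<open>Complex Hilbert spaces and adjoints\<close>

lemma scaleC_one [simp]: "1 *\<^sub>C x = (x :: 'a :: complex_normed_vector)"
  using scaleC_of_real[of 1 x] by simp

lemma cinner_zero_right [simp]: "cinner x 0 = 0"
  using cinner_add_right[of x 0 0] by simp

lemma cinner_minus_right [simp]: "cinner x (- y) = - cinner x y"
  using cinner_add_right[of x y "- y"] by (simp add: add_eq_0_iff)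

lemma cinner_diff_right: "cinner x (y - z) = cinner x y - cinner x z"
  using cinner_add_right[of x y "- z"] by simp

lemma cinner_add_left: "cinner (x + y) z = cinner x z + cinner y z"
  unfolding cinner_commute[of "x + y"] cinner_commute[of x z] cinner_commute[of y z]
  by (simp add: cinner_add_right)

lemma cinner_zero_left [simp]: "cinner 0 x = 0"
  using cinner_add_left[of 0 0 x] by simp

lemma cinner_minus_left [simp]: "cinner (- x) y = - cinner x y"
  using cinner_add_left[of x "- x" y] by (simp add: add_eq_0_iff)

lemma cinner_diff_left: "cinner (x - y) z = cinner x z - cinner y z"
  using cinner_add_left[of x "- y" z] by simp

lemma cinner_scaleC_left: "cinner (c *\<^sub>C x) y = cnj c * cinner x y"
  unfolding cinner_commute[of "c *\<^sub>C x"] cinner_commute[of x y]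
  by (simp add: cinner_scaleC_right)

lemma cinner_scaleR_right: "cinner x (r *\<^sub>R y) = of_real r * cinner x y"
  using cinner_scaleC_right[of x "of_real r" y] by (simp add: scaleC_of_real)

lemma cinner_scaleR_left: "cinner (r *\<^sub>R x) y = of_real r * cinner x y"
  using cinner_scaleC_left[of "of_real r" x y] by (simp add: scaleC_of_real)

lemma cinner_same: "cinner x x = of_real ((norm x)\<^sup>2)"
proof (rule complex_eqI)
  show "Re (cinner x x) = Re (of_real ((norm x)\<^sup>2))"
    by (simp add: Re_cinner power2_norm_eq_inner)
  have "Im (cinner x x) = - Im (cinner x x)"
    using arg_cong[OF cinner_commute[of x x], of Im] by simp
  then show "Im (cinner x x) = Im (of_real ((norm x)\<^sup>2))"
    by simp
qed

lemma Im_cinner: "Im (cinner x y) = - inner x (\<i> *\<^sub>C y)"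
  using Re_cinner[of x "\<i> *\<^sub>C y"] by (simp add: cinner_scaleC_right)

lemma cmod_cinner_le: "cmod (cinner x y) \<le> norm x * norm y"
proof (cases "cinner x y = 0")
  case False
  define c where "c = cnj (sgn (cinner x y))"
  have c: "cmod c = 1"
    using False by (simp add: c_def norm_sgn)
  have "c * cinner x y = of_real (cmod (cinner x y))"
    using False unfolding c_def sgn_eq
    by (simp add: field_simps complex_norm_square[symmetric] power2_eq_square)
  then have "cmod (cinner x y) = Re (cinner x (c *\<^sub>C y))"
    by (simp add: cinner_scaleC_right)
  also have "\<dots> \<le> norm x * norm (c *\<^sub>C y)"
    unfolding Re_cinner by (rule norm_cauchy_schwarz)
  finally show ?thesis
    by (simp add: norm_scaleC c)
qed simp

lemma bounded_linear_cinner_right: "bounded_linear (cinner x)"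
proof (rule bounded_linear_intro[of _ "norm x"])
  show "norm (cinner x y) \<le> norm y * norm x" for y
    using cmod_cinner_le[of x y] by (simp add: mult.commute)
qed (simp_all add: cinner_add_right cinner_scaleR_right scaleR_conv_of_real)

lemmas tendsto_cinner_right = bounded_linear.tendsto[OF bounded_linear_cinner_right]

lemma cinner_ext_right:
  assumes "\<And>h. cinner h x = cinner h y"
  shows "x = y"
proof -
  have "cinner (x - y) (x - y) = 0"
    by (simp add: cinner_diff_right assms)
  then show ?thesis
    by (simp add: cinner_same)
qed

lemma cinner_ext_left:
  assumes "\<And>h. cinner x h = cinner y h"
  shows "x = y"
proof (rule cinner_ext_right)
  show "cinner h x = cinner h y" for h
    using assms[of h] cinner_commute[of h x] cinner_commute[of h y] by simp
qed

lemma le_of_square_le: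
  assumes "x * x \<le> c * x" "0 \<le> x" "0 \<le> (c::real)"
  shows "x \<le> c"
  using assms by (cases "x = 0") auto

text \<open>The representing vector minimises \<open>\<parallel>x\<parallel>\<^sup>2 - 2 f(x)\<close>; by the parallelogram
law every minimising sequence is Cauchy.\<close>

lemma riesz_representation:
  fixes f :: "'a::{real_inner, complete_space} \<Rightarrow> real"
  assumes "bounded_linear f"
  obtains y where "\<And>x. f x = inner y x"
proof -
  interpret f: bounded_linear f by fact
  obtain K where K: "\<And>x. \<bar>f x\<bar> \<le> norm x * K"
    using f.bounded by auto
  define J where "J x = inner x x - 2 * f x" for x
  have lower: "- (K\<^sup>2) \<le> J x" for x
  proof -
    have "0 \<le> (norm x - K)\<^sup>2" by simp
    then have "2 * (norm x * K) \<le> (norm x)\<^sup>2 + K\<^sup>2"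
      by (simp add: power2_diff)
    with K[of x] show ?thesis
      by (simp add: J_def power2_norm_eq_inner[symmetric])
  qed
  define m where "m = Inf (range J)"
  have bdd: "bdd_below (range J)"
    by (rule bdd_belowI2, rule lower)
  have m_le: "m \<le> J x" for x
    unfolding m_def by (rule cInf_lower[OF _ bdd]) auto
  have "\<exists>x. J x < m + 1 / real (Suc n)" for n
    using cInf_lessD[of "range J" "m + 1 / real (Suc n)"] unfolding m_def by auto
  then obtain u where u: "\<And>n. J (u n) < m + 1 / real (Suc n)"
    by metis
  have par: "(norm (x - y))\<^sup>2 = 2 * (J x + J y - 2 * J ((1/2) *\<^sub>R (x + y)))" for x y
    unfolding J_def power2_norm_eq_inner
    by (simp add: f.add f.scaleR inner_add_left inner_add_right inner_diff_left
        inner_diff_right inner_commute field_simps)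
  have close: "(norm (u i - u j))\<^sup>2 \<le> 4 / real (Suc N)" if "i \<ge> N" "j \<ge> N" for i j N
  proof -
    have "1 / real (Suc i) \<le> 1 / real (Suc N)" "1 / real (Suc j) \<le> 1 / real (Suc N)"
      using that by (auto intro!: divide_left_mono)
    then show ?thesis
      unfolding par using u[of i] u[of j] m_le[of "(1/2) *\<^sub>R (u i + u j)"] by simp
  qed
  have "Cauchy u"
  proof (rule CauchyI)
    fix e :: real assume "0 < e"
    then obtain N where N: "4 / e\<^sup>2 < real N"
      using reals_Archimedean2 by blast
    then have "4 / real (Suc N) < e\<^sup>2"
      using \<open>0 < e\<close> zero_less_power[of e 2] by (simp add: field_simps del: zero_less_power) (simp add: add_pos_pos add_strict_increasing)
    then have "\<forall>i\<ge>N. \<forall>j\<ge>N. norm (u i - u j) < e"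
      using close[of N] \<open>0 < e\<close> by (meson le_less_trans power2_less_imp_less less_imp_le)
    then show "\<exists>M. \<forall>m\<ge>M. \<forall>n\<ge>M. norm (u m - u n) < e" by blast
  qed
  then obtain y where y: "u \<longlonglongrightarrow> y"
    using Cauchy_convergent_iff convergent_def by blast
  have "(\<lambda>n. J (u n)) \<longlonglongrightarrow> J y"
    unfolding J_def by (intro tendsto_intros y f.tendsto)
  moreover have "(\<lambda>n. m + 1 / real (Suc n)) \<longlonglongrightarrow> m + 0"
    by (intro tendsto_intros LIMSEQ_Suc[OF lim_1_over_n])
  ultimately have Jy: "J y \<le> m"
    using LIMSEQ_le[of "\<lambda>n. J (u n)"] u by (force intro: less_imp_le)
  \<comment> \<open>the first variation of \<open>J\<close> vanishes at a minimiser\<close>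
  have "f h = inner y h" for h
  proof -
    define d where "d = inner y h - f h"
    have quad: "0 \<le> t\<^sup>2 * inner h h + 2 * t * d" for t
      using m_le[of "y + t *\<^sub>R h"] Jy unfolding J_def d_def
      by (simp add: f.add f.scaleR inner_add_left inner_add_right inner_commute
          power2_eq_square algebra_simps)
    have "d = 0"
    proof (cases "inner h h = 0")
      case True
      with quad[of "- d"] show ?thesis
        by (simp add: power2_eq_square[symmetric])
    next
      case False
      then have pos: "inner h h > 0" by simp
      have "t\<^sup>2 * inner h h + 2 * t * d = - (d\<^sup>2 / inner h h)" if "t = - d / inner h h" for t
        unfolding that using False by (simp add: field_simps power2_eq_square)
      with quad[of "- d / inner h h"] have "d\<^sup>2 / inner h h \<le> 0" by simp
      with pos show ?thesis
        by (auto simp: divide_le_0_iff simp del: inner_gt_zero_iff)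
    qed
    then show ?thesis by (simp add: d_def)
  qed
  then show ?thesis by (rule that)
qed

lemma clinear_opsI:
  "(\<And>c x. blinfun_apply T (c *\<^sub>C x) = c *\<^sub>C blinfun_apply T x) \<Longrightarrow> T \<in> clinear_ops"
  by (simp add: clinear_ops_def)

lemma clinear_opsD: "T \<in> clinear_ops \<Longrightarrow> blinfun_apply T (c *\<^sub>C x) = c *\<^sub>C blinfun_apply T x"
  by (simp add: clinear_ops_def)

lemma cinner_op_adj:
  fixes T :: "'a::chilbert_space \<Rightarrow>\<^sub>L 'b::chilbert_space"
  assumes "T \<in> clinear_ops"
  shows "cinner (op_adj T y) x = cinner y (T x)"
proof -
  have "\<exists>w. \<forall>x. inner y (T x) = inner w x" for y
    by (rule riesz_representation[of "\<lambda>x. inner y (T x)"])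
      (auto intro: bounded_linear_compose[OF bounded_linear_inner_right blinfun.bounded_linear_right])
  then obtain S where S: "\<And>y x. inner y (T x) = inner (S y) x"
    by metis
  have cS: "cinner (S y) x = cinner y (T x)" for y x
    by (rule complex_eqI) (simp_all add: Re_cinner Im_cinner S[symmetric] clinear_opsD[OF assms])
  have "bounded_linear S"
  proof (rule bounded_linear_intro[of _ "norm T"])
    show "S (y + z) = S y + S z" for y z
      by (rule cinner_ext_left) (simp add: cS cinner_add_left)
    show "S (r *\<^sub>R y) = r *\<^sub>R S y" for r y
      by (rule cinner_ext_left) (simp add: cS cinner_scaleR_left)
    show "norm (S y) \<le> norm y * norm T" for y
    proof -
      have "(norm (S y))\<^sup>2 = inner y (T (S y))"
        by (simp add: S power2_norm_eq_inner)
      also have "\<dots> \<le> norm y * (norm T * norm (S y))"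
        by (rule order.trans[OF norm_cauchy_schwarz mult_left_mono[OF norm_blinfun]]) simp
      finally have "norm (S y) * norm (S y) \<le> (norm y * norm T) * norm (S y)"
        by (simp add: power2_eq_square mult.assoc)
      then show ?thesis
        by (rule le_of_square_le) simp_all
    qed
  qed
  then have "\<forall>x y. cinner (blinfun_apply (Blinfun S) y) x = cinner y (T x)"
    by (simp add: bounded_linear_Blinfun_apply cS)
  then have "\<forall>x y. cinner (blinfun_apply (op_adj T) y) x = cinner y (T x)"
    unfolding op_adj_def
  proof (rule theI)
    fix R assume "\<forall>x y. cinner (blinfun_apply R y) x = cinner y (T x)"
    then have "cinner (blinfun_apply R y) x = cinner (S y) x" for x y
      by (simp add: cS)
    then have "blinfun_apply R y = S y" for y
      by (rule cinner_ext_left)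
    then show "R = Blinfun S"
      by (intro blinfun_eqI) (simp add: bounded_linear_Blinfun_apply[OF \<open>bounded_linear S\<close>])
  qed
  then show ?thesis by blast
qed

lemma op_adj_unique:
  assumes "T \<in> clinear_ops" "\<And>x y. cinner (blinfun_apply S y) x = cinner y (T x)"
  shows "op_adj T = S"
  by (rule blinfun_eqI, rule cinner_ext_left) (simp add: assms cinner_op_adj)

lemma cinner_op_adj_right:
  assumes "T \<in> clinear_ops"
  shows "cinner x (op_adj T y) = cinner (T x) y"
  unfolding cinner_commute[of x] cinner_commute[of "T x"] cinner_op_adj[OF assms] ..

lemma op_adj_clinear [intro]:
  assumes "T \<in> clinear_ops"
  shows "op_adj T \<in> clinear_ops"
  by (rule clinear_opsI, rule cinner_ext_left)
    (simp add: assms cinner_op_adj cinner_scaleC_left)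

lemma op_adj_op_adj:
  assumes "T \<in> clinear_ops"
  shows "op_adj (op_adj T) = T"
  by (rule op_adj_unique) (simp_all add: assms op_adj_clinear cinner_op_adj_right)

lemma clinear_compose [intro]:
  "S \<in> clinear_ops \<Longrightarrow> T \<in> clinear_ops \<Longrightarrow> S o\<^sub>L T \<in> clinear_ops"
  by (simp add: clinear_ops_def)

lemma op_adj_compose:
  assumes "S \<in> clinear_ops" "T \<in> clinear_ops"
  shows "op_adj (S o\<^sub>L T) = op_adj T o\<^sub>L op_adj S"
  by (rule op_adj_unique) (simp_all add: assms clinear_compose cinner_op_adj)

lemma op_adj_add:
  assumes "S \<in> clinear_ops" "T \<in> clinear_ops"
  shows "op_adj (S + T) = op_adj S + op_adj T"
  by (rule op_adj_unique)
    (use assms in \<open>auto simp: clinear_ops_def scaleC_add_right blinfun.add_left cinner_add_left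
      cinner_add_right cinner_op_adj\<close>)

lemma op_adj_scaleC:
  assumes "T \<in> clinear_ops"
  shows "op_adj (c *\<^sub>C T) = cnj c *\<^sub>C op_adj T"
  by (rule op_adj_unique)
    (use assms in \<open>auto simp: clinear_ops_def scaleC_blinfun_apply cinner_scaleC_left
      cinner_scaleC_right cinner_op_adj scaleC_scaleC mult.commute\<close>)

lemma id_clinear [simp, intro]: "id_blinfun \<in> clinear_ops"
  by (simp add: clinear_ops_def)

lemma op_adj_id [simp]: "op_adj id_blinfun = id_blinfun"
  by (rule op_adj_unique) simp_all

lemma norm_op_adj_le:
  assumes "T \<in> clinear_ops"
  shows "norm (op_adj T) \<le> norm T"
proof (rule norm_blinfun_bound)
  fix y
  have "(norm (op_adj T y))\<^sup>2 = Re (cinner y (T (op_adj T y)))"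
    by (simp add: cinner_op_adj[OF assms, symmetric] Re_cinner power2_norm_eq_inner)
  also have "\<dots> \<le> norm y * (norm T * norm (op_adj T y))"
    unfolding Re_cinner
    by (rule order.trans[OF norm_cauchy_schwarz mult_left_mono[OF norm_blinfun]]) simp
  finally have "norm (op_adj T y) * norm (op_adj T y) \<le> (norm T * norm y) * norm (op_adj T y)"
    by (simp add: power2_eq_square algebra_simps)
  then show "norm (op_adj T y) \<le> norm T * norm y"
    by (rule le_of_square_le) simp_all
qed simp

lemma norm_op_adj:
  assumes "T \<in> clinear_ops"
  shows "norm (op_adj T) = norm T"
  using norm_op_adj_le[OF assms] norm_op_adj_le[OF op_adj_clinear[OF assms]]
  by (simp add: op_adj_op_adj[OF assms])

lemma norm_adj_compose_self:
  assumes "T \<in> clinear_ops"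
  shows "norm (op_adj T o\<^sub>L T) = (norm T)\<^sup>2"
proof (rule order_antisym)
  show "norm (op_adj T o\<^sub>L T) \<le> (norm T)\<^sup>2"
    using norm_blinfun_compose[of "op_adj T" T] by (simp add: norm_op_adj assms power2_eq_square)
  have "norm T \<le> sqrt (norm (op_adj T o\<^sub>L T))"
  proof (rule norm_blinfun_bound)
    fix x
    have "(norm (T x))\<^sup>2 = Re (cinner x ((op_adj T o\<^sub>L T) x))"
      by (simp add: cinner_op_adj_right assms Re_cinner power2_norm_eq_inner)
    also have "\<dots> \<le> norm x * (norm (op_adj T o\<^sub>L T) * norm x)"
      unfolding Re_cinner
      by (rule order.trans[OF norm_cauchy_schwarz mult_left_mono[OF norm_blinfun]]) simp
    finally have "(norm (T x))\<^sup>2 \<le> (sqrt (norm (op_adj T o\<^sub>L T)) * norm x)\<^sup>2"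
      by (simp add: power2_eq_square algebra_simps)
    then show "norm (T x) \<le> sqrt (norm (op_adj T o\<^sub>L T)) * norm x"
      by (rule power2_le_imp_le) simp
  qed simp
  then show "(norm T)\<^sup>2 \<le> norm (op_adj T o\<^sub>L T)"
    using power_mono[of "norm T" _ 2] by fastforce
qed

section \<open>Strong limits, order and normality\<close>

lemma limitin_strong_operator_topology:
  "limitin strong_operator_topology T q F \<longleftrightarrow> (\<forall>h. ((\<lambda>n. blinfun_apply (T n) h) \<longlongrightarrow> q h) F)"
proof
  assume "limitin strong_operator_topology T q F"
  then show "\<forall>h. ((\<lambda>n. blinfun_apply (T n) h) \<longlongrightarrow> q h) F"
    using continuous_map_limit[OF strong_operator_topology_continuous_evaluation]
    by (fastforce simp: o_def)
next
  assume *: "\<forall>h. ((\<lambda>n. blinfun_apply (T n) h) \<longlongrightarrow> q h) F"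
  have "limitin euclidean (\<lambda>n. blinfun_apply (T n)) (blinfun_apply q) F"
    unfolding euclidean_product_topology[symmetric] limitin_componentwise using * by simp
  then have lim: "((\<lambda>n. blinfun_apply (T n)) \<longlongrightarrow> blinfun_apply q) F"
    by simp
  show "limitin strong_operator_topology T q F"
    unfolding limitin_def
  proof (intro conjI allI impI)
    fix U assume "openin strong_operator_topology U \<and> q \<in> U"
    then obtain W where "open W" "U = blinfun_apply -` W" "blinfun_apply q \<in> W"
      by (auto simp: strong_operator_topology_def openin_pullback_topology)
    then show "\<forall>\<^sub>F n in F. T n \<in> U"
      using topological_tendstoD[OF lim] by auto
  qed (simp add: strong_operator_topology_topspace)
qed

lemma sot_limit_eqI:
  assumes "\<And>h. (\<lambda>n. blinfun_apply (T n) h) \<longlonglongrightarrow> blinfun_apply q h"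
  shows "sot_limit T = q"
  unfolding sot_limit_def limitin_strong_operator_topology
  using assms by (intro the_equality) (auto intro!: blinfun_eqI intro: LIMSEQ_unique)

lemma von_neumann_algebra_limit:
  assumes "von_neumann_algebra M" "\<And>n. T n \<in> M"
    and "\<And>h. (\<lambda>n. blinfun_apply (T n) h) \<longlonglongrightarrow> blinfun_apply q h"
  shows "q \<in> M"
proof (rule limitin_closedin)
  show "limitin strong_operator_topology T q sequentially"
    using assms(3) by (simp add: limitin_strong_operator_topology)
qed (use assms in \<open>auto simp: von_neumann_algebra_def\<close>)

lemma von_neumann_algebra_complete:
  assumes "von_neumann_algebra M"
  shows "complete M"
  unfolding complete_eq_closed closed_sequential_limits
  using von_neumann_algebra_limit[OF assms] blinfun.tendsto[OF _ tendsto_const] by metis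

lemma pointwise_limit_blinfun:
  fixes T :: "nat \<Rightarrow> ('a::real_normed_vector \<Rightarrow>\<^sub>L 'b::real_normed_vector)"
  assumes "\<And>h. convergent (\<lambda>n. T n h)" "\<And>n. norm (T n) \<le> K"
  obtains Q where "\<And>h. (\<lambda>n. T n h) \<longlonglongrightarrow> blinfun_apply Q h"
proof -
  define L where "L h = lim (\<lambda>n. T n h)" for h
  have L: "(\<lambda>n. T n h) \<longlonglongrightarrow> L h" for h
    using assms(1) unfolding L_def by (rule convergent_LIMSEQ_iff[THEN iffD1])
  have "bounded_linear L"
  proof (rule bounded_linear_intro[of _ K])
    show "L (x + y) = L x + L y" for x y
      using tendsto_add[OF L[of x] L[of y]]
      by (intro LIMSEQ_unique[OF L[of "x + y"]]) (simp add: blinfun.add_right)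
    show "L (r *\<^sub>R x) = r *\<^sub>R L x" for r x
      using tendsto_scaleR[OF tendsto_const L[of x], of r]
      by (intro LIMSEQ_unique[OF L[of "r *\<^sub>R x"]]) (simp add: blinfun.scaleR_right)
    show "norm (L x) \<le> norm x * K" for x
    proof (rule Lim_bounded[OF tendsto_norm[OF L[of x]]])
      show "\<forall>n\<ge>0. norm (T n x) \<le> norm x * K"
        using norm_blinfun[of "T _" x] assms(2) mult_right_mono[OF assms(2), of "norm x"]
        by (metis mult.commute norm_ge_zero order.trans)
    qed
  qed
  then show ?thesis
    using that[of "Blinfun L"] L by (simp add: bounded_linear_Blinfun_apply)
qed

lemma norm_pointwise_limit_le:
  assumes "\<And>h. (\<lambda>n. blinfun_apply (T n) h) \<longlonglongrightarrow> blinfun_apply Q h" "\<And>n. norm (T n) \<le> K"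
  shows "norm Q \<le> K"
proof (rule norm_blinfun_bound)
  show "norm (Q x) \<le> K * norm x" for x
    by (rule Lim_bounded[OF tendsto_norm[OF assms(1)]])
      (meson assms(2) mult_right_mono norm_blinfun norm_ge_zero order.trans)
  show "0 \<le> K"
    using assms(2) norm_ge_zero order.trans by blast
qed

lemma op_positive_iff:
  "op_positive T \<longleftrightarrow> T \<in> clinear_ops \<and> (\<forall>h. Re (cinner h (T h)) \<ge> 0 \<and> Im (cinner h (T h)) = 0)"
  by (simp add: op_positive_def complex_nonneg_Reals_iff)

lemma clinear_diff [intro]: "S \<in> clinear_ops \<Longrightarrow> T \<in> clinear_ops \<Longrightarrow> S - T \<in> clinear_ops"
  by (simp add: clinear_ops_def blinfun.diff_left complex_vector.scale_right_diff_distrib)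

lemma op_ext_quadratic:
  fixes S T :: "'a::chilbert_space \<Rightarrow>\<^sub>L 'a"
  assumes "S \<in> clinear_ops" "T \<in> clinear_ops" "\<And>h. cinner h (S h) = cinner h (T h)"
  shows "S = T"
proof -
  define D where "D = S - T"
  have D: "D \<in> clinear_ops"
    using assms by (auto simp: D_def)
  have zero: "cinner h (D h) = 0" for h
    by (simp add: D_def blinfun.diff_left cinner_diff_right assms(3))
  have "cinner x (D y) = 0" for x y
  proof -
    have "cinner x (D y) + cinner y (D x) = 0"
      using zero[of "x + y"] zero[of x] zero[of y]
      by (simp add: blinfun.add_right cinner_add_left cinner_add_right add.commute)
    moreover have "\<i> * cinner x (D y) - \<i> * cinner y (D x) = 0"
      using zero[of "x + \<i> *\<^sub>C y"] zero[of x] zero[of y]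
      by (simp add: blinfun.add_right cinner_add_left cinner_add_right clinear_opsD[OF D]
          cinner_scaleC_left cinner_scaleC_right)
    then have "cinner x (D y) = cinner y (D x)"
      by simp
    ultimately show ?thesis by simp
  qed
  then have "D y = 0" for y
    using cinner_ext_right[of "D y" 0] by simp
  then show ?thesis
    by (intro blinfun_eqI) (simp add: D_def blinfun.diff_left)
qed

lemma op_positive_symmetric:
  assumes "op_positive T"
  shows "op_adj T = T"
proof (rule op_ext_quadratic)
  have T: "T \<in> clinear_ops"
    using assms by (simp add: op_positive_def)
  show "op_adj T \<in> clinear_ops" "T \<in> clinear_ops"
    using T by auto
  show "cinner h (op_adj T h) = cinner h (T h)" for h
  proof -
    have "cinner h (op_adj T h) = cnj (cinner h (T h))"
      using cinner_commute[of "T h" h] by (simp add: cinner_op_adj_right[OF T])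
    also have "\<dots> = cinner h (T h)"
      using assms by (simp add: op_positive_iff complex_eq_iff)
    finally show ?thesis .
  qed
qed

lemma op_le_antisym:
  assumes "op_le S T" "op_le T S"
  shows "S = T"
proof -
  have "T - S = 0"
  proof (rule op_ext_quadratic)
    show "T - S \<in> clinear_ops"
      using assms by (simp add: op_le_def op_positive_iff)
    show "0 \<in> clinear_ops"
      by (simp add: clinear_ops_def)
    show "cinner h ((T - S) h) = cinner h (blinfun_apply 0 h)" for h
      using assms unfolding op_le_def op_positive_iff
      by (intro complex_eqI) (simp_all add: blinfun.diff_left cinner_diff_right order_antisym)
  qed
  then show ?thesis by simp
qed

text \<open>Positivity of the form at \<open>h - t T h\<close> with \<open>t = 1 / K\<close> gives this
  Cauchy--Schwarz type bound, which turns convergence of the quadratic form into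
  strong convergence.\<close>

lemma op_positive_norm_sq_le:
  assumes "op_positive T" "norm T \<le> K"
  shows "(norm (T h))\<^sup>2 \<le> K * Re (cinner h (T h))"
proof (cases "K = 0")
  case True
  with assms show ?thesis by simp
next
  case False
  have "K > 0"
    using False assms(2) norm_ge_zero[of T] by linarith
  have sym: "cinner (T x) y = cinner x (T y)" for x y
    using assms(1) cinner_op_adj[of T x y] op_positive_symmetric[OF assms(1)]
    by (simp add: op_positive_def)
  define t where "t = 1 / K"
  define b where "b = (norm (T h))\<^sup>2"
  define v where "v = T h"
  have vv: "cinner v v = of_real b"
    by (simp add: v_def b_def cinner_same)
  have hv: "cinner h (T v) = of_real b"
    unfolding vv[symmetric] by (simp add: v_def sym)
  have "Re (cinner v (T v)) \<le> norm v * (norm T * norm v)"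
    unfolding Re_cinner
    by (rule order.trans[OF norm_cauchy_schwarz mult_left_mono[OF norm_blinfun]]) simp
  also have "\<dots> \<le> K * b"
    using mult_right_mono[OF assms(2), of b] by (simp add: b_def v_def power2_eq_square algebra_simps)
  finally have c: "Re (cinner v (T v)) \<le> K * b" .
  have "0 \<le> Re (cinner (h - t *\<^sub>R v) (T (h - t *\<^sub>R v)))"
    using assms(1) by (simp add: op_positive_iff)
  also have "\<dots> = Re (cinner h v) - 2 * t * b + t\<^sup>2 * Re (cinner v (T v))"
    by (simp add: blinfun.diff_right blinfun.scaleR_right cinner_diff_left cinner_diff_right
        cinner_scaleR_left cinner_scaleR_right hv v_def[symmetric] vv power2_eq_square algebra_simps)
  also have "\<dots> \<le> Re (cinner h v) - 2 * t * b + t\<^sup>2 * (K * b)"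
    using c by (intro add_left_mono mult_left_mono) auto
  also have "\<dots> = Re (cinner h v) - b / K"
    using \<open>K > 0\<close> by (simp add: t_def power2_eq_square field_simps)
  finally have "b \<le> K * Re (cinner h v)"
    using \<open>K > 0\<close> by (simp add: field_simps)
  then show ?thesis by (simp add: b_def v_def)
qed

lemma op_positive_limit:
  assumes "\<And>n. op_positive (T n)"
    and "\<And>h. (\<lambda>n. blinfun_apply (T n) h) \<longlonglongrightarrow> blinfun_apply q h"
  shows "op_positive q"
  unfolding op_positive_def
proof (intro conjI allI)
  show "q \<in> clinear_ops"
  proof (rule clinear_opsI)
    fix c x
    have "(\<lambda>n. T n (c *\<^sub>C x)) \<longlonglongrightarrow> c *\<^sub>C q x"
      using bounded_linear.tendsto[OF bounded_linear_scaleC assms(2)] assms(1)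
      by (simp add: op_positive_def clinear_opsD)
    with assms(2) show "q (c *\<^sub>C x) = c *\<^sub>C q x"
      by (rule LIMSEQ_unique)
  qed
  show "cinner h (q h) \<in> \<real>\<^sub>\<ge>\<^sub>0" for h
    by (rule closed_sequentially[OF closed_nonneg_Reals_complex _ tendsto_cinner_right[OF assms(2)]])
      (use assms(1) in \<open>simp add: op_positive_def\<close>)
qed

lemma op_positive_add:
  "op_positive S \<Longrightarrow> op_positive T \<Longrightarrow> op_positive (S + T)"
  by (simp add: op_positive_iff clinear_ops_def blinfun.add_left cinner_add_right scaleC_add_right)

lemma decreasing_op_tail:
  fixes T :: "nat \<Rightarrow> ('h::chilbert_space \<Rightarrow>\<^sub>L 'h)"
  assumes "\<And>n. T n \<in> clinear_ops" "\<And>n. op_le (T (Suc n)) (T n)" "m \<le> n"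
  shows "op_le (T n) (T m)"
  using assms(3)
proof (induction rule: dec_induct)
  case base
  then show ?case
    by (simp add: op_le_def op_positive_iff clinear_ops_def)
next
  case (step n)
  have "T m - T (Suc n) = (T m - T n) + (T n - T (Suc n))" by simp
  moreover have "op_positive ((T m - T n) + (T n - T (Suc n)))"
    using step(3) assms(2)[of n] unfolding op_le_def by (rule op_positive_add)
  ultimately show ?case
    unfolding op_le_def by simp
qed

text \<open>The quadratic forms decrease and are bounded below, hence converge; the bound on
\<open>\<parallel>T h\<parallel>\<^sup>2\<close> by the form, applied to the positive differences, turns this into strong convergence.\<close>

lemma decreasing_positive_convergent:
  fixes T :: "nat \<Rightarrow> ('h::chilbert_space \<Rightarrow>\<^sub>L 'h)"
  assumes pos: "\<And>n. op_positive (T n)" and dec: "\<And>n. op_le (T (Suc n)) (T n)"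
    and bound: "\<And>n. norm (T n) \<le> K"
  obtains Q where "\<And>h. (\<lambda>n. T n h) \<longlonglongrightarrow> blinfun_apply Q h"
proof -
  have "convergent (\<lambda>n. T n h)" for h
  proof -
    define a where "a n = Re (cinner h (T n h))" for n
    have tail: "op_le (T n) (T m)" if "m \<le> n" for m n
      using decreasing_op_tail[of T, OF _ dec that] pos by (simp add: op_positive_def)
    have "K \<ge> 0"
      using bound[of 0] norm_ge_zero order.trans by blast
    have "decseq a"
      using tail by (auto simp: decseq_def a_def op_le_def op_positive_iff blinfun.diff_left cinner_diff_right)
    moreover have "\<forall>n. 0 \<le> a n"
      using pos by (simp add: a_def op_positive_iff)
    ultimately obtain L where "a \<longlonglongrightarrow> L"
      using decseq_convergent by blast
    then have Ca: "Cauchy a"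
      by (rule LIMSEQ_imp_Cauchy)
    have diff: "(norm (T m h - T n h))\<^sup>2 \<le> 2 * K * (a m - a n)" if "m \<le> n" for m n
      using op_positive_norm_sq_le[of "T m - T n" "2 * K" h] tail[OF that] bound[of m] bound[of n]
        norm_triangle_ineq4[of "T m" "T n"]
      by (simp add: op_le_def blinfun.diff_left cinner_diff_right a_def)
    have "Cauchy (\<lambda>n. T n h)"
    proof (rule CauchyI')
      fix e :: real assume "0 < e"
      define d where "d = e\<^sup>2 / (2 * K + 1)"
      have "d > 0"
        using \<open>0 < e\<close> \<open>K \<ge> 0\<close> by (simp add: d_def)
      then obtain N where N: "\<And>m n. m \<ge> N \<Longrightarrow> n \<ge> N \<Longrightarrow> norm (a m - a n) < d"
        using CauchyD[OF Ca] by blast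
      have "norm (T m h - T n h) < e" if "m \<ge> N" "m < n" for m n
      proof -
        have "(norm (T m h - T n h))\<^sup>2 \<le> 2 * K * (a m - a n)"
          using diff that by simp
        also have "\<dots> \<le> 2 * K * d"
          using N[of m n] that \<open>K \<ge> 0\<close> by (intro mult_left_mono) auto
        also have "\<dots> < (2 * K + 1) * d"
          using \<open>d > 0\<close> by simp
        also have "\<dots> = e\<^sup>2"
          using \<open>K \<ge> 0\<close> by (simp add: d_def)
        finally show ?thesis
          using \<open>0 < e\<close> by (meson power2_less_imp_less less_imp_le)
      qed
      then show "\<exists>M. \<forall>m\<ge>M. \<forall>n>m. dist (T m h) (T n h) < e"
        unfolding dist_norm by blast
    qed
    then show ?thesis
      by (simp add: Cauchy_convergent_iff)
  qed
  then show ?thesis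
    using pointwise_limit_blinfun[of T, OF _ bound] that by blast
qed

lemma sigma_weak_limitD:
  assumes "limitin sigma_weak_topology X x sequentially"
  shows "(\<lambda>n. cinner h (blinfun_apply (X n) k)) \<longlonglongrightarrow> cinner h (x k)"
proof (rule topological_tendstoI)
  define \<xi> \<eta> where "\<xi> = (\<lambda>n::nat. if n = 0 then h else 0)"
    and "\<eta> = (\<lambda>n::nat. if n = 0 then k else 0)"
  have single: "(\<Sum>n. cinner (\<xi> n) (blinfun_apply T (\<eta> n))) = cinner h (T k)" for T
    by (subst suminf_finite[of "{0}"]) (auto simp: \<xi>_def \<eta>_def)
  fix S assume S: "open S" "cinner h (x k) \<in> S"
  have "summable (\<lambda>n. (norm (\<xi> n))\<^sup>2)" "summable (\<lambda>n. (norm (\<eta> n))\<^sup>2)"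
    by (rule summable_finite[of "{0}"]; simp add: \<xi>_def \<eta>_def)+
  then have "openin sigma_weak_topology
      {T. (\<Sum>n. cinner (\<xi> n) (blinfun_apply T (\<eta> n))) \<in> S}"
    unfolding sigma_weak_topology_def using S(1)
    by (intro topology_generated_by_Basis) blast
  from limitinD[OF assms this] S(2)
  show "\<forall>\<^sub>F n in sequentially. cinner h (X n k) \<in> S"
    by (simp add: single)
qed

text \<open>The terms of the series defining a \<open>\<sigma>\<close>-weak functional are dominated by
\<open>K (\<parallel>\<xi> k\<parallel>\<^sup>2 + \<parallel>\<eta> k\<parallel>\<^sup>2)\<close>, so that Tannery's theorem applies.\<close>

lemma sigma_weak_limitI:
  fixes X :: "nat \<Rightarrow> ('h::chilbert_space \<Rightarrow>\<^sub>L 'h)"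
  assumes bound: "\<And>n. norm (X n) \<le> K"
    and lim: "\<And>h. (\<lambda>n. X n h) \<longlonglongrightarrow> blinfun_apply x h"
  shows "limitin sigma_weak_topology X x sequentially"
proof -
  have basic: "(\<lambda>n. \<Sum>k. cinner (\<xi> k) (X n (\<eta> k))) \<longlonglongrightarrow> (\<Sum>k. cinner (\<xi> k) (x (\<eta> k)))"
    if "summable (\<lambda>n::nat. (norm (\<xi> n))\<^sup>2)" "summable (\<lambda>n. (norm (\<eta> n))\<^sup>2)" for \<xi> \<eta>
  proof -
    have le: "cmod (cinner (\<xi> k) (X n (\<eta> k))) \<le> K * ((norm (\<xi> k))\<^sup>2 + (norm (\<eta> k))\<^sup>2)" for k n
    proof -
      have "cmod (cinner (\<xi> k) (X n (\<eta> k))) \<le> norm (\<xi> k) * (K * norm (\<eta> k))"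
        by (meson bound cmod_cinner_le mult_left_mono mult_right_mono norm_blinfun norm_ge_zero
            order.trans)
      also have "\<dots> = K * (norm (\<xi> k) * norm (\<eta> k))" by simp
      also have "\<dots> \<le> K * ((norm (\<xi> k))\<^sup>2 + (norm (\<eta> k))\<^sup>2)"
      proof (rule mult_left_mono)
        show "0 \<le> K"
          using bound norm_ge_zero order.trans by blast
        show "norm (\<xi> k) * norm (\<eta> k) \<le> (norm (\<xi> k))\<^sup>2 + (norm (\<eta> k))\<^sup>2"
          using zero_le_power2[of "norm (\<xi> k) - norm (\<eta> k)"]
            mult_nonneg_nonneg[OF norm_ge_zero[of "\<xi> k"] norm_ge_zero[of "\<eta> k"]]
          unfolding power2_diff by linarith
      qed
      finally show ?thesis .
    qed
    then have "eventually (\<lambda>(k,n). norm (cinner (\<xi> k) (X n (\<eta> k)))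
        \<le> K * ((norm (\<xi> k))\<^sup>2 + (norm (\<eta> k))\<^sup>2)) (at_top \<times>\<^sub>F sequentially)"
      by (intro always_eventually) auto
    then show ?thesis
      using tannerys_theorem[of "\<lambda>k n. cinner (\<xi> k) (X n (\<eta> k))", OF tendsto_cinner_right[OF lim]]
        summable_mult[OF summable_add[OF that]] by simp
  qed
  have "\<forall>\<^sub>F n in sequentially. X n \<in> U"
    if "openin sigma_weak_topology U" "x \<in> U" for U
    using openin_topology_generated_by[OF that(1)[unfolded sigma_weak_topology_def]] that(2)
  proof (induction)
    case (Int a b)
    then show ?case by (auto intro: eventually_conj)
  next
    case (UN W)
    then obtain k where "k \<in> W" "\<forall>\<^sub>F n in sequentially. X n \<in> k" by blast
    then show ?case by (auto elim: eventually_mono)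
  next
    case (Basis s)
    then show ?case
      using topological_tendstoD[OF basic] by auto
  qed simp
  moreover have "x \<in> topspace sigma_weak_topology"
    unfolding sigma_weak_topology_def topology_generated_by_topspace
    by (intro UnionI[of UNIV] CollectI exI[of _ "\<lambda>_. 0"] exI[of _ UNIV]) auto
  ultimately show ?thesis
    by (simp add: limitin_def)
qed

text \<open>On bounded sequences strong convergence implies \<open>\<sigma>\<close>-weak convergence, so a normal
  map respects strong limits of bounded sequences as soon as the images converge.\<close>

lemma normal_on_limit:
  assumes "normal_on M f" "\<And>n. X n \<in> M" "\<And>n. norm (X n) \<le> K"
    and "\<And>h. (\<lambda>n. X n h) \<longlonglongrightarrow> blinfun_apply x h" "x \<in> M"
    and "\<And>h. (\<lambda>n. f (X n) h) \<longlonglongrightarrow> blinfun_apply y h"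
  shows "f x = y"
proof -
  have "limitin (subtopology sigma_weak_topology M) X x sequentially"
    using sigma_weak_limitI[OF assms(3,4)] assms(2,5) by (simp add: limitin_subtopology)
  then have "limitin sigma_weak_topology (f \<circ> X) (f x) sequentially"
    using assms(1) unfolding normal_on_def by (rule continuous_map_limit[rotated])
  then have "(\<lambda>n. cinner h (f (X n) k)) \<longlonglongrightarrow> cinner h (f x k)" for h k
    using sigma_weak_limitD by fastforce
  moreover have "(\<lambda>n. cinner h (f (X n) k)) \<longlonglongrightarrow> cinner h (y k)" for h k
    by (rule tendsto_cinner_right[OF assms(6)])
  ultimately have "cinner h (f x k) = cinner h (y k)" for h k
    by (rule LIMSEQ_unique)
  then show ?thesis
    by (intro blinfun_eqI) (rule cinner_ext_right)
qed

section \<open>Contractivity of endomorphisms\<close>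

lemma scaleC_compose_left: "(c *\<^sub>C S) o\<^sub>L T = c *\<^sub>C (S o\<^sub>L T)"
  by (rule blinfun_eqI) (simp add: scaleC_blinfun_apply)

lemma scaleC_compose_right: "S \<in> clinear_ops \<Longrightarrow> S o\<^sub>L (c *\<^sub>C T) = c *\<^sub>C (S o\<^sub>L T)"
  by (rule blinfun_eqI) (simp add: scaleC_blinfun_apply clinear_opsD)

lemmas compose_add_left = bounded_bilinear.add_left[OF bounded_bilinear_blinfun_compose]
  and compose_add_right = bounded_bilinear.add_right[OF bounded_bilinear_blinfun_compose]
  and compose_diff_left = bounded_bilinear.diff_left[OF bounded_bilinear_blinfun_compose]
  and compose_diff_right = bounded_bilinear.diff_right[OF bounded_bilinear_blinfun_compose]
  and compose_zero_left = bounded_bilinear.zero_left[OF bounded_bilinear_blinfun_compose]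
  and compose_zero_right = bounded_bilinear.zero_right[OF bounded_bilinear_blinfun_compose]
  and tendsto_compose = bounded_bilinear.tendsto[OF bounded_bilinear_blinfun_compose]

lemma compose_assoc: "(R o\<^sub>L S) o\<^sub>L T = R o\<^sub>L (S o\<^sub>L T)"
  by (rule blinfun_eqI) simp

lemma compose_id [simp]: "id_blinfun o\<^sub>L T = T" "T o\<^sub>L id_blinfun = T"
  by (rule blinfun_eqI, simp)+

lemma clinear_onD:
  assumes "clinear_on M f"
  shows clinear_on_add: "x \<in> M \<Longrightarrow> y \<in> M \<Longrightarrow> f (x + y) = f x + f y"
    and clinear_on_scaleC: "x \<in> M \<Longrightarrow> f (c *\<^sub>C x) = c *\<^sub>C f x"
  using assms by (auto simp: clinear_on_def)

lemma clinear_on_diff: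
  assumes "clinear_on M f" "csubspace M" "x \<in> M" "y \<in> M"
  shows "f (x - y) = f x - f y"
proof -
  have "f (x + (- 1) *\<^sub>C y) = f x + f ((- 1) *\<^sub>C y)"
    by (rule clinear_on_add[OF assms(1,3) complex_vector.subspace_scale[OF assms(2,4)]])
  also have "f ((- 1) *\<^sub>C y) = (- 1) *\<^sub>C f y"
    by (rule clinear_on_scaleC[OF assms(1,4)])
  finally show ?thesis
    by simp
qed

lemma funpow_mem: "f ` M \<subseteq> M \<Longrightarrow> x \<in> M \<Longrightarrow> (f ^^ n) x \<in> M"
  by (induction n) auto

lemma clinear_on_funpow:
  assumes "clinear_on M f" "f ` M \<subseteq> M"
  shows "clinear_on M (f ^^ n)"
proof (induction n)
  case (Suc n)
  then show ?case
    using assms funpow_mem[OF assms(2)] unfolding clinear_on_def by simp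
qed (simp add: clinear_on_def)

lemma funpow_eigenvector:
  assumes "clinear_on M f" "x \<in> M" "f x = z *\<^sub>C x"
  shows "(f ^^ n) x = z ^ n *\<^sub>C x"
  by (induction n) (simp_all add: assms clinear_on_scaleC[OF assms(1)] scaleC_scaleC mult.commute)

lemma norm_diff_sq:
  "(norm (a - b))\<^sup>2 = (norm a)\<^sup>2 - 2 * inner a b + (norm (b :: 'a :: real_inner))\<^sup>2"
  unfolding power2_norm_eq_inner by (simp add: inner_diff_left inner_diff_right inner_commute)

text \<open>Let \<open>y = \<theta>(x)\<close> and suppose \<open>\<parallel>y\<parallel> > \<parallel>x\<parallel>\<close>. Then
\<open>w = x\<^sup>* x / \<parallel>y\<parallel>\<^sup>2\<close> has norm less than 1, so \<open>1 - w\<close> is invertible in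
\<open>M\<close> and \<open>\<theta>(1) - \<theta>(w)\<close> is invertible in the corner of \<open>\<theta>(1)\<close>. But
\<open>\<theta>(w) = y\<^sup>* y / \<parallel>y\<parallel>\<^sup>2\<close>, and \<open>1 - \<theta>(w)\<close> is small on vectors that
nearly attain the norm of \<open>y\<close>. The proof makes this quantitative: with \<open>C\<close> the product
of the norms of \<open>y\<close> and of the image of the inverse, it gives
\<open>\<parallel>y\<parallel>\<^sup>2 + C\<^sup>2 \<le> C\<^sup>2\<close>.\<close>

lemma star_endomorphism_contractive:
  assumes M: "von_neumann_algebra M" and \<theta>: "normal_star_endomorphism M \<theta>" and x: "x \<in> M"
  shows "norm (\<theta> x) \<le> norm x"
proof (rule ccontr)
  assume "\<not> norm (\<theta> x) \<le> norm x"
  define y where "y = \<theta> x"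
  define t where "t = inverse ((norm y)\<^sup>2)"
  define w where "w = complex_of_real t *\<^sub>C (op_adj x o\<^sub>L x)"
  have less: "norm x < norm y" and ny: "norm y > 0"
    using \<open>\<not> norm (\<theta> x) \<le> norm x\<close> norm_ge_zero[of x] unfolding y_def by linarith+
  have sub: "csubspace M" and M_lin: "M \<subseteq> clinear_ops" and one: "id_blinfun \<in> M"
    and mult: "\<And>a b. a \<in> M \<Longrightarrow> b \<in> M \<Longrightarrow> a o\<^sub>L b \<in> M"
    and adj: "\<And>a. a \<in> M \<Longrightarrow> op_adj a \<in> M"
    using M by (auto simp: von_neumann_algebra_def)
  have lin: "clinear_on M \<theta>" and \<theta>M: "\<And>a. a \<in> M \<Longrightarrow> \<theta> a \<in> M"
    and \<theta>mult: "\<And>a b. a \<in> M \<Longrightarrow> b \<in> M \<Longrightarrow> \<theta> (a o\<^sub>L b) = \<theta> a o\<^sub>L \<theta> b"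
    and \<theta>adj: "\<And>a. a \<in> M \<Longrightarrow> \<theta> (op_adj a) = op_adj (\<theta> a)"
    using \<theta> by (auto simp: normal_star_endomorphism_def)
  have tpos: "t > 0"
    using ny by (simp add: t_def)
  have t1: "t * (norm y)\<^sup>2 = 1"
    using ny by (simp add: t_def)
  have wM: "w \<in> M"
    unfolding w_def by (intro complex_vector.subspace_scale[OF sub] mult adj x)
  have "norm w = t * (norm x)\<^sup>2"
    using tpos norm_adj_compose_self[of x] M_lin x by (simp add: w_def norm_scaleC subset_iff)
  also have "\<dots> < t * (norm y)\<^sup>2"
    using less tpos by (intro mult_strict_left_mono power_strict_mono) auto
  finally have nw: "norm w < 1"
    using ny by (simp add: t_def)
  \<comment> \<open>the inverse of \<open>1 - w\<close> in \<open>M\<close>\<close>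
  have "\<exists>!g\<in>M. id_blinfun + (g o\<^sub>L w) = g"
  proof (rule Banach_fix[where c = "norm w"])
    show "complete M"
      by (rule von_neumann_algebra_complete[OF M])
    show "(\<lambda>g. id_blinfun + (g o\<^sub>L w)) ` M \<subseteq> M"
      by (auto intro: complex_vector.subspace_add[OF sub] one mult wM)
    show "dist (id_blinfun + (a o\<^sub>L w)) (id_blinfun + (b o\<^sub>L w)) \<le> norm w * dist a b" for a b
      using norm_blinfun_compose[of "a - b" w]
      by (simp add: dist_norm compose_diff_left mult.commute)
  qed (use one nw in auto)
  then obtain g where g: "g \<in> M" "id_blinfun + (g o\<^sub>L w) = g"
    by blast
  have "\<theta> w = complex_of_real t *\<^sub>C (op_adj y o\<^sub>L y)"
    by (simp add: w_def y_def clinear_on_scaleC[OF lin] \<theta>mult \<theta>adj mult adj x)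
  moreover have "\<theta> g = \<theta> id_blinfun + (\<theta> g o\<^sub>L \<theta> w)"
    using arg_cong[OF g(2), of \<theta>] by (simp add: clinear_on_add[OF lin] \<theta>mult one g(1) mult wM)
  ultimately have inv: "\<theta> g h = \<theta> id_blinfun h + \<theta> g (t *\<^sub>R (op_adj y (y h)))" for h
    by (metis blinfun_apply_blinfun_compose plus_blinfun.rep_eq scaleC_blinfun_apply scaleC_of_real)
  have y: "y \<in> clinear_ops"
    using \<theta>M[OF x] M_lin by (auto simp: y_def)
  have y_one: "y (\<theta> id_blinfun h) = y h" for h
    using \<theta>mult[OF x one] by (metis blinfun_apply_blinfun_compose compose_id(2) y_def)
  define C where "C = norm y * norm (\<theta> g)"
  have est: "(norm (y h))\<^sup>2 \<le> C\<^sup>2 * ((norm h)\<^sup>2 - t * (norm (y h))\<^sup>2)" for h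
  proof -
    define k where "k = h - t *\<^sub>R (op_adj y (y h))"
    have "\<theta> id_blinfun h = \<theta> g k"
      using inv[of h] by (simp add: k_def blinfun.diff_right)
    then have "norm (y h) \<le> norm y * (norm (\<theta> g) * norm k)"
      using y_one[of h] by (metis mult_left_mono norm_blinfun norm_ge_zero order.trans)
    then have "(norm (y h))\<^sup>2 \<le> C\<^sup>2 * (norm k)\<^sup>2"
      using power_mono[of "norm (y h)" "C * norm k" 2]
      by (simp add: C_def power_mult_distrib mult.assoc)
    moreover have "(norm k)\<^sup>2 \<le> (norm h)\<^sup>2 - t * (norm (y h))\<^sup>2"
    proof -
      have "norm (op_adj y (y h)) \<le> norm y * norm (y h)"
        using norm_blinfun[of "op_adj y" "y h"] by (simp add: norm_op_adj[OF y])
      then have "(norm (op_adj y (y h)))\<^sup>2 \<le> (norm y)\<^sup>2 * (norm (y h))\<^sup>2"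
        using power_mono[of _ "norm y * norm (y h)" 2] by (simp add: power_mult_distrib)
      then have "t\<^sup>2 * (norm (op_adj y (y h)))\<^sup>2 \<le> t\<^sup>2 * ((norm y)\<^sup>2 * (norm (y h))\<^sup>2)"
        by (rule mult_left_mono) simp
      also have "\<dots> = t * (norm (y h))\<^sup>2"
        using t1 by (metis mult.assoc mult.commute mult_1 power2_eq_square)
      finally have "t\<^sup>2 * (norm (op_adj y (y h)))\<^sup>2 \<le> t * (norm (y h))\<^sup>2" .
      moreover have "inner h (op_adj y (y h)) = (norm (y h))\<^sup>2"
        using cinner_op_adj_right[OF y, of h "y h"]
        by (metis Re_cinner power2_norm_eq_inner)
      then have "(norm k)\<^sup>2 = (norm h)\<^sup>2 - 2 * t * (norm (y h))\<^sup>2 + t\<^sup>2 * (norm (op_adj y (y h)))\<^sup>2"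
        unfolding k_def norm_diff_sq by (simp add: power_mult_distrib)
      ultimately show ?thesis by simp
    qed
    ultimately show ?thesis
      by (meson mult_left_mono order.trans zero_le_power2)
  qed
  define s where "s = C\<^sup>2 / (1 + C\<^sup>2 * t)"
  have den: "1 + C\<^sup>2 * t > 0"
    using tpos by (simp add: add_pos_nonneg)
  have "norm y \<le> sqrt s"
  proof (rule norm_blinfun_bound)
    fix h
    have "(norm (y h))\<^sup>2 * (1 + C\<^sup>2 * t) \<le> C\<^sup>2 * (norm h)\<^sup>2"
      using est[of h] by (simp add: algebra_simps)
    then have "(norm (y h))\<^sup>2 \<le> s * (norm h)\<^sup>2"
      using den by (simp add: s_def field_simps)
    then show "norm (y h) \<le> sqrt s * norm h"
      using real_le_rsqrt[of "norm (y h)" "s * (norm h)\<^sup>2"] by (simp add: real_sqrt_mult)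
  qed (use den in \<open>simp add: s_def\<close>)
  then have "(norm y)\<^sup>2 \<le> s"
    using den power_mono[of "norm y" "sqrt s" 2] by (simp add: s_def)
  then have "(norm y)\<^sup>2 * (1 + C\<^sup>2 * t) \<le> C\<^sup>2"
    using den by (simp add: s_def field_simps)
  moreover have "(norm y)\<^sup>2 * (1 + C\<^sup>2 * t) = (norm y)\<^sup>2 + C\<^sup>2"
    using ny by (simp add: t_def algebra_simps)
  ultimately show False
    using ny by simp
qed

section \<open>Iterates of a contractive completely positive map\<close>

lemma Re_cinner_le_norm:
  fixes x :: "'h::chilbert_space \<Rightarrow>\<^sub>L 'h"
  shows "Re (cinner h (blinfun_apply x h)) \<le> norm x * (norm h)\<^sup>2"
proof -
  have "Re (cinner h (x h)) \<le> norm h * (norm x * norm h)"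
    unfolding Re_cinner
    by (rule order.trans[OF norm_cauchy_schwarz mult_left_mono[OF norm_blinfun]]) simp
  then show ?thesis
    by (simp add: power2_eq_square algebra_simps)
qed

lemma op_le_id:
  fixes x :: "'h::chilbert_space \<Rightarrow>\<^sub>L 'h"
  assumes "op_positive x" "norm x \<le> 1"
  shows "op_le x id_blinfun"
  unfolding op_le_def op_positive_iff
proof (intro conjI allI)
  show "id_blinfun - x \<in> clinear_ops"
    using assms by (auto simp: op_positive_def)
  fix h :: 'h
  have "norm x * (norm h)\<^sup>2 \<le> (norm h)\<^sup>2"
    using assms(2) by (simp add: mult_left_le_one_le)
  then show "0 \<le> Re (cinner h ((id_blinfun - x) h))"
    using Re_cinner_le_norm[of h x]
    by (simp add: blinfun.diff_left cinner_diff_right cinner_same)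
  show "Im (cinner h ((id_blinfun - x) h)) = 0"
    using assms by (simp add: blinfun.diff_left cinner_diff_right cinner_same op_positive_iff)
qed

locale contractive_cp_map =
  fixes A :: "('h::chilbert_space \<Rightarrow>\<^sub>L 'h) set" and \<tau>
  assumes vN: "von_neumann_algebra A" and cp: "contractive_normal_cp A \<tau>"
begin

lemma A_clinear: "A \<subseteq> clinear_ops" and A_subspace: "csubspace A" and A_one: "id_blinfun \<in> A"
  and A_adj: "x \<in> A \<Longrightarrow> op_adj x \<in> A"
  using vN by (auto simp: von_neumann_algebra_def)

lemma \<tau>_image: "\<tau> ` A \<subseteq> A" and \<tau>_linear: "clinear_on A \<tau>" and \<tau>_normal: "normal_on A \<tau>"
  and norm_\<tau>_le: "x \<in> A \<Longrightarrow> norm (\<tau> x) \<le> norm x"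
  using cp by (auto simp: contractive_normal_cp_def)

lemmas iter_mem = funpow_mem[OF \<tau>_image]
  and iter_linear = clinear_on_funpow[OF \<tau>_linear \<tau>_image]

lemmas iter_diff = clinear_on_diff[OF iter_linear A_subspace]

lemma norm_iter_le:
  assumes "x \<in> A"
  shows "norm ((\<tau> ^^ n) x) \<le> norm x"
  by (induction n) (auto intro: order.trans[OF norm_\<tau>_le] iter_mem assms)

lemma matrix_positive_iter:
  assumes "\<forall>i<m. \<forall>j<m. a i j \<in> A" "matrix_positive m a"
  shows "matrix_positive m (\<lambda>i j. (\<tau> ^^ n) (a i j))"
proof (induction n)
  case (Suc n)
  have "\<forall>i<m. \<forall>j<m. (\<tau> ^^ n) (a i j) \<in> A"
    using assms(1) iter_mem by blast
  with Suc cp show ?case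
    unfolding contractive_normal_cp_def completely_positive_on_def by simp
qed (use assms in simp)

lemma op_positive_iter:
  assumes "x \<in> A" "op_positive x"
  shows "op_positive ((\<tau> ^^ n) x)"
  unfolding op_positive_def
proof (intro conjI allI)
  show "(\<tau> ^^ n) x \<in> clinear_ops"
    using iter_mem[OF assms(1)] A_clinear by blast
  fix h
  have "matrix_positive (Suc 0) (\<lambda>i j. x)"
    using assms(2) by (simp add: matrix_positive_def op_positive_def)
  then have "matrix_positive (Suc 0) (\<lambda>i j. (\<tau> ^^ n) x)"
    using matrix_positive_iter[of "Suc 0" "\<lambda>i j. x"] assms(1) by simp
  then show "cinner h ((\<tau> ^^ n) x h) \<in> \<real>\<^sub>\<ge>\<^sub>0"
    unfolding matrix_positive_def by (auto dest: spec[of _ "\<lambda>_. h"])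
qed

lemma op_le_iter:
  assumes "x \<in> A" "y \<in> A" "op_le x y"
  shows "op_le ((\<tau> ^^ n) x) ((\<tau> ^^ n) y)"
  using op_positive_iter[of "y - x" n] assms
  by (simp add: op_le_def iter_diff complex_vector.subspace_diff[OF A_subspace])

lemma op_positive_id: "op_positive id_blinfun"
  by (simp add: op_positive_iff cinner_same)

text \<open>Complete positivity is applied to the positive matrix \<open>a\<close> with diagonal entries
\<open>\<parallel>x\<parallel>\<close> and off-diagonal entries \<open>x\<close>, \<open>x\<^sup>*\<close>. Evaluating the
image on the pair of \<open>h\<close> and \<open>z k\<close> for the four unimodular numbers
\<open>\<plusminus> 1, \<plusminus> \<i>\<close> separates the contribution of \<open>\<tau>\<^sup>n(x)\<close> from that
of \<open>\<tau>\<^sup>n(x\<^sup>*)\<close>.\<close>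

lemma cmod_cinner_iter_le:
  assumes x: "x \<in> A"
  shows "cmod (cinner h ((\<tau> ^^ n) x k))
    \<le> norm x * (Re (cinner h ((\<tau> ^^ n) id_blinfun h)) + Re (cinner k ((\<tau> ^^ n) id_blinfun k)))"
proof -
  define s where "s = complex_of_real (norm x)"
  define a where "a i j = (if i = j then s *\<^sub>C id_blinfun else if i < j then x else op_adj x)"
    for i j :: nat
  define U where "U = (\<tau> ^^ n) id_blinfun"
  define D where "D = norm x * (Re (cinner h (U h)) + Re (cinner k (U k)))"
  define b where "b = cinner h ((\<tau> ^^ n) x k)"
  define c where "c = cinner k ((\<tau> ^^ n) (op_adj x) h)"
  have xl: "x \<in> clinear_ops"
    using x A_clinear by blast
  have upos: "op_positive U"
    unfolding U_def by (rule op_positive_iter[OF A_one op_positive_id])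
  have aA: "\<forall>i<2. \<forall>j<2. a i j \<in> A"
    by (auto simp: a_def intro: x A_adj A_one complex_vector.subspace_scale[OF A_subspace])
  have expand: "(\<Sum>i<2. \<Sum>j<2. f i j) = f 0 0 + f 0 1 + f 1 0 + f 1 1" for f :: "nat \<Rightarrow> nat \<Rightarrow> complex"
    by (simp add: numeral_2_eq_2 add.assoc)
  have "matrix_positive 2 a"
    unfolding matrix_positive_def
  proof
    fix v :: "nat \<Rightarrow> 'h"
    define u w where "u = v 0" and "w = v 1"
    have "cinner w (op_adj x u) = cnj (cinner u (x w))"
      using cinner_commute[of "x w" u] by (simp add: cinner_op_adj_right[OF xl])
    then have "(\<Sum>i<2. \<Sum>j<2. cinner (v i) (a i j (v j)))
        = of_real (norm x * ((norm u)\<^sup>2 + (norm w)\<^sup>2) + 2 * Re (cinner u (x w)))"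
      unfolding expand
      by (simp add: a_def u_def w_def s_def scaleC_blinfun_apply cinner_scaleC_right cinner_same
          complex_eq_iff algebra_simps)
    moreover have "0 \<le> norm x * ((norm u)\<^sup>2 + (norm w)\<^sup>2) + 2 * Re (cinner u (x w))"
    proof -
      have "\<bar>Re (cinner u (x w))\<bar> \<le> norm u * (norm x * norm w)"
        by (rule order.trans[OF abs_Re_le_cmod order.trans[OF cmod_cinner_le mult_left_mono[OF norm_blinfun]]])
          simp
      moreover have "0 \<le> norm x * (norm u - norm w)\<^sup>2"
        by simp
      then have "2 * (norm u * (norm x * norm w)) \<le> norm x * ((norm u)\<^sup>2 + (norm w)\<^sup>2)"
        by (simp add: power2_diff algebra_simps)
      ultimately show ?thesis by linarith
    qed
    ultimately show "(\<Sum>i<2. \<Sum>j<2. cinner (v i) (a i j (v j))) \<in> \<real>\<^sub>\<ge>\<^sub>0"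
      by (metis nonneg_Reals_of_real_iff)
  qed
  then have mp: "matrix_positive 2 (\<lambda>i j. (\<tau> ^^ n) (a i j))"
    by (rule matrix_positive_iter[OF aA])
  have phase: "of_real D + (z * b + cnj z * c) \<in> \<real>\<^sub>\<ge>\<^sub>0" if "cmod z = 1" for z
  proof -
    define v where "v i = (if i = 0 then h else z *\<^sub>C k)" for i :: nat
    have unit: "z * cnj z = 1"
      using complex_norm_square[of z] that by simp
    have "(\<tau> ^^ n) (s *\<^sub>C id_blinfun) = s *\<^sub>C U"
      by (simp add: clinear_on_scaleC[OF iter_linear] A_one U_def)
    moreover have "U (z *\<^sub>C k) = z *\<^sub>C U k" "(\<tau> ^^ n) x (z *\<^sub>C k) = z *\<^sub>C (\<tau> ^^ n) x k"
      using upos iter_mem[OF x] A_clinear by (auto simp: op_positive_def intro: clinear_opsD)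
    moreover have "cinner h (U h) = of_real (Re (cinner h (U h)))"
      "cinner k (U k) = of_real (Re (cinner k (U k)))"
      using upos by (simp_all add: op_positive_iff complex_eq_iff)
    ultimately have "(\<Sum>i<2. \<Sum>j<2. cinner (v i) ((\<tau> ^^ n) (a i j) (v j)))
       = of_real D + (z * b + cnj z * c)"
      unfolding expand D_def b_def c_def of_real_mult of_real_add
      by (simp add: v_def a_def scaleC_blinfun_apply cinner_scaleC_left cinner_scaleC_right unit
          s_def algebra_simps)
    then show ?thesis
      using spec[OF mp[unfolded matrix_positive_def], of v] by simp
  qed
  have "Re (b + c) \<le> D" "- Re (b + c) \<le> D" "Im (b + c) = 0"
    using phase[of 1] phase[of "- 1"] by (auto simp: complex_nonneg_Reals_iff)
  then have "cmod (b + c) \<le> D"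
    by (simp add: cmod_eq_Re)
  moreover have "Im (b - c) \<le> D" "- Im (b - c) \<le> D" "Re (b - c) = 0"
    using phase[of \<i>] phase[of "- \<i>"] by (auto simp: complex_nonneg_Reals_iff)
  then have "cmod (b - c) \<le> D"
    by (simp add: cmod_eq_Im)
  moreover have "2 * b = (b + c) + (b - c)"
    by simp
  then have "2 * cmod b \<le> cmod (b + c) + cmod (b - c)"
    by (metis norm_mult norm_numeral norm_triangle_ineq)
  ultimately show ?thesis
    by (simp add: b_def D_def U_def)
qed

definition unit_limit :: "'h \<Rightarrow>\<^sub>L 'h"
  where "unit_limit = sot_limit (\<lambda>n. (\<tau> ^^ n) id_blinfun)"

lemma norm_iter_id_le: "norm ((\<tau> ^^ n) id_blinfun) \<le> 1"
  using norm_iter_le[OF A_one] norm_blinfun_id_le order.trans by blast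

lemma iter_id_decreasing: "op_le ((\<tau> ^^ Suc n) id_blinfun) ((\<tau> ^^ n) id_blinfun)"
proof -
  have "op_le (\<tau> id_blinfun) id_blinfun"
    using op_positive_iter[OF A_one op_positive_id, of 1] norm_iter_id_le[of 1]
    by (intro op_le_id) auto
  then have "op_le ((\<tau> ^^ n) (\<tau> id_blinfun)) ((\<tau> ^^ n) id_blinfun)"
    using \<tau>_image A_one by (intro op_le_iter) auto
  then show ?thesis
    by (simp add: funpow_swap1)
qed

lemma iter_id_tendsto: "(\<lambda>n. (\<tau> ^^ n) id_blinfun h) \<longlonglongrightarrow> unit_limit h"
proof -
  obtain Q where Q: "\<And>h. (\<lambda>n. (\<tau> ^^ n) id_blinfun h) \<longlonglongrightarrow> blinfun_apply Q h"
    using decreasing_positive_convergent[of "\<lambda>n. (\<tau> ^^ n) id_blinfun",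
        OF op_positive_iter[OF A_one op_positive_id] iter_id_decreasing norm_iter_id_le] by blast
  then show ?thesis
    unfolding unit_limit_def using sot_limit_eqI[of "\<lambda>n. (\<tau> ^^ n) id_blinfun", OF Q] by simp
qed

lemma unit_limit_mem: "unit_limit \<in> A"
  by (rule von_neumann_algebra_limit[OF vN iter_mem[OF A_one] iter_id_tendsto])

lemma unit_limit_positive: "op_positive unit_limit"
  by (rule op_positive_limit[OF op_positive_iter[OF A_one op_positive_id] iter_id_tendsto])

lemma norm_unit_limit_le: "norm unit_limit \<le> 1"
  by (rule norm_pointwise_limit_le[OF iter_id_tendsto norm_iter_id_le])

lemma unit_limit_fixed: "\<tau> unit_limit = unit_limit"
proof (rule normal_on_limit[OF \<tau>_normal iter_mem[OF A_one] norm_iter_id_le iter_id_tendsto unit_limit_mem])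
  show "(\<lambda>n. \<tau> ((\<tau> ^^ n) id_blinfun) h) \<longlonglongrightarrow> unit_limit h" for h
    using LIMSEQ_Suc[OF iter_id_tendsto[of h]] by simp
qed

lemma fixed_point_le_unit_limit:
  assumes "y \<in> A" "op_positive y" "norm y \<le> 1" "\<tau> y = y"
  shows "op_le y unit_limit"
  unfolding op_le_def
proof (rule op_positive_limit)
  fix n
  have "(\<tau> ^^ n) y = y"
    using assms(4) by (induction n) auto
  then show "op_positive ((\<tau> ^^ n) id_blinfun - y)"
    using op_le_iter[OF assms(1) A_one op_le_id[OF assms(2,3)], of n] by (simp add: op_le_def)
  show "(\<lambda>n. ((\<tau> ^^ n) id_blinfun - y) h) \<longlonglongrightarrow> (unit_limit - y) h" for h
    by (simp add: blinfun.diff_left tendsto_diff iter_id_tendsto)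
qed

text \<open>The left side of the estimate for the iterates is constant along the orbit of a peripheral
eigenvector, so the estimate passes to the limit.\<close>

lemma peripheral_eigenvector_le:
  assumes "x \<in> eigenspace_on A \<tau> z" "cmod z = 1"
  shows "cmod (cinner h (x k))
    \<le> norm x * (Re (cinner h (unit_limit h)) + Re (cinner k (unit_limit k)))"
proof (rule LIMSEQ_le_const)
  have x: "x \<in> A" "\<tau> x = z *\<^sub>C x"
    using assms(1) by (auto simp: eigenspace_on_def)
  show "(\<lambda>n. norm x * (Re (cinner h ((\<tau> ^^ n) id_blinfun h)) + Re (cinner k ((\<tau> ^^ n) id_blinfun k))))
      \<longlonglongrightarrow> norm x * (Re (cinner h (unit_limit h)) + Re (cinner k (unit_limit k)))"
    by (intro tendsto_intros tendsto_Re tendsto_cinner_right iter_id_tendsto)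
  have "cmod (cinner h ((\<tau> ^^ n) x k)) = cmod (cinner h (x k))" for n
    using assms(2)
    by (simp add: funpow_eigenvector[OF \<tau>_linear x] scaleC_blinfun_apply cinner_scaleC_right
        norm_mult norm_power)
  then show "\<exists>N. \<forall>n\<ge>N. cmod (cinner h (x k))
      \<le> norm x * (Re (cinner h ((\<tau> ^^ n) id_blinfun h)) + Re (cinner k ((\<tau> ^^ n) id_blinfun k)))"
    using cmod_cinner_iter_le[OF x(1)] by metis
qed

lemma peripheral_eigenvector_zero:
  assumes "unit_limit = 0" "x \<in> eigenspace_on A \<tau> z" "cmod z = 1"
  shows "x = 0"
proof (rule blinfun_eqI)
  fix k
  have "cinner h (x k) = cinner h 0" for h
    using peripheral_eigenvector_le[OF assms(2,3), of h k] by (simp add: assms(1))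
  then show "x k = blinfun_apply 0 k"
    using cinner_ext_right[of "x k" 0] by simp
qed

lemma eigenspace_fixed: "eigenspace_on A \<tau> 1 = {x \<in> A. \<tau> x = x}"
  by (simp add: eigenspace_on_def)

lemma eigenspace_subset_peripheral:
  "cmod z = 1 \<Longrightarrow> eigenspace_on A \<tau> z \<subseteq> peripheral_space A \<tau>"
  unfolding peripheral_space_def
  by (intro order.trans[OF _ closure_subset] order.trans[OF _ complex_vector.span_superset]) auto

lemma unit_limit_mem_peripheral: "unit_limit \<in> peripheral_space A \<tau>"
  using eigenspace_subset_peripheral[of 1] unit_limit_mem unit_limit_fixed
  by (auto simp: eigenspace_fixed)

lemma unit_limit_nonzero_iff_fixed: "unit_limit \<noteq> 0 \<longleftrightarrow> (\<exists>x\<in>A. x \<noteq> 0 \<and> \<tau> x = x)"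
  using peripheral_eigenvector_zero[of _ 1] unit_limit_mem unit_limit_fixed
  by (auto simp: eigenspace_fixed)

lemma zero_eigenspace: "0 \<in> eigenspace_on A \<tau> z"
  using clinear_on_scaleC[OF \<tau>_linear A_one, of 0] complex_vector.subspace_0[OF A_subspace]
  by (simp add: eigenspace_on_def)

lemma unit_limit_nonzero_iff_peripheral: "unit_limit \<noteq> 0 \<longleftrightarrow> peripheral_space A \<tau> \<noteq> {0}"
proof -
  have "peripheral_space A \<tau> = {0}" if "unit_limit = 0"
  proof -
    have "(\<Union>z\<in>{z. cmod z = 1}. eigenspace_on A \<tau> z) = {0}"
      using peripheral_eigenvector_zero[OF that] zero_eigenspace
      by (auto intro!: exI[of _ 1])
    then show ?thesis
      by (simp add: peripheral_space_def complex_vector.span_insert_0)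
  qed
  then show ?thesis
    using unit_limit_mem_peripheral by auto
qed

text \<open>The normalised limit \<open>q / \<parallel>q\<parallel>\<close> is a positive fixed point of norm 1, so it is at most
\<open>q\<close>; this excludes \<open>\<parallel>q\<parallel> < 1\<close>.\<close>

lemma norm_unit_limit:
  assumes "unit_limit \<noteq> 0"
  shows "norm unit_limit = 1"
proof (rule ccontr)
  assume "norm unit_limit \<noteq> 1"
  define r where "r = norm unit_limit"
  have r: "0 < r" "r < 1"
    using \<open>norm unit_limit \<noteq> 1\<close> norm_unit_limit_le assms by (auto simp: r_def)
  define y where "y = complex_of_real (1 / r) *\<^sub>C unit_limit"
  have cq: "cinner h (y h) = of_real (1 / r) * cinner h (unit_limit h)" for h
    by (simp add: y_def scaleC_blinfun_apply cinner_scaleC_right)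
  have "op_le y unit_limit"
  proof (rule fixed_point_le_unit_limit)
    show yA: "y \<in> A"
      unfolding y_def by (rule complex_vector.subspace_scale[OF A_subspace unit_limit_mem])
    show "op_positive y"
      using unit_limit_positive yA A_clinear r
      unfolding op_positive_iff cq by auto
    show "norm y \<le> 1"
      using r by (simp add: y_def norm_scaleC r_def[symmetric] norm_divide)
    show "\<tau> y = y"
      by (simp add: y_def clinear_on_scaleC[OF \<tau>_linear unit_limit_mem] unit_limit_fixed)
  qed
  then have le: "Re (cinner h (unit_limit h)) / r \<le> Re (cinner h (unit_limit h))" for h
    by (simp add: op_le_def op_positive_iff blinfun.diff_left cinner_diff_right cq)
  have "unit_limit = 0"
  proof (rule op_ext_quadratic)
    show "unit_limit \<in> clinear_ops" "0 \<in> clinear_ops"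
      using unit_limit_positive by (simp_all add: op_positive_def clinear_ops_def)
    fix h
    have "Re (cinner h (unit_limit h)) \<ge> 0" "Im (cinner h (unit_limit h)) = 0"
      using unit_limit_positive by (auto simp: op_positive_iff)
    moreover have "Re (cinner h (unit_limit h)) * (1 - r) \<le> 0"
      using le[of h] r by (simp add: field_simps)
    ultimately show "cinner h (unit_limit h) = cinner h (blinfun_apply 0 h)"
      using r by (simp add: mult_le_0_iff complex_eq_iff)
  qed
  with assms show False ..
qed

text \<open>For \<open>|z| > 1\<close> the resolvent equation \<open>\<tau>(u) - z u = y\<close> is the fixed point equation
of the strict contraction \<open>u \<mapsto> z\<^sup>-\<^sup>1 (\<tau>(u) - y)\<close> of the complete space \<open>A\<close>.\<close>

lemma spectrum_bound:
  assumes "z \<in> spectrum_on A \<tau>"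
  shows "cmod z \<le> 1"
proof (rule ccontr)
  assume "\<not> cmod z \<le> 1"
  then have z: "cmod z > 1" by simp
  then have z0: "z \<noteq> 0" by auto
  note sub = A_subspace
  have ex1: "\<exists>!u\<in>A. inverse z *\<^sub>C (\<tau> u - y) = u" if "y \<in> A" for y
  proof (rule Banach_fix[where c = "inverse (cmod z)"])
    show "complete A" by (rule von_neumann_algebra_complete[OF vN])
    show "(\<lambda>u. inverse z *\<^sub>C (\<tau> u - y)) ` A \<subseteq> A"
      using \<tau>_image that
      by (auto intro!: complex_vector.subspace_scale[OF sub] complex_vector.subspace_diff[OF sub])
    fix u v assume uv: "u \<in> A" "v \<in> A"
    have "norm (\<tau> u - \<tau> v) \<le> norm (u - v)"
      using norm_\<tau>_le[of "u - v"] uv complex_vector.subspace_diff[OF sub]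
      by (simp add: clinear_on_diff[OF \<tau>_linear sub])
    moreover have "inverse z *\<^sub>C (\<tau> u - y) - inverse z *\<^sub>C (\<tau> v - y) = inverse z *\<^sub>C (\<tau> u - \<tau> v)"
      by (simp add: complex_vector.scale_right_diff_distrib)
    ultimately show "dist (inverse z *\<^sub>C (\<tau> u - y)) (inverse z *\<^sub>C (\<tau> v - y)) \<le> inverse (cmod z) * dist u v"
      by (simp add: dist_norm norm_scaleC norm_inverse mult_left_mono)
  qed (use z A_one in \<open>auto simp: inverse_less_1_iff\<close>)
  define g where "g y = (THE u. u \<in> A \<and> inverse z *\<^sub>C (\<tau> u - y) = u)" for y
  have gA: "g y \<in> A" and g: "inverse z *\<^sub>C (\<tau> (g y) - y) = g y" if "y \<in> A" for y
    using theI'[of "\<lambda>u. u \<in> A \<and> inverse z *\<^sub>C (\<tau> u - y) = u"] ex1[OF that]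
    unfolding g_def by auto
  have eq_iff: "inverse z *\<^sub>C v = u \<longleftrightarrow> v = z *\<^sub>C u" for u v :: "'h \<Rightarrow>\<^sub>L 'h"
    using z0 by (auto simp: scaleC_scaleC)
  have g_eqI: "g y = u" if "y \<in> A" "u \<in> A" "\<tau> u - y = z *\<^sub>C u" for u y
    using ex1[OF that(1)] gA[OF that(1)] g[OF that(1)] that by (auto simp: eq_iff)
  have g': "\<tau> (g y) - y = z *\<^sub>C g y" if "y \<in> A" for y
    using g[OF that] by (simp add: eq_iff)
  have "bounded_clinear_on A g"
    unfolding bounded_clinear_on_def clinear_on_def
  proof (intro conjI ballI allI exI[of _ "1 / (cmod z - 1)"])
    show "g ` A \<subseteq> A" using gA by auto
    fix x assume x: "x \<in> A"
    show "g (c *\<^sub>C x) = c *\<^sub>C g x" for c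
    proof (rule g_eqI)
      have "\<tau> (c *\<^sub>C g x) - c *\<^sub>C x = c *\<^sub>C (\<tau> (g x) - x)"
        by (simp add: clinear_on_scaleC[OF \<tau>_linear] gA x complex_vector.scale_right_diff_distrib)
      then show "\<tau> (c *\<^sub>C g x) - c *\<^sub>C x = z *\<^sub>C c *\<^sub>C g x"
        by (simp add: g'[OF x] scaleC_scaleC mult.commute)
    qed (use x gA complex_vector.subspace_scale[OF sub] in auto)
    show "norm (g x) \<le> 1 / (cmod z - 1) * norm x"
    proof -
      have "cmod z * norm (g x) = norm (\<tau> (g x) - x)"
        by (simp add: g'[OF x] norm_scaleC)
      also have "\<dots> \<le> norm (g x) + norm x"
        using norm_triangle_ineq4[of "\<tau> (g x)" x] norm_\<tau>_le[OF gA[OF x]] by linarith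
      finally show ?thesis
        using z by (simp add: field_simps)
    qed
    fix y assume y: "y \<in> A"
    show "g (x + y) = g x + g y"
    proof (rule g_eqI)
      have "\<tau> (g x + g y) - (x + y) = (\<tau> (g x) - x) + (\<tau> (g y) - y)"
        by (simp add: clinear_on_add[OF \<tau>_linear] gA x y)
      then show "\<tau> (g x + g y) - (x + y) = z *\<^sub>C (g x + g y)"
        by (simp add: g' x y scaleC_add_right)
    qed (use x y gA complex_vector.subspace_add[OF sub] in auto)
  qed
  moreover have "g (\<tau> x - z *\<^sub>C x) = x" if "x \<in> A" for x
  proof (rule g_eqI)
    show "\<tau> x - z *\<^sub>C x \<in> A"
      using \<tau>_image that
      by (auto intro!: complex_vector.subspace_scale[OF sub] complex_vector.subspace_diff[OF sub])
  qed (use that in auto)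
  moreover have "\<tau> (g x) - z *\<^sub>C g x = x" if "x \<in> A" for x
    using g'[OF that] by (simp add: algebra_simps)
  ultimately show False
    using assms unfolding spectrum_on_def by blast
qed

lemma spectral_radius_eq_1:
  assumes "unit_limit \<noteq> 0"
  shows "spectral_radius_on A \<tau> = 1"
  unfolding spectral_radius_on_def
proof (rule cSup_eq_maximum)
  have "1 \<in> spectrum_on A \<tau>"
  proof -
    have False if g: "bounded_clinear_on A g" "\<forall>x\<in>A. g (\<tau> x - 1 *\<^sub>C x) = x" for g
    proof -
      have "g 0 = unit_limit"
        using g(2) unit_limit_mem unit_limit_fixed by force
      moreover have "g (0 *\<^sub>C unit_limit) = 0 *\<^sub>C g unit_limit"
        using g(1) unit_limit_mem by (intro clinear_on_scaleC) (auto simp: bounded_clinear_on_def)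
      ultimately show False
        using assms by simp
    qed
    then show ?thesis
      unfolding spectrum_on_def by auto
  qed
  then show "1 \<in> cmod ` spectrum_on A \<tau>"
    by (metis image_eqI norm_one)
qed (use spectrum_bound in auto)

lemma unit_limit_maximal:
  assumes "unit_limit \<noteq> 0"
  shows "maximal_pf_eigenvector A \<tau> unit_limit"
  unfolding maximal_pf_eigenvector_def pf_eigenvector_def spectral_radius_eq_1[OF assms]
  using unit_limit_mem unit_limit_positive norm_unit_limit[OF assms] unit_limit_fixed
    fixed_point_le_unit_limit by simp

lemma maximal_pf_eigenvector_unique:
  assumes "maximal_pf_eigenvector A \<tau> x" "maximal_pf_eigenvector A \<tau> y"
  shows "x = y"
  using assms op_le_antisym unfolding maximal_pf_eigenvector_def by blast

end

section \<open>Recurrence of peripheral eigenvalues\<close>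

lemma unit_circle_powers_convergent_subsequence:
  assumes "finite \<Lambda>" "\<And>z. z \<in> \<Lambda> \<Longrightarrow> cmod z = 1"
  shows "\<exists>r::nat \<Rightarrow> nat. strict_mono r \<and> (\<forall>z\<in>\<Lambda>. convergent (\<lambda>k. z ^ r k))"
  using assms
proof (induction \<Lambda> rule: finite_induct)
  case empty
  show ?case
    by (intro exI[of _ id]) (simp add: strict_mono_def)
next
  case (insert z \<Lambda>)
  then obtain r :: "nat \<Rightarrow> nat" where r: "strict_mono r" "\<And>w. w \<in> \<Lambda> \<Longrightarrow> convergent (\<lambda>k. w ^ r k)"
    by (metis insertCI)
  have "\<forall>k. z ^ r k \<in> cball 0 1"
    using insert.prems[of z] by (simp add: norm_power)
  then obtain l s where s: "strict_mono (s :: nat \<Rightarrow> nat)" "(\<lambda>k. z ^ r (s k)) \<longlonglongrightarrow> l"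
    using seq_compactE[OF compact_imp_seq_compact[OF compact_cball[of "0 :: complex" 1]],
        of "\<lambda>k. z ^ r k"] unfolding o_def by blast
  have "convergent (\<lambda>k. w ^ r (s k))" if "w \<in> \<Lambda>" for w
    using convergent_subseq_convergent[OF r(2)[OF that] s(1)] by (simp add: o_def)
  moreover have "convergent (\<lambda>k. z ^ r (s k))"
    using s(2) convergentI by blast
  ultimately show ?case
    using strict_mono_o[OF r(1) s(1)] by (intro exI[of _ "\<lambda>k. r (s k)"]) (auto simp: o_def)
qed

text \<open>Differences of late indices of a subsequence along which all powers converge are common return
times to 1.\<close>

lemma simultaneous_recurrence:
  assumes "finite \<Lambda>" "\<And>z. z \<in> \<Lambda> \<Longrightarrow> cmod z = 1" "0 < \<epsilon>"
  obtains n where "n \<ge> N" "\<And>z. z \<in> \<Lambda> \<Longrightarrow> cmod (z ^ n - 1) \<le> \<epsilon>"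
proof -
  obtain r :: "nat \<Rightarrow> nat" where r: "strict_mono r" "\<And>w. w \<in> \<Lambda> \<Longrightarrow> convergent (\<lambda>k. w ^ r k)"
    using unit_circle_powers_convergent_subsequence[OF assms(1,2)] by blast
  have "\<exists>K. \<forall>i\<ge>K. \<forall>j\<ge>K. cmod (w ^ r i - w ^ r j) < \<epsilon>" if "w \<in> \<Lambda>" for w
    using CauchyD[OF convergent_Cauchy[OF r(2)[OF that]] assms(3)] by blast
  then obtain K where K: "\<And>w i j. w \<in> \<Lambda> \<Longrightarrow> i \<ge> K w \<Longrightarrow> j \<ge> K w \<Longrightarrow> cmod (w ^ r i - w ^ r j) < \<epsilon>"
    by metis
  define M where "M = Max (insert 0 (K ` \<Lambda>))"
  have M: "K w \<le> M" if "w \<in> \<Lambda>" for w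
    using assms(1) that by (simp add: M_def)
  define n where "n = r (M + N) - r M"
  have le: "r M + N \<le> r (M + N)"
  proof (induction N)
    case (Suc N)
    have "r (M + N) < r (M + Suc N)"
      using r(1) by (simp add: strict_mono_def)
    with Suc show ?case by simp
  qed simp
  show ?thesis
  proof (rule that)
    show "n \<ge> N"
      using le by (simp add: n_def)
    fix z assume z: "z \<in> \<Lambda>"
    have "z ^ r (M + N) = z ^ r M * z ^ n"
      using le by (simp add: n_def power_add[symmetric])
    then have "cmod (z ^ r M) * cmod (z ^ n - 1) = cmod (z ^ r (M + N) - z ^ r M)"
      by (simp add: norm_mult[symmetric] algebra_simps)
    also have "\<dots> \<le> \<epsilon>"
      using K[OF z, of "M + N" M] M[OF z] by simp
    finally show "cmod (z ^ n - 1) \<le> \<epsilon>"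
      using assms(2)[OF z] by (simp add: norm_power)
  qed
qed

text \<open>Common return times of finitely many eigenvalues are return times, in norm, of the orbit of a
linear combination of eigenvectors.\<close>

lemma span_eigenvectors_almost_periodic:
  assumes lin: "clinear_on M f" and sub: "csubspace M" and fM: "f ` M \<subseteq> M"
    and z: "z \<in> cspan (\<Union>w\<in>{w. cmod w = 1}. eigenspace_on M f w)"
  shows "z \<in> M \<and> (\<exists>\<Lambda> C. finite \<Lambda> \<and> (\<forall>w\<in>\<Lambda>. cmod w = 1) \<and> 0 \<le> C \<and>
    (\<forall>n \<delta>. 0 \<le> \<delta> \<longrightarrow> (\<forall>w\<in>\<Lambda>. cmod (w ^ n - 1) \<le> \<delta>) \<longrightarrow> norm ((f ^^ n) z - z) \<le> C * \<delta>))"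
  using z
proof (induction rule: complex_vector.span_induct_alt)
  case base
  have "(f ^^ n) (0 *\<^sub>C 0) = 0 *\<^sub>C (f ^^ n) 0" for n
    by (rule clinear_on_scaleC[OF clinear_on_funpow[OF lin fM] complex_vector.subspace_0[OF sub]])
  then have "(f ^^ n) 0 = 0" for n
    by simp
  then show ?case
    using complex_vector.subspace_0[OF sub]
    by (intro conjI exI[of _ "{} :: complex set"] exI[of _ "0 :: real"]) auto
next
  case (step c x y)
  then obtain w where w: "cmod w = 1" "x \<in> M" "f x = w *\<^sub>C x"
    by (auto simp: eigenspace_on_def)
  obtain \<Lambda> C where yM: "y \<in> M" and \<Lambda>: "finite \<Lambda>" "\<forall>w\<in>\<Lambda>. cmod w = 1" "0 \<le> C"
    and est: "\<And>n \<delta>. 0 \<le> \<delta> \<Longrightarrow> (\<forall>w\<in>\<Lambda>. cmod (w ^ n - 1) \<le> \<delta>) \<Longrightarrow> norm ((f ^^ n) y - y) \<le> C * \<delta>"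
    using step(2) by blast
  note linn = clinear_on_funpow[OF lin fM]
  have cxM: "c *\<^sub>C x \<in> M"
    by (rule complex_vector.subspace_scale[OF sub w(2)])
  have "norm ((f ^^ n) (c *\<^sub>C x + y) - (c *\<^sub>C x + y)) \<le> (cmod c * norm x + C) * \<delta>"
    if "0 \<le> \<delta>" "\<forall>w\<in>insert w \<Lambda>. cmod (w ^ n - 1) \<le> \<delta>" for n \<delta>
  proof -
    have "(f ^^ n) (c *\<^sub>C x + y) - (c *\<^sub>C x + y) = ((w ^ n - 1) * c) *\<^sub>C x + ((f ^^ n) y - y)"
      by (simp add: clinear_on_add[OF linn] clinear_on_scaleC[OF linn] cxM yM w(2)
          funpow_eigenvector[OF lin w(2,3)] scaleC_scaleC algebra_simps
          complex_vector.scale_left_diff_distrib)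
    then have "norm ((f ^^ n) (c *\<^sub>C x + y) - (c *\<^sub>C x + y))
        \<le> cmod (w ^ n - 1) * (cmod c * norm x) + norm ((f ^^ n) y - y)"
      by (metis norm_triangle_ineq norm_scaleC norm_mult mult.assoc)
    also have "\<dots> \<le> \<delta> * (cmod c * norm x) + C * \<delta>"
      using that est[of \<delta> n] by (intro add_mono mult_right_mono) auto
    finally show ?thesis
      by (simp add: algebra_simps)
  qed
  moreover have "c *\<^sub>C x + y \<in> M"
    by (rule complex_vector.subspace_add[OF sub cxM yM])
  ultimately show ?case
    using \<Lambda> w(1) by (intro conjI exI[of _ "insert w \<Lambda>"] exI[of _ "cmod c * norm x + C"]) auto
qed

section \<open>Dilations of unital maps\<close>

lemma isometry_adj_compose:
  fixes V :: "'h::chilbert_space \<Rightarrow>\<^sub>L 'k::chilbert_space"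
  assumes "V \<in> clinear_ops" "\<And>h. norm (V h) = norm h"
  shows "op_adj V o\<^sub>L V = id_blinfun"
  by (rule op_ext_quadratic)
    (use assms in \<open>auto simp: cinner_op_adj_right cinner_same clinear_compose op_adj_clinear\<close>)

lemma compress_op_add: "compress_op V (x + y) = compress_op V x + compress_op V y"
  by (simp add: compress_op_def compose_add_left compose_add_right)

lemma compress_op_diff: "compress_op V (x - y) = compress_op V x - compress_op V y"
  by (simp add: compress_op_def compose_diff_left compose_diff_right)

lemma compress_op_scaleC:
  "V \<in> clinear_ops \<Longrightarrow> compress_op V (c *\<^sub>C x) = c *\<^sub>C compress_op V x"
  by (simp add: compress_op_def scaleC_compose_left scaleC_compose_right op_adj_clinear)

lemma compress_op_adj:
  assumes "V \<in> clinear_ops" "x \<in> clinear_ops"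
  shows "compress_op V (op_adj x) = op_adj (compress_op V x)"
  using assms
  by (simp add: compress_op_def op_adj_compose clinear_compose op_adj_clinear op_adj_op_adj
      compose_assoc)

lemma norm_isometry_le:
  assumes "\<And>h. norm (blinfun_apply V h) = norm h"
  shows "norm V \<le> 1"
  by (rule norm_blinfun_bound) (simp_all add: assms)

locale unital_dilation =
  fixes A :: "('h::chilbert_space \<Rightarrow>\<^sub>L 'h) set" and \<tau>
    and V :: "'h \<Rightarrow>\<^sub>L 'k::chilbert_space" and B \<theta>
  assumes dilation: "dilation_conditions A \<tau> V B \<theta>"
    and unital: "\<tau> id_blinfun = id_blinfun"
begin

lemma V_clinear: "V \<in> clinear_ops" and V_norm: "norm (V h) = norm h"
  and B_vN: "von_neumann_algebra B" and A_eq: "A = compress_op V ` B"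
  and \<theta>_endo: "normal_star_endomorphism B \<theta>"
  and iter_\<tau>: "x \<in> A \<Longrightarrow> (\<tau> ^^ n) x = compress_op V ((\<theta> ^^ n) (lift_op V x))"
  and dense: "closure (cspan {dilation_vector V \<theta> x h n | x h n. \<forall>i. x i \<in> A}) = UNIV"
  and B_gen: "B = vn_generated {(\<theta> ^^ n) (lift_op V x) | n x. x \<in> A}"
  using dilation unfolding dilation_conditions_def by (blast+)

lemma B_clinear: "x \<in> B \<Longrightarrow> x \<in> clinear_ops" and B_subspace: "csubspace B"
  and B_one: "id_blinfun \<in> B" and B_mult: "x \<in> B \<Longrightarrow> y \<in> B \<Longrightarrow> x o\<^sub>L y \<in> B"
  and B_adj: "x \<in> B \<Longrightarrow> op_adj x \<in> B"
  using B_vN by (auto simp: von_neumann_algebra_def)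

lemma \<theta>_image: "\<theta> ` B \<subseteq> B" and \<theta>_linear: "clinear_on B \<theta>"
  and \<theta>_mult: "x \<in> B \<Longrightarrow> y \<in> B \<Longrightarrow> \<theta> (x o\<^sub>L y) = \<theta> x o\<^sub>L \<theta> y"
  and \<theta>_adj: "x \<in> B \<Longrightarrow> \<theta> (op_adj x) = op_adj (\<theta> x)"
  and \<theta>_normal: "normal_on B \<theta>"
  using \<theta>_endo by (auto simp: normal_star_endomorphism_def)

lemmas \<theta>_mem = funpow_mem[OF \<theta>_image]
  and \<theta>_iter_linear = clinear_on_funpow[OF \<theta>_linear \<theta>_image]

lemma \<theta>_iter_mult:
  "x \<in> B \<Longrightarrow> y \<in> B \<Longrightarrow> (\<theta> ^^ n) (x o\<^sub>L y) = (\<theta> ^^ n) x o\<^sub>L (\<theta> ^^ n) y"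
  by (induction n) (auto simp: \<theta>_mult \<theta>_mem)

lemma \<theta>_iter_adj: "x \<in> B \<Longrightarrow> (\<theta> ^^ n) (op_adj x) = op_adj ((\<theta> ^^ n) x)"
  by (induction n) (auto simp: \<theta>_adj \<theta>_mem)

lemma norm_\<theta>_iter_le: "x \<in> B \<Longrightarrow> norm ((\<theta> ^^ n) x) \<le> norm x"
  by (induction n)
    (auto intro: order.trans[OF star_endomorphism_contractive[OF B_vN \<theta>_endo]] \<theta>_mem)

lemma V_adj_V: "op_adj V o\<^sub>L V = id_blinfun"
  by (rule isometry_adj_compose[OF V_clinear V_norm])

lemma V_adj_V_apply [simp]: "op_adj V (V h) = h"
  using arg_cong[OF V_adj_V, of "\<lambda>T. blinfun_apply T h"] by simp

lemma norm_V_le: "norm V \<le> 1" and norm_V_adj_le: "norm (op_adj V) \<le> 1"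
  using norm_isometry_le[OF V_norm] by (simp_all add: norm_op_adj[OF V_clinear])

lemma norm_compress_le: "norm (compress_op V z) \<le> norm z"
proof -
  have "norm (compress_op V z) \<le> norm (op_adj V) * norm z * norm V"
    unfolding compress_op_def
    by (meson mult_right_mono norm_blinfun_compose norm_ge_zero order.trans)
  also have "\<dots> \<le> 1 * norm z * 1"
    using norm_V_le norm_V_adj_le by (intro mult_mono) auto
  finally show ?thesis by simp
qed

lemma norm_lift_le: "norm (lift_op V x) \<le> norm x"
proof -
  have "norm (lift_op V x) \<le> norm V * norm x * norm (op_adj V)"
    unfolding lift_op_def
    by (meson mult_right_mono norm_blinfun_compose norm_ge_zero order.trans)
  also have "\<dots> \<le> 1 * norm x * 1"
    using norm_V_le norm_V_adj_le by (intro mult_mono) auto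
  finally show ?thesis by simp
qed

lemma lift_mem: "x \<in> A \<Longrightarrow> lift_op V x \<in> B"
proof -
  assume "x \<in> A"
  then have "(\<theta> ^^ 0) (lift_op V x) \<in> {(\<theta> ^^ n) (lift_op V x) | n x. x \<in> A}"
    by blast
  then show ?thesis
    by (subst B_gen) (auto simp: vn_generated_def)
qed

lemma compress_mem: "z \<in> B \<Longrightarrow> compress_op V z \<in> A"
  by (simp add: A_eq)

lemma A_one: "id_blinfun \<in> A"
  using compress_mem[OF B_one] by (simp add: compress_op_def V_adj_V)

text \<open>The projection \<open>\<theta>\<^sup>n(p)\<close>, where \<open>p\<close> is the projection onto
  \<open>H\<close>.\<close>

definition P :: "nat \<Rightarrow> 'k \<Rightarrow>\<^sub>L 'k"
  where "P n = (\<theta> ^^ n) (lift_op V id_blinfun)"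

lemma P_mem: "P n \<in> B"
  unfolding P_def by (intro \<theta>_mem lift_mem A_one)

lemma P_idem: "P n o\<^sub>L P n = P n"
proof -
  have "lift_op V id_blinfun o\<^sub>L lift_op V id_blinfun = lift_op V id_blinfun"
    by (rule blinfun_eqI) (simp add: lift_op_def)
  then show ?thesis
    unfolding P_def by (simp add: \<theta>_iter_mult[symmetric] lift_mem A_one)
qed

lemma P_adj: "op_adj (P n) = P n"
proof -
  have "op_adj (lift_op V id_blinfun) = lift_op V id_blinfun"
    by (simp add: lift_op_def op_adj_compose V_clinear op_adj_clinear op_adj_op_adj)
  then show ?thesis
    unfolding P_def by (simp add: \<theta>_iter_adj[symmetric] lift_mem A_one)
qed

lemma cinner_P: "cinner (P n x) y = cinner x (P n y)"
  using cinner_op_adj[OF B_clinear[OF P_mem], of n x y] by (simp add: P_adj)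

lemma P_P [simp]: "P n (P n k) = P n k"
  using arg_cong[OF P_idem, of "\<lambda>T. blinfun_apply T k"] by simp

lemma inner_P: "inner (P n x) y = inner x (P n y)"
  using cinner_P by (metis Re_cinner)

lemma norm_P_sq: "(norm (P n k))\<^sup>2 = inner (P n k) k"
  by (simp add: power2_norm_eq_inner inner_P)

lemma norm_P_le: "norm (P n) \<le> 1"
proof -
  have "norm (P n) \<le> norm (lift_op V id_blinfun)"
    unfolding P_def by (intro norm_\<theta>_iter_le lift_mem A_one)
  also have "\<dots> \<le> 1"
    using norm_lift_le[of id_blinfun] norm_blinfun_id_le order.trans by blast
  finally show ?thesis .
qed

lemma norm_P_apply_le: "norm (P n k) \<le> norm k"
  using norm_blinfun[of "P n" k] mult_right_mono[OF norm_P_le, of "norm k" n] by simp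

text \<open>A projection whose compression to \<open>H\<close> is the identity fixes every vector of \<open>H\<close>. Here
the compression of \<open>\<theta>\<^sup>n(p)\<close> is \<open>\<tau>\<^sup>n(1) = 1\<close>.\<close>

lemma P_V [simp]: "P n (V h) = V h"
proof -
  have "(\<tau> ^^ n) id_blinfun = id_blinfun"
    by (induction n) (auto simp: unital)
  then have "compress_op V (P n) = id_blinfun"
    using iter_\<tau>[OF A_one, of n] by (simp add: P_def)
  then have "op_adj V (P n (V h)) = h"
    by (metis blinfun_apply_blinfun_compose blinfun_apply_id_blinfun compress_op_def id_apply)
  then have "cinner (V h) (P n (V h)) = cinner h h"
    by (metis cinner_op_adj_right V_clinear)
  then have "inner (V h) (P n (V h)) = (norm (V h))\<^sup>2"
    by (metis Re_cinner V_norm power2_norm_eq_inner)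
  then have "(norm (P n (V h) - V h))\<^sup>2 = 0"
    unfolding norm_diff_sq norm_P_sq by (simp add: inner_commute)
  then show ?thesis by simp
qed

lemma V_adj_P [simp]: "op_adj V (P n k) = op_adj V k"
proof (rule cinner_ext_right)
  show "cinner h (op_adj V (P n k)) = cinner h (op_adj V k)" for h
    by (simp add: cinner_op_adj_right[OF V_clinear] cinner_P[symmetric])
qed

lemma P_lift: "P n o\<^sub>L lift_op V x = lift_op V x" "lift_op V x o\<^sub>L P n = lift_op V x"
  by (rule blinfun_eqI, simp add: lift_op_def)+

lemma P_iter_lift:
  assumes "x \<in> A" "m \<le> n"
  shows "P n o\<^sub>L (\<theta> ^^ m) (lift_op V x) = (\<theta> ^^ m) (lift_op V x)"
    and "(\<theta> ^^ m) (lift_op V x) o\<^sub>L P n = (\<theta> ^^ m) (lift_op V x)"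
proof -
  have "P n = (\<theta> ^^ m) (P (n - m))"
    using assms(2) unfolding P_def by (simp add: funpow_add[symmetric, THEN fun_cong, unfolded o_def])
  then show "P n o\<^sub>L (\<theta> ^^ m) (lift_op V x) = (\<theta> ^^ m) (lift_op V x)"
    and "(\<theta> ^^ m) (lift_op V x) o\<^sub>L P n = (\<theta> ^^ m) (lift_op V x)"
    using assms(1) by (simp_all add: \<theta>_iter_mult[symmetric] P_mem lift_mem P_lift)
qed

lemma P_increasing:
  assumes "m \<le> n"
  shows "P n (P m k) = P m k"
  using arg_cong[OF P_iter_lift(1)[OF A_one assms], of "\<lambda>T. blinfun_apply T k"]
  by (simp add: P_def)

lemma P_dilation_vector:
  assumes "\<forall>i. x i \<in> A" "m \<le> n"
  shows "P n (dilation_vector V \<theta> x h m) = dilation_vector V \<theta> x h m"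
proof (cases m)
  case (Suc j)
  then show ?thesis
    using assms P_iter_lift(1)[of "x m" m n]
    by (metis blinfun_apply_blinfun_compose dilation_vector.simps(2))
qed simp

text \<open>The set of vectors on which \<open>\<theta>\<^sup>n(p)\<close> converges to the identity is a closed
subspace, and it contains the vectors \<open>\<theta>\<^sup>m(x\<^sub>m) \<dots> \<theta>(x\<^sub>1) h\<close>, which
\<open>\<theta>\<^sup>n(p)\<close> fixes for \<open>n \<ge> m\<close>. By minimality it is the whole space.\<close>

lemma P_tendsto: "(\<lambda>n. P n k) \<longlonglongrightarrow> k"
proof -
  define S where "S = {k. (\<lambda>n. P n k) \<longlonglongrightarrow> k}"
  have "csubspace S"
    unfolding complex_vector.subspace_def S_def
    using bounded_linear.tendsto[OF bounded_linear_scaleC]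
    by (auto simp: blinfun.add_right clinear_opsD[OF B_clinear[OF P_mem]] intro: tendsto_add)
  moreover have "{dilation_vector V \<theta> x h n | x h n. \<forall>i. x i \<in> A} \<subseteq> S"
  proof
    fix v assume "v \<in> {dilation_vector V \<theta> x h n | x h n. \<forall>i. x i \<in> A}"
    then obtain x h m where v: "v = dilation_vector V \<theta> x h m" "\<forall>i. x i \<in> A" by blast
    then have "\<forall>\<^sub>F n in sequentially. P n v = v"
      using P_dilation_vector[of x m] unfolding eventually_sequentially by blast
    then show "v \<in> S"
      by (simp add: S_def tendsto_eventually)
  qed
  ultimately have span: "cspan {dilation_vector V \<theta> x h n | x h n. \<forall>i. x i \<in> A} \<subseteq> S"
    by (rule complex_vector.span_minimal[rotated])
  have "closed S"
    unfolding closed_sequential_limits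
  proof (intro allI impI, elim conjE)
    fix X l assume X: "\<forall>j. X j \<in> S" "X \<longlonglongrightarrow> l"
    show "l \<in> S"
      unfolding S_def mem_Collect_eq
    proof (rule LIMSEQ_I)
      fix r :: real assume "0 < r"
      then obtain j where j: "norm (X j - l) < r / 3"
        using X(2) by (metis LIMSEQ_D divide_pos_pos order_refl zero_less_numeral)
      obtain N where N: "\<And>n. n \<ge> N \<Longrightarrow> norm (P n (X j) - X j) < r / 3"
        using X(1) \<open>0 < r\<close> LIMSEQ_D[of "\<lambda>n. P n (X j)" "X j" "r / 3"] by (auto simp: S_def)
      have "norm (P n l - l) < r" if "n \<ge> N" for n
      proof -
        have "P n l - l = P n (l - X j) + (P n (X j) - X j) + (X j - l)"
          by (simp add: blinfun.diff_right)
        then have "norm (P n l - l) \<le> norm (P n (l - X j)) + norm (P n (X j) - X j) + norm (X j - l)"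
          by (metis norm_triangle_le norm_triangle_ineq add_right_mono)
        also have "\<dots> < r / 3 + r / 3 + r / 3"
          using N[OF that] j norm_P_apply_le[of n "l - X j"] by (simp add: norm_minus_commute)
        finally show ?thesis by simp
      qed
      then show "\<exists>no. \<forall>n\<ge>no. norm (P n l - l) < r" by blast
    qed
  qed
  then have "closure (cspan {dilation_vector V \<theta> x h n | x h n. \<forall>i. x i \<in> A}) \<subseteq> S"
    by (rule closure_minimal[OF span])
  then show ?thesis
    unfolding dense by (auto simp: S_def)
qed

lemma P_tendsto_compose:
  assumes "filterlim n at_top sequentially" "w \<longlonglongrightarrow> k"
  shows "(\<lambda>j. P (n j) (w j)) \<longlonglongrightarrow> k"
proof -
  have "(\<lambda>j. P (n j) (w j - k)) \<longlonglongrightarrow> 0"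
    by (rule Lim_null_comparison[OF always_eventually]) (use norm_P_apply_le assms(2)
        tendsto_norm_zero[OF LIM_zero[OF assms(2)]] in auto)
  moreover have "(\<lambda>j. P (n j) k) \<longlonglongrightarrow> k"
    by (rule filterlim_compose[OF P_tendsto assms(1)])
  ultimately have "(\<lambda>j. P (n j) (w j - k) + P (n j) k) \<longlonglongrightarrow> 0 + k"
    by (rule tendsto_add)
  then show ?thesis
    by (simp add: blinfun.diff_right)
qed

text \<open>The projection \<open>\<theta>(1)\<close> dominates each \<open>\<theta>\<^sup>n\<^sup>+\<^sup>1(p)\<close>, and these
converge strongly to 1.\<close>

lemma \<theta>_one: "\<theta> id_blinfun = id_blinfun"
proof (rule blinfun_eqI)
  fix k
  have "\<theta> id_blinfun o\<^sub>L P (Suc n) = P (Suc n)" for n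
    using \<theta>_mult[OF B_one P_mem[of n]] by (simp add: P_def)
  then have eq: "\<theta> id_blinfun (P (Suc n) k) = P (Suc n) k" for n
    by (metis blinfun_apply_blinfun_compose)
  have lim: "(\<lambda>n. P (Suc n) k) \<longlonglongrightarrow> k"
    by (rule LIMSEQ_Suc[OF P_tendsto])
  have "(\<lambda>n. \<theta> id_blinfun (P (Suc n) k)) \<longlonglongrightarrow> \<theta> id_blinfun k"
    by (rule blinfun.tendsto[OF tendsto_const lim])
  with lim show "\<theta> id_blinfun k = id_blinfun k"
    unfolding eq by (simp add: LIMSEQ_unique)
qed

lemma iter_compress: 
  assumes "z \<in> B"
  shows "(\<theta> ^^ n) (lift_op V (compress_op V z)) = P n o\<^sub>L (\<theta> ^^ n) z o\<^sub>L P n"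
proof -
  have "lift_op V (compress_op V z) = lift_op V id_blinfun o\<^sub>L z o\<^sub>L lift_op V id_blinfun"
    by (rule blinfun_eqI) (simp add: compress_op_def lift_op_def)
  then show ?thesis
    unfolding P_def by (simp add: \<theta>_iter_mult assms B_mult lift_mem A_one)
qed

lemma compress_eigenvector:
  assumes "z \<in> eigenspace_on B \<theta> w"
  shows "compress_op V z \<in> eigenspace_on A \<tau> w"
proof -
  have z: "z \<in> B" "\<theta> z = w *\<^sub>C z"
    using assms by (auto simp: eigenspace_on_def)
  have "\<tau> (compress_op V z) = compress_op V (P 1 o\<^sub>L \<theta> z o\<^sub>L P 1)"
    using iter_\<tau>[OF compress_mem[OF z(1)], of 1] iter_compress[OF z(1), of 1] by simp
  also have "\<dots> = compress_op V (\<theta> z)"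
    by (rule blinfun_eqI) (simp add: compress_op_def)
  finally show ?thesis
    using z by (simp add: eigenspace_on_def compress_mem compress_op_scaleC[OF V_clinear])
qed

text \<open>The norm of \<open>\<theta>\<^sup>n(p z p) = P n \<theta>\<^sup>n(z) P n\<close> is at most that of the
compression. Along return times of \<open>z\<close> the right side converges strongly to \<open>z\<close>.\<close>

lemma compress_isometric:
  assumes "z \<in> cspan (\<Union>w\<in>{w. cmod w = 1}. eigenspace_on B \<theta> w)"
  shows "norm (compress_op V z) = norm z"
proof (rule order_antisym[OF norm_compress_le])
  \<comment> \<open>return times \<open>n j\<close> of \<open>z\<close> that tend to infinity\<close>
  obtain \<Lambda> C where z: "z \<in> B" and \<Lambda>: "finite \<Lambda>" "\<And>w. w \<in> \<Lambda> \<Longrightarrow> cmod w = 1" "0 \<le> C"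
    and est: "\<And>n \<delta>. 0 \<le> \<delta> \<Longrightarrow> (\<forall>w\<in>\<Lambda>. cmod (w ^ n - 1) \<le> \<delta>) \<Longrightarrow> norm ((\<theta> ^^ n) z - z) \<le> C * \<delta>"
    using span_eigenvectors_almost_periodic[OF \<theta>_linear B_subspace \<theta>_image assms] by blast
  have "\<exists>n\<ge>j. norm ((\<theta> ^^ n) z - z) \<le> C * inverse (real (Suc j))" for j
  proof -
    obtain n where "n \<ge> j" "\<And>w. w \<in> \<Lambda> \<Longrightarrow> cmod (w ^ n - 1) \<le> inverse (real (Suc j))"
      using simultaneous_recurrence[OF \<Lambda>(1,2), of "inverse (real (Suc j))" j] by auto
    then show ?thesis
      using est[of "inverse (real (Suc j))" n] by auto
  qed
  then obtain n where n: "\<And>j. n j \<ge> j" "\<And>j. norm ((\<theta> ^^ n j) z - z) \<le> C * inverse (real (Suc j))"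
    by metis
  have n_lim: "filterlim n at_top sequentially"
    by (rule filterlim_at_top_mono[OF filterlim_ident]) (simp add: n(1))
  have "(\<lambda>j. (\<theta> ^^ n j) z - z) \<longlonglongrightarrow> 0"
  proof (rule Lim_null_comparison[OF always_eventually])
    show "\<forall>j. norm ((\<theta> ^^ n j) z - z) \<le> C * inverse (real (Suc j))"
      using n(2) by blast
    show "(\<lambda>j. C * inverse (real (Suc j))) \<longlonglongrightarrow> 0"
      by (rule tendsto_mult_right_zero[OF LIMSEQ_inverse_real_of_nat])
  qed
  then have z_lim: "(\<lambda>j. (\<theta> ^^ n j) z) \<longlonglongrightarrow> z"
    by (rule LIM_zero_cancel)
  show "norm z \<le> norm (compress_op V z)"
  proof (rule norm_blinfun_bound)
    fix k
    have "(\<lambda>j. P (n j) ((\<theta> ^^ n j) z (P (n j) k))) \<longlonglongrightarrow> z k"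
      by (intro P_tendsto_compose[OF n_lim] blinfun.tendsto[OF z_lim] tendsto_const)
    moreover have "norm (P (n j) ((\<theta> ^^ n j) z (P (n j) k))) \<le> norm (compress_op V z) * norm k" for j
    proof -
      have "P (n j) ((\<theta> ^^ n j) z (P (n j) k)) = (\<theta> ^^ n j) (lift_op V (compress_op V z)) k"
        by (simp add: iter_compress[OF z])
      also have "norm \<dots> \<le> norm ((\<theta> ^^ n j) (lift_op V (compress_op V z))) * norm k"
        by (rule norm_blinfun)
      also have "\<dots> \<le> norm (compress_op V z) * norm k"
        by (intro mult_right_mono norm_ge_zero order.trans[OF norm_\<theta>_iter_le norm_lift_le]
            lift_mem compress_mem z)
      finally show ?thesis .
    qed
    ultimately show "norm (z k) \<le> norm (compress_op V z) * norm k"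
      by (intro Lim_bounded[OF tendsto_norm]) auto
  qed simp
qed

lemma \<tau>_linear: "clinear_on A \<tau>"
proof -
  have eq: "\<tau> x = compress_op V (\<theta> (lift_op V x))" if "x \<in> A" for x
    using iter_\<tau>[OF that, of 1] by simp
  have A_sub: "x + y \<in> A" "c *\<^sub>C x \<in> A" if "x \<in> A" "y \<in> A" for x y c
    using that complex_vector.subspace_add[OF B_subspace] complex_vector.subspace_scale[OF B_subspace]
    unfolding A_eq by (auto simp: compress_op_add[symmetric] compress_op_scaleC[OF V_clinear, symmetric])
  have lift_add: "lift_op V (x + y) = lift_op V x + lift_op V y" for x y
    by (simp add: lift_op_def compose_add_left compose_add_right)
  have lift_scale: "lift_op V (c *\<^sub>C x) = c *\<^sub>C lift_op V x" for c x
    by (simp add: lift_op_def scaleC_compose_left scaleC_compose_right V_clinear)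
  show ?thesis
    unfolding clinear_on_def
    by (simp add: eq A_sub lift_add lift_scale lift_mem clinear_on_add[OF \<theta>_linear]
        clinear_on_scaleC[OF \<theta>_linear] compress_op_add compress_op_scaleC[OF V_clinear])
qed

text \<open>The lift is the strong limit of \<open>Z n = w\<^sup>-\<^sup>n \<theta>\<^sup>n(x)\<close>, where
\<open>w\<^sup>-\<^sup>1\<close> is the complex conjugate of \<open>w\<close>. This is a bounded martingale for the
projections: \<open>P m Z n P m = Z m\<close> for \<open>m \<le> n\<close>. On the range of a fixed
\<open>P m\<close> the increments are therefore orthogonal, and the norms \<open>\<parallel>Z n k\<parallel>\<close>
increase to a finite limit, so \<open>Z n k\<close> is Cauchy; the ranges are dense. Since
\<open>\<theta>(Z n) = w Z (n + 1)\<close>, normality makes the limit an eigenvector.\<close>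

lemma lift_eigenvector:
  assumes x: "x \<in> eigenspace_on A \<tau> w" and w: "cmod w = 1"
  obtains z where "z \<in> eigenspace_on B \<theta> w" "compress_op V z = x"
proof -
  have xA: "x \<in> A" and \<tau>x: "\<tau> x = w *\<^sub>C x"
    using x by (auto simp: eigenspace_on_def)
  define X where "X = lift_op V x"
  have X: "X \<in> B"
    unfolding X_def by (rule lift_mem[OF xA])
  define Z where "Z n = cnj w ^ n *\<^sub>C (\<theta> ^^ n) X" for n
  have ww: "cnj w * w = 1"
    using complex_norm_square[of w] w by (simp add: mult.commute)
  have ZB: "Z n \<in> B" for n
    unfolding Z_def by (intro complex_vector.subspace_scale[OF B_subspace] \<theta>_mem X)
  have nZ: "norm (Z n) \<le> norm X" for n
    using norm_\<theta>_iter_le[OF X, of n] by (simp add: Z_def norm_scaleC norm_power w)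
  have PZ: "P n (Z n k) = Z n k" "Z n (P n k) = Z n k" for n k
  proof -
    have "P n o\<^sub>L Z n = Z n" "Z n o\<^sub>L P n = Z n"
      unfolding Z_def X_def
      by (simp_all add: scaleC_compose_left scaleC_compose_right B_clinear[OF P_mem] P_iter_lift[OF xA])
    then show "P n (Z n k) = Z n k" "Z n (P n k) = Z n k"
      by (metis blinfun_apply_blinfun_compose)+
  qed
  have martingale: "P m (Z n (P m k)) = Z m k" if "m \<le> n" for m n k
  proof -
    define j where "j = n - m"
    have n: "n = m + j"
      using that by (simp add: j_def)
    have "compress_op V ((\<theta> ^^ j) X) = w ^ j *\<^sub>C x"
      using iter_\<tau>[OF xA, of j] funpow_eigenvector[OF \<tau>_linear xA \<tau>x, of j] by (simp add: X_def)
    then have "(\<theta> ^^ m) (lift_op V (w ^ j *\<^sub>C x)) = P m o\<^sub>L (\<theta> ^^ m) ((\<theta> ^^ j) X) o\<^sub>L P m"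
      using iter_compress[OF \<theta>_mem[OF X], of m j] by simp
    moreover have "lift_op V (w ^ j *\<^sub>C x) = w ^ j *\<^sub>C X"
      by (simp add: X_def lift_op_def scaleC_compose_left scaleC_compose_right V_clinear)
    ultimately have "w ^ j *\<^sub>C (\<theta> ^^ m) X = P m o\<^sub>L (\<theta> ^^ n) X o\<^sub>L P m"
      by (simp add: clinear_on_scaleC[OF \<theta>_iter_linear X] n funpow_add)
    then have "cnj w ^ n *\<^sub>C w ^ j *\<^sub>C (\<theta> ^^ m) X k = P m (Z n (P m k))"
      by (metis (no_types, lifting) B_clinear P_mem Z_def blinfun_apply_blinfun_compose
          clinear_opsD scaleC_blinfun_apply)
    moreover have "cnj w ^ n * w ^ j = cnj w ^ m * (cnj w * w) ^ j"
      unfolding n power_add power_mult_distrib by simp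
    then have "cnj w ^ n * w ^ j = cnj w ^ m"
      by (simp add: ww)
    ultimately show ?thesis
      by (simp add: Z_def scaleC_blinfun_apply scaleC_scaleC)
  qed
  have tower: "(norm (Z n k - Z l k))\<^sup>2 = (norm (Z n k))\<^sup>2 - (norm (Z l k))\<^sup>2"
    if k: "P m k = k" and "m \<le> l" "l \<le> n" for m l n k
  proof -
    have "P l k = k"
      using P_increasing[OF \<open>m \<le> l\<close>, of k] by (simp add: k)
    then have Zl: "Z l k = P l (Z n k)"
      using martingale[OF \<open>l \<le> n\<close>, of k] by simp
    then have "inner (Z n k) (Z l k) = (norm (Z l k))\<^sup>2"
      by (simp add: norm_P_sq inner_commute)
    then show ?thesis
      unfolding norm_diff_sq by simp
  qed
  \<comment> \<open>the sequence is shifted by \<open>m\<close> because \<open>tower\<close> needs indices beyond \<open>m\<close>\<close>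
  have conv_dense: "Cauchy (\<lambda>n. Z n k)" if k: "P m k = k" for m k
  proof -
    define a where "a n = (norm (Z (n + m) k))\<^sup>2" for n
    have "incseq a"
      unfolding incseq_def a_def
      using tower[OF k, of "_ + m" "_ + m"] by (smt (verit, best) add_le_mono1 le_add2 zero_le_power2)
    moreover have "\<forall>n. a n \<le> (norm X * norm k)\<^sup>2"
      unfolding a_def
      using nZ by (meson mult_right_mono norm_blinfun norm_ge_zero order.trans power_mono)
    ultimately obtain L where "a \<longlonglongrightarrow> L"
      using incseq_convergent by blast
    then have Ca: "Cauchy a"
      by (rule LIMSEQ_imp_Cauchy)
    have "Cauchy (\<lambda>n. Z (n + m) k)"
    proof (rule CauchyI')
      fix e :: real assume "0 < e"
      then obtain N where N: "\<And>i j. i \<ge> N \<Longrightarrow> j \<ge> N \<Longrightarrow> norm (a i - a j) < e\<^sup>2"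
        using CauchyD[OF Ca, of "e\<^sup>2"] by auto
      have "dist (Z (i + m) k) (Z (j + m) k) < e" if "i \<ge> N" "i < j" for i j
      proof -
        have "(norm (Z (j + m) k - Z (i + m) k))\<^sup>2 = a j - a i"
          using tower[OF k, of "i + m" "j + m"] that by (simp add: a_def)
        also have "\<dots> < e\<^sup>2"
          using N[of j i] that by simp
        finally show ?thesis
          using \<open>0 < e\<close> by (metis dist_commute dist_norm less_imp_le power2_less_imp_less)
      qed
      then show "\<exists>M. \<forall>i\<ge>M. \<forall>j>i. dist (Z (i + m) k) (Z (j + m) k) < e"
        by blast
    qed
    then obtain l where "(\<lambda>n. Z (n + m) k) \<longlonglongrightarrow> l"
      unfolding Cauchy_convergent_iff convergent_def by blast
    then show ?thesis
      using LIMSEQ_offset[of "\<lambda>n. Z n k" m l] LIMSEQ_imp_Cauchy by blast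
  qed
  have conv: "convergent (\<lambda>n. Z n k)" for k
  proof -
    have "Cauchy (\<lambda>n. Z n k)"
    proof (rule metric_CauchyI)
      fix e :: real assume "0 < e"
      define d where "d = (e / 3) / (norm X + 1)"
      have "d > 0"
        using \<open>0 < e\<close> by (simp add: d_def add_nonneg_pos)
      then obtain m where m: "norm (P m k - k) < d"
        using LIMSEQ_D[OF P_tendsto] by blast
      have small: "norm (Z n k - Z n (P m k)) < e / 3" for n
      proof -
        have "norm (Z n k - Z n (P m k)) \<le> norm X * norm (k - P m k)"
          unfolding blinfun.diff_right[symmetric]
          by (meson nZ mult_right_mono norm_blinfun norm_ge_zero order.trans)
        also have "\<dots> \<le> (norm X + 1) * norm (k - P m k)"
          by (simp add: mult_right_mono)
        also have "\<dots> < (norm X + 1) * d"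
          using m by (intro mult_strict_left_mono) (auto simp: norm_minus_commute add_nonneg_pos)
        also have "\<dots> = e / 3"
          unfolding d_def using add_nonneg_pos[OF norm_ge_zero[of X] zero_less_one]
          by (intro nonzero_mult_div_cancel_left[THEN trans[OF times_divide_eq_right]]) simp
        finally show ?thesis .
      qed
      obtain N where N: "\<And>i j. i \<ge> N \<Longrightarrow> j \<ge> N \<Longrightarrow> norm (Z i (P m k) - Z j (P m k)) < e / 3"
        using CauchyD[OF conv_dense[of m "P m k"], of "e / 3"] \<open>0 < e\<close> by auto
      have "dist (Z i k) (Z j k) < e" if "i \<ge> N" "j \<ge> N" for i j
        using N[OF that] small[of i] small[of j]
          norm_triangle_ineq[of "Z i k - Z i (P m k)" "Z i (P m k) - Z j k"]
          norm_triangle_ineq[of "Z i (P m k) - Z j (P m k)" "Z j (P m k) - Z j k"]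
        by (simp add: dist_norm norm_minus_commute)
      then show "\<exists>M. \<forall>i\<ge>M. \<forall>j\<ge>M. dist (Z i k) (Z j k) < e"
        by blast
    qed
    then show ?thesis
      by (simp add: Cauchy_convergent_iff)
  qed
  obtain z where z: "\<And>k. (\<lambda>n. Z n k) \<longlonglongrightarrow> blinfun_apply z k"
    using pointwise_limit_blinfun[of Z, OF conv nZ] by blast
  have zB: "z \<in> B"
    by (rule von_neumann_algebra_limit[OF B_vN ZB z])
  have "\<theta> z = w *\<^sub>C z"
  proof (rule normal_on_limit[OF \<theta>_normal ZB nZ z zB])
    fix k
    have "\<theta> (Z n) = w *\<^sub>C Z (Suc n)" for n
    proof -
      have "w *\<^sub>C Z (Suc n) = ((cnj w * w) * cnj w ^ n) *\<^sub>C (\<theta> ^^ Suc n) X"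
        unfolding Z_def scaleC_scaleC by (simp add: mult.left_commute mult.commute)
      then show ?thesis
        by (simp add: Z_def ww clinear_on_scaleC[OF \<theta>_linear] \<theta>_mem X)
    qed
    then show "(\<lambda>n. \<theta> (Z n) k) \<longlonglongrightarrow> (w *\<^sub>C z) k"
      using bounded_linear.tendsto[OF bounded_linear_scaleC LIMSEQ_Suc[OF z]]
      by (simp add: scaleC_blinfun_apply)
  qed
  moreover have "compress_op V z = x"
  proof (rule blinfun_eqI)
    fix h
    have "op_adj V (Z n (V h)) = x h" for n
    proof -
      have "op_adj V (Z n (V h)) = op_adj V (P 0 (Z n (P 0 (V h))))"
        by simp
      also have "\<dots> = op_adj V (Z 0 (V h))"
        using martingale[of 0 n "V h"] by simp
      also have "\<dots> = x h"
        by (simp add: Z_def X_def lift_op_def)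
      finally show ?thesis .
    qed
    moreover have "(\<lambda>n. op_adj V (Z n (V h))) \<longlonglongrightarrow> op_adj V (z (V h))"
      by (rule blinfun.tendsto[OF tendsto_const z])
    ultimately show "compress_op V z h = x h"
      by (simp add: compress_op_def LIMSEQ_const_iff)
  qed
  ultimately show ?thesis
    using that zB by (simp add: eigenspace_on_def)
qed

lemma compress_eigenspace:
  assumes "cmod w = 1"
  shows "compress_op V ` eigenspace_on B \<theta> w = eigenspace_on A \<tau> w"
  using compress_eigenvector lift_eigenvector[OF _ assms] by blast

end

section \<open>The Choi--Effros product\<close>

text \<open>The properties of a dilation on which the Choi--Effros algebra depends. They hold for the
dilation of a unital map, with \<open>e = 1\<close>, and for the dilation read off from a unitization, with
\<open>e\<close> the limit of the projections \<open>\<theta>\<^sup>n(1)\<close>.\<close>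

locale peripheral_dilation =
  fixes A :: "('h::chilbert_space \<Rightarrow>\<^sub>L 'h) set" and \<tau>
    and V :: "'h \<Rightarrow>\<^sub>L 'k::chilbert_space" and B \<theta> and e :: "'k \<Rightarrow>\<^sub>L 'k"
  assumes V_clinear: "V \<in> clinear_ops"
    and B_clinear: "B \<subseteq> clinear_ops"
    and B_mult: "x \<in> B \<Longrightarrow> y \<in> B \<Longrightarrow> x o\<^sub>L y \<in> B"
    and B_adj: "x \<in> B \<Longrightarrow> op_adj x \<in> B"
    and \<theta>_mult: "x \<in> B \<Longrightarrow> y \<in> B \<Longrightarrow> \<theta> (x o\<^sub>L y) = \<theta> x o\<^sub>L \<theta> y"
    and \<theta>_adj: "x \<in> B \<Longrightarrow> \<theta> (op_adj x) = op_adj (\<theta> x)"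
    and compress_eigenspace:
      "cmod w = 1 \<Longrightarrow> compress_op V ` eigenspace_on B \<theta> w = eigenspace_on A \<tau> w"
    and compress_isometric:
      "z \<in> cspan (\<Union>w\<in>{w. cmod w = 1}. eigenspace_on B \<theta> w) \<Longrightarrow> norm (compress_op V z) = norm z"
    and e_fixed: "e \<in> eigenspace_on B \<theta> 1"
    and e_unit: "cmod w = 1 \<Longrightarrow> x \<in> eigenspace_on B \<theta> w \<Longrightarrow> e o\<^sub>L x = x \<and> x o\<^sub>L e = x"
begin

abbreviation "E \<equiv> \<Union>w\<in>{w. cmod w = 1}. eigenspace_on B \<theta> w"
abbreviation "F \<equiv> \<Union>w\<in>{w. cmod w = 1}. eigenspace_on A \<tau> w"
abbreviation "PB \<equiv> peripheral_space B \<theta>"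
abbreviation "PA \<equiv> peripheral_space A \<tau>"
abbreviation "c \<equiv> compress_op V"

lemma PB_eq: "PB = closure (cspan E)" and PA_eq: "PA = closure (cspan F)"
  by (simp_all add: peripheral_space_def)

lemma E_mult: "x \<in> E \<Longrightarrow> y \<in> E \<Longrightarrow> x o\<^sub>L y \<in> E"
proof -
  assume "x \<in> E" "y \<in> E"
  then obtain v w where v: "cmod v = 1" "x \<in> B" "\<theta> x = v *\<^sub>C x"
    and w: "cmod w = 1" "y \<in> B" "\<theta> y = w *\<^sub>C y"
    by (auto simp: eigenspace_on_def)
  have "\<theta> (x o\<^sub>L y) = (v * w) *\<^sub>C (x o\<^sub>L y)"
    using B_clinear v w
    by (simp add: \<theta>_mult scaleC_compose_left scaleC_compose_right scaleC_scaleC subset_iff)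
  then have "x o\<^sub>L y \<in> eigenspace_on B \<theta> (v * w)"
    by (simp add: eigenspace_on_def B_mult v w)
  then show ?thesis
    using v(1) w(1) by (auto simp: norm_mult intro!: exI[of _ "v * w"])
qed

lemma E_adj: "x \<in> E \<Longrightarrow> op_adj x \<in> E"
proof -
  assume "x \<in> E"
  then obtain v where v: "cmod v = 1" "x \<in> B" "\<theta> x = v *\<^sub>C x"
    by (auto simp: eigenspace_on_def)
  then have "op_adj x \<in> eigenspace_on B \<theta> (cnj v)"
    using B_clinear by (auto simp: eigenspace_on_def \<theta>_adj B_adj op_adj_scaleC)
  then show ?thesis
    using v(1) by (auto intro!: exI[of _ "cnj v"])
qed

lemma clinear_subspace: "csubspace (clinear_ops :: ('k \<Rightarrow>\<^sub>L 'k) set)"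
  by (auto simp: complex_vector.subspace_def clinear_ops_def blinfun.add_left scaleC_add_right
      scaleC_blinfun_apply scaleC_scaleC mult.commute)

lemma span_E_clinear: "x \<in> cspan E \<Longrightarrow> x \<in> clinear_ops"
  using complex_vector.span_minimal[OF _ clinear_subspace, of E] B_clinear
  by (auto simp: eigenspace_on_def)

lemma PB_clinear:
  assumes "x \<in> PB"
  shows "x \<in> clinear_ops"
proof -
  obtain X where X: "\<And>n. X n \<in> cspan E" "X \<longlonglongrightarrow> x"
    using assms unfolding PB_eq closure_sequential by blast
  show ?thesis
  proof (rule clinear_opsI)
    fix a k
    have l1: "(\<lambda>n. X n (a *\<^sub>C k)) \<longlonglongrightarrow> x (a *\<^sub>C k)"
      by (intro blinfun.tendsto X(2) tendsto_const)
    have "(\<lambda>n. a *\<^sub>C X n k) \<longlonglongrightarrow> a *\<^sub>C x k"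
      by (intro bounded_linear.tendsto[OF bounded_linear_scaleC] blinfun.tendsto X(2) tendsto_const)
    then have "(\<lambda>n. X n (a *\<^sub>C k)) \<longlonglongrightarrow> a *\<^sub>C x k"
      by (simp add: clinear_opsD[OF span_E_clinear[OF X(1)]])
    with l1 show "x (a *\<^sub>C k) = a *\<^sub>C x k"
      by (rule LIMSEQ_unique)
  qed
qed

lemma span_E_mult:
  assumes "x \<in> cspan E" "y \<in> cspan E"
  shows "x o\<^sub>L y \<in> cspan E"
  using assms(1)
proof (induction rule: complex_vector.span_induct_alt)
  case base
  show ?case
    by (simp add: compose_zero_left complex_vector.span_zero)
next
  case (step a u v)
  have "u o\<^sub>L y \<in> cspan E"
    using assms(2)
  proof (induction rule: complex_vector.span_induct_alt)
    case base
    show ?case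
      by (simp add: compose_zero_right complex_vector.span_zero)
  next
    case (step b s t)
    have "u \<in> clinear_ops"
      using span_E_clinear[OF complex_vector.span_base[OF \<open>u \<in> E\<close>]] .
    then have "u o\<^sub>L (b *\<^sub>C s + t) = b *\<^sub>C (u o\<^sub>L s) + (u o\<^sub>L t)"
      by (simp add: compose_add_right scaleC_compose_right)
    then show ?case
      using complex_vector.span_base[OF E_mult[OF \<open>u \<in> E\<close> step(1)]] step(2)
      by (simp add: complex_vector.span_add complex_vector.span_scale)
  qed
  then show ?case
    using step(2)
    by (simp add: compose_add_left scaleC_compose_left complex_vector.span_add
        complex_vector.span_scale)
qed

lemma span_E_adj:
  assumes "x \<in> cspan E"
  shows "x \<in> clinear_ops \<and> op_adj x \<in> cspan E"
  using assms
proof (induction rule: complex_vector.span_induct_alt)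
  case base
  have zero: "(0 :: 'k \<Rightarrow>\<^sub>L 'k) \<in> clinear_ops"
    by (simp add: clinear_ops_def)
  have "op_adj 0 = (0 :: 'k \<Rightarrow>\<^sub>L 'k)"
    by (rule op_adj_unique) (simp_all add: zero)
  then show ?case
    by (simp add: zero complex_vector.span_zero)
next
  case (step a u v)
  have au: "a *\<^sub>C u \<in> clinear_ops" "u \<in> clinear_ops"
    using span_E_clinear complex_vector.span_base[OF step(1)] complex_vector.span_scale by blast+
  then have "op_adj (a *\<^sub>C u + v) = cnj a *\<^sub>C op_adj u + op_adj v"
    using step(2) by (simp add: op_adj_add op_adj_scaleC)
  then show ?case
    using complex_vector.span_base[OF E_adj[OF step(1)]] step(2) au
      complex_vector.subspace_add[OF clinear_subspace]
    by (simp add: complex_vector.span_add complex_vector.span_scale)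
qed

lemma PB_sequence:
  assumes "x \<in> PB"
  obtains X where "\<And>n. X n \<in> cspan E" "X \<longlonglongrightarrow> x"
proof -
  obtain X where "\<forall>n. X n \<in> cspan E" "X \<longlonglongrightarrow> x"
    using assms unfolding PB_eq closure_sequential by auto
  then show ?thesis
    using that[of X] by simp
qed

lemma PB_limit: "(\<And>n. X n \<in> cspan E) \<Longrightarrow> X \<longlonglongrightarrow> x \<Longrightarrow> x \<in> PB"
  unfolding PB_eq closure_sequential by blast

lemma PB_mult:
  assumes "x \<in> PB" "y \<in> PB"
  shows "x o\<^sub>L y \<in> PB"
proof -
  obtain X Y where "\<And>n. X n \<in> cspan E" "X \<longlonglongrightarrow> x" "\<And>n. Y n \<in> cspan E" "Y \<longlonglongrightarrow> y"
    using PB_sequence assms by metis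
  then show ?thesis
    by (intro PB_limit[of "\<lambda>n. X n o\<^sub>L Y n"] span_E_mult tendsto_compose)
qed

lemma PB_subspace: "csubspace PB"
  unfolding complex_vector.subspace_def
proof (intro conjI ballI allI)
  show "0 \<in> PB"
    using complex_vector.span_zero[of E] closure_subset unfolding PB_eq by blast
  fix x assume "x \<in> PB"
  then obtain X where X: "\<And>n. X n \<in> cspan E" "X \<longlonglongrightarrow> x"
    by (rule PB_sequence) (rule that)
  then show "a *\<^sub>C x \<in> PB" for a
    by (intro PB_limit[of "\<lambda>n. a *\<^sub>C X n"] complex_vector.span_scale
        bounded_linear.tendsto[OF bounded_linear_scaleC])
  fix y assume "y \<in> PB"
  then obtain Y where "\<And>n. Y n \<in> cspan E" "Y \<longlonglongrightarrow> y"
    by (rule PB_sequence) (rule that)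
  with X show "x + y \<in> PB"
    by (intro PB_limit[of "\<lambda>n. X n + Y n"] complex_vector.span_add tendsto_add)
qed

lemma PB_adj:
  assumes "x \<in> PB"
  shows "op_adj x \<in> PB"
proof -
  obtain X where X: "\<And>n. X n \<in> cspan E" "X \<longlonglongrightarrow> x"
    using assms by (rule PB_sequence) (rule that)
  have diff: "op_adj (X n) - op_adj x = op_adj (X n - x)" for n
  proof (rule op_adj_unique[symmetric])
    have "X n \<in> clinear_ops" "x \<in> clinear_ops"
      using span_E_clinear[OF X(1)] PB_clinear[OF assms] .
    then show "X n - x \<in> clinear_ops"
      "cinner (blinfun_apply (op_adj (X n) - op_adj x) v) u = cinner v ((X n - x) u)" for u v
      by (auto simp: blinfun.diff_left cinner_diff_left cinner_diff_right cinner_op_adj)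
  qed
  have "(\<lambda>n. op_adj (X n) - op_adj x) \<longlonglongrightarrow> 0"
  proof (rule Lim_null_comparison[OF always_eventually])
    show "\<forall>n. norm (op_adj (X n) - op_adj x) \<le> norm (X n - x)"
      unfolding diff
      using norm_op_adj_le clinear_diff span_E_clinear[OF X(1)] PB_clinear[OF assms] by blast
    show "(\<lambda>n. norm (X n - x)) \<longlonglongrightarrow> 0"
      using X(2) by (simp add: LIM_zero_iff tendsto_norm_zero)
  qed
  then have "(\<lambda>n. op_adj (X n)) \<longlonglongrightarrow> op_adj x"
    by (rule LIM_zero_cancel)
  then show ?thesis
    using span_E_adj[OF X(1)] by (intro PB_limit[of "\<lambda>n. op_adj (X n)"]) auto
qed

lemma c_add: "c (x + y) = c x + c y"
  and c_diff: "c (x - y) = c x - c y"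
  and c_scale: "c (a *\<^sub>C x) = a *\<^sub>C c x"
  by (simp_all add: compress_op_add compress_op_diff compress_op_scaleC[OF V_clinear])

lemma c_tendsto: "X \<longlonglongrightarrow> x \<Longrightarrow> (\<lambda>n. c (X n)) \<longlonglongrightarrow> c x"
  unfolding compress_op_def by (intro tendsto_compose tendsto_const)

lemma c_span: "c ` cspan E = cspan F"
proof
  show "c ` cspan E \<subseteq> cspan F"
  proof (rule image_subsetI)
    fix x assume "x \<in> cspan E"
    then show "c x \<in> cspan F"
    proof (induction rule: complex_vector.span_induct_alt)
      case base
      show ?case
        by (simp add: compress_op_def compose_zero_left compose_zero_right complex_vector.span_zero)
    next
      case (step a u v)
      then have "c u \<in> F"
        using compress_eigenspace by blast
      with step(2) show ?case
        by (simp add: c_add c_scale complex_vector.span_add complex_vector.span_scale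
            complex_vector.span_base)
    qed
  qed
  have "csubspace (c ` cspan E)"
    unfolding complex_vector.subspace_def
  proof (intro conjI ballI allI)
    have "c 0 = 0"
      by (simp add: compress_op_def compose_zero_left compose_zero_right)
    then show "0 \<in> c ` cspan E"
      by (metis complex_vector.span_zero image_eqI)
    show "x + y \<in> c ` cspan E" if "x \<in> c ` cspan E" "y \<in> c ` cspan E" for x y
      using that by (auto simp flip: c_add intro!: imageI complex_vector.span_add)
    show "a *\<^sub>C x \<in> c ` cspan E" if "x \<in> c ` cspan E" for a x
      using that by (auto simp flip: c_scale intro!: imageI complex_vector.span_scale)
  qed
  moreover have "F \<subseteq> c ` cspan E"
  proof
    fix y assume "y \<in> F"
    then obtain w where w: "cmod w = 1" "y \<in> eigenspace_on A \<tau> w"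
      by auto
    then obtain x where x: "x \<in> eigenspace_on B \<theta> w" "y = c x"
      unfolding compress_eigenspace[OF w(1), symmetric] by auto
    then have "x \<in> cspan E"
      using w(1) by (intro complex_vector.span_base) auto
    then show "y \<in> c ` cspan E"
      using x(2) by simp
  qed
  ultimately show "cspan F \<subseteq> c ` cspan E"
    by (rule complex_vector.span_minimal[rotated])
qed

lemma norm_c:
  assumes "x \<in> PB"
  shows "norm (c x) = norm x"
proof -
  obtain X where X: "\<And>n. X n \<in> cspan E" "X \<longlonglongrightarrow> x"
    using assms by (rule PB_sequence) (rule that)
  have "(\<lambda>n. norm (c (X n))) \<longlonglongrightarrow> norm (c x)"
    by (intro tendsto_norm c_tendsto X(2))
  moreover have "(\<lambda>n. norm (c (X n))) \<longlonglongrightarrow> norm x"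
    using tendsto_norm[OF X(2)] by (simp add: compress_isometric[OF X(1)])
  ultimately show ?thesis
    by (rule LIMSEQ_unique)
qed

lemma c_PB: "c ` PB = PA"
proof
  show "c ` PB \<subseteq> PA"
  proof (rule image_subsetI)
    fix x assume "x \<in> PB"
    then obtain X where X: "\<And>n. X n \<in> cspan E" "X \<longlonglongrightarrow> x"
      by (rule PB_sequence) (rule that)
    have "\<forall>n. c (X n) \<in> c ` cspan E" "(\<lambda>n. c (X n)) \<longlonglongrightarrow> c x"
      using X(1) c_tendsto[OF X(2)] by simp_all
    then show "c x \<in> PA"
      unfolding PA_eq closure_sequential c_span[symmetric]
      by (intro exI[of _ "\<lambda>n. c (X n)"]) simp
  qed
  \<comment> \<open>a Cauchy sequence in the image comes from a Cauchy sequence, since \<open>c\<close> is isometric\<close>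
  show "PA \<subseteq> c ` PB"
  proof
    fix y assume "y \<in> PA"
    then have "\<exists>Y. (\<forall>n. Y n \<in> c ` cspan E) \<and> Y \<longlonglongrightarrow> y"
      unfolding PA_eq closure_sequential c_span[symmetric] .
    then obtain Y where Y: "\<forall>n. Y n \<in> c ` cspan E" "Y \<longlonglongrightarrow> y"
      by (elim exE conjE)
    have "\<exists>X. X \<in> cspan E \<and> Y n = c X" for n
      using Y(1)[rule_format, of n] by (elim imageE) (intro exI conjI)
    then obtain X where X: "\<And>n. X n \<in> cspan E" "\<And>n. Y n = c (X n)"
      by metis
    have "dist (X m) (X n) = dist (Y m) (Y n)" for m n
      using compress_isometric[OF complex_vector.span_diff[OF X(1) X(1)]]
      by (simp add: dist_norm X(2) c_diff)
    then have "Cauchy X"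
      using LIMSEQ_imp_Cauchy[OF Y(2)] by (simp add: Cauchy_def)
    then obtain x where x: "X \<longlonglongrightarrow> x"
      unfolding Cauchy_convergent_iff convergent_def by blast
    have "y = c x"
      using Y(2) c_tendsto[OF x] unfolding X(2)[symmetric] by (rule LIMSEQ_unique)
    then show "y \<in> c ` PB"
      using PB_limit[OF X(1) x] by blast
  qed
qed

lemma c_inj:
  assumes "x \<in> PB" "y \<in> PB" "c x = c y"
  shows "x = y"
  using norm_c[OF complex_vector.subspace_diff[OF PB_subspace assms(1,2)]] assms(3)
  by (simp add: c_diff)

lemma lift_c:
  assumes "x \<in> PB"
  shows "peripheral_lift V B \<theta> (c x) = x"
  unfolding peripheral_lift_def
  by (rule the_equality) (use assms c_inj in auto)

lemma choi_effros_c: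
  assumes "x \<in> PB" "y \<in> PB"
  shows "choi_effros V B \<theta> (c x) (c y) = c (x o\<^sub>L y)"
  by (simp add: choi_effros_def lift_c assms)

lemma c_op_adj:
  assumes "x \<in> PB"
  shows "op_adj (c x) = c (op_adj x)"
  by (simp add: compress_op_adj[OF V_clinear PB_clinear[OF assms]])

text \<open>All the axioms are transported along the isometric bijection \<open>c\<close> from the algebra
  \<open>PB\<close> of operators.\<close>

lemma cstar_algebra_choi_effros: "cstar_algebra_on PA (choi_effros V B \<theta>) op_adj"
proof -
  have complete: "complete PA"
    unfolding PA_eq complete_eq_closed by simp
  have sub: "csubspace (c ` PB)"
    unfolding complex_vector.subspace_def
  proof (intro conjI ballI allI)
    have "c 0 = 0"
      by (simp add: compress_op_def compose_zero_left compose_zero_right)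
    then show "0 \<in> c ` PB"
      by (metis complex_vector.subspace_0[OF PB_subspace] image_eqI)
    show "x + y \<in> c ` PB" if "x \<in> c ` PB" "y \<in> c ` PB" for x y
      using that by (auto simp flip: c_add intro!: imageI complex_vector.subspace_add[OF PB_subspace])
    show "a *\<^sub>C x \<in> c ` PB" if "x \<in> c ` PB" for a x
      using that by (auto simp flip: c_scale intro!: imageI complex_vector.subspace_scale[OF PB_subspace])
  qed
  note add = complex_vector.subspace_add[OF PB_subspace]
    and scale = complex_vector.subspace_scale[OF PB_subspace]
  show ?thesis
    unfolding cstar_algebra_on_def c_PB[symmetric] clinear_on_def ball_simps
  proof (intro conjI ballI allI)
    show "csubspace (c ` PB)" by (rule sub)
    show "complete (c ` PB)" using complete by (simp add: c_PB)
    fix x assume x: "x \<in> PB"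
    note ax = PB_adj[OF x]
    have xl: "x \<in> clinear_ops"
      by (rule PB_clinear[OF x])
    show "op_adj (c x) \<in> c ` PB" "op_adj (op_adj (c x)) = c x"
      using ax by (simp_all add: c_op_adj x op_adj_op_adj[OF xl])
    show "op_adj (a *\<^sub>C c x) = cnj a *\<^sub>C op_adj (c x)" for a
      by (simp add: c_scale[symmetric] c_op_adj x scale op_adj_scaleC[OF xl])
    show "norm (choi_effros V B \<theta> (op_adj (c x)) (c x)) = (norm (c x))\<^sup>2"
      by (simp add: c_op_adj x choi_effros_c ax norm_c PB_mult norm_adj_compose_self[OF xl])
    fix y assume y: "y \<in> PB"
    show "choi_effros V B \<theta> (c x) (c y) \<in> c ` PB"
      by (simp add: choi_effros_c x y PB_mult)
    show "choi_effros V B \<theta> (c x) (a *\<^sub>C c y) = a *\<^sub>C choi_effros V B \<theta> (c x) (c y)"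
      "choi_effros V B \<theta> (a *\<^sub>C c y) (c x) = a *\<^sub>C choi_effros V B \<theta> (c y) (c x)" for a
      by (simp_all add: c_scale[symmetric] choi_effros_c x y scale scaleC_compose_left
          scaleC_compose_right[OF xl])
    show "norm (choi_effros V B \<theta> (c x) (c y)) \<le> norm (c x) * norm (c y)"
      by (simp add: choi_effros_c x y norm_c PB_mult norm_blinfun_compose)
    show "op_adj (c x + c y) = op_adj (c x) + op_adj (c y)"
      by (simp add: c_add[symmetric] c_op_adj x y add op_adj_add[OF xl PB_clinear[OF y]])
    show "op_adj (choi_effros V B \<theta> (c x) (c y)) = choi_effros V B \<theta> (op_adj (c y)) (op_adj (c x))"
      by (simp add: choi_effros_c x y PB_mult PB_adj c_op_adj op_adj_compose[OF xl PB_clinear[OF y]])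
    fix z assume z: "z \<in> PB"
    show "choi_effros V B \<theta> (choi_effros V B \<theta> (c x) (c y)) (c z)
        = choi_effros V B \<theta> (c x) (choi_effros V B \<theta> (c y) (c z))"
      by (simp add: choi_effros_c x y z PB_mult compose_assoc)
    show "choi_effros V B \<theta> (c x) (c y + c z)
        = choi_effros V B \<theta> (c x) (c y) + choi_effros V B \<theta> (c x) (c z)"
      "choi_effros V B \<theta> (c y + c z) (c x)
        = choi_effros V B \<theta> (c y) (c x) + choi_effros V B \<theta> (c z) (c x)"
      by (simp_all add: c_add[symmetric] choi_effros_c x y z add compose_add_left compose_add_right)
  qed
qed

lemma choi_effros_unit: "is_unit_on PA (choi_effros V B \<theta>) (c e)"
proof -
  have "e \<in> E"
    using e_fixed by (auto intro!: exI[of _ 1])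
  then have e: "e \<in> PB"
    unfolding PB_eq by (intro subsetD[OF closure_subset] complex_vector.span_base)
  have span: "e o\<^sub>L x = x \<and> x o\<^sub>L e = x" if "x \<in> cspan E" for x
    using that
  proof (induction rule: complex_vector.span_induct_alt)
    case base
    show ?case
      by (simp add: compose_zero_left compose_zero_right)
  next
    case (step a u v)
    then have "e o\<^sub>L u = u \<and> u o\<^sub>L e = u"
      using e_unit by auto
    with step(2) show ?case
      by (simp add: compose_add_left compose_add_right scaleC_compose_left
          scaleC_compose_right[OF PB_clinear[OF e]])
  qed
  have unit: "e o\<^sub>L x = x \<and> x o\<^sub>L e = x" if x: "x \<in> PB" for x
  proof -
    obtain X where X: "\<And>n. X n \<in> cspan E" "X \<longlonglongrightarrow> x"
      using x by (rule PB_sequence) (rule that)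
    have "(\<lambda>n. e o\<^sub>L X n) \<longlonglongrightarrow> (e o\<^sub>L x)" "(\<lambda>n. X n o\<^sub>L e) \<longlonglongrightarrow> (x o\<^sub>L e)"
      by (intro tendsto_compose tendsto_const X(2))+
    then show ?thesis
      using X(2) span[OF X(1)] by (auto intro: LIMSEQ_unique)
  qed
  show ?thesis
    unfolding is_unit_on_def c_PB[symmetric] using e unit by (auto simp: choi_effros_c)
qed

end

section \<open>Dilations of non-unital maps\<close>

lemma dsum_add: "dsum a c + dsum b d = dsum (a + b) (c + d)"
  by (rule blinfun_eqI) (simp add: dsum_apply blinfun.add_left algebra_simps)

lemma dsum_scaleC: "s *\<^sub>C dsum a c = dsum (s *\<^sub>C a) (s * c)"
  by (rule blinfun_eqI)
    (simp add: dsum_apply scaleC_blinfun_apply scaleC_prod_def scaleC_complex_def)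

lemma dsum_compose: "dsum a c o\<^sub>L dsum b d = dsum (a o\<^sub>L b) (c * d)"
  by (rule blinfun_eqI) (simp add: dsum_apply)

lemma dsum_zero: "dsum 0 0 = 0"
  by (rule blinfun_eqI) (simp add: dsum_apply zero_prod_def)

lemma dsum_id: "dsum id_blinfun 1 = id_blinfun"
  by (rule blinfun_eqI) (simp add: dsum_apply)

lemma dsum_inject: "dsum a c = dsum b d \<longleftrightarrow> a = b \<and> c = d"
  by (metis op_part_dsum scalar_part_dsum)

lemma dsum_clinear_iff: "dsum a c \<in> clinear_ops \<longleftrightarrow> a \<in> clinear_ops"
proof
  assume *: "dsum a c \<in> clinear_ops"
  show "a \<in> clinear_ops"
  proof (rule clinear_opsI)
    show "a (s *\<^sub>C x) = s *\<^sub>C a x" for s x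
      using clinear_opsD[OF *, of s "(x, 0)"] by (simp add: dsum_apply scaleC_prod_def)
  qed
qed (simp add: clinear_ops_def dsum_apply scaleC_prod_def scaleC_complex_def)

lemma op_adj_dsum:
  assumes "a \<in> clinear_ops"
  shows "op_adj (dsum a c) = dsum (op_adj a) (cnj c)"
  by (rule op_adj_unique)
    (simp_all add: dsum_clinear_iff assms dsum_apply cinner_prod_def cinner_complex_def cinner_op_adj)

lemma norm_dsum_zero: "norm (dsum a 0) = norm a"
proof (rule order_antisym)
  show "norm (dsum a 0) \<le> norm a"
  proof (rule norm_blinfun_bound)
    fix x :: "'a \<times> complex"
    have "norm (dsum a 0 x) \<le> norm a * norm (fst x)"
      by (simp add: dsum_apply norm_blinfun)
    also have "\<dots> \<le> norm a * norm x"
      using norm_fst_le[of "fst x" "snd x"] by (intro mult_left_mono) simp_all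
    finally show "norm (dsum a 0 x) \<le> norm a * norm x" .
  qed simp
  show "norm a \<le> norm (dsum a 0)"
  proof (rule norm_blinfun_bound)
    show "norm (a x) \<le> norm (dsum a 0) * norm x" for x
      using norm_blinfun[of "dsum a 0" "(x, 0)"] by (simp add: dsum_apply)
  qed simp
qed

lemma dsum_mem_unitized_iff: "dsum a c \<in> unitized_algebra M \<longleftrightarrow> a \<in> M"
  by (auto simp: unitized_algebra_def dsum_inject)

lemma compress_op_dsum:
  "V \<in> clinear_ops \<Longrightarrow> compress_op (dsum V 1) (dsum z c) = dsum (compress_op V z) c"
  by (simp add: compress_op_def op_adj_dsum dsum_compose)

lemma lift_op_dsum:
  "V \<in> clinear_ops \<Longrightarrow> lift_op (dsum V 1) (dsum z c) = dsum (lift_op V z) c"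
  by (simp add: lift_op_def op_adj_dsum dsum_compose)

lemma unitized_map_dsum_zero: "unitized_map f (dsum x 0) = dsum (f x) 0"
  by (simp add: unitized_map_dsum)

lemma unitized_map_iter_dsum_zero: "(unitized_map f ^^ n) (dsum x 0) = dsum ((f ^^ n) x) 0"
  by (induction n) (simp_all add: unitized_map_dsum_zero)

text \<open>The corner \<open>0 \<oplus> 1\<close> of the unitization records the defect
\<open>1 - f\<^sup>n(1)\<close>.\<close>

lemma unitized_map_iter_corner:
  assumes "clinear_on M f" "csubspace M" "f ` M \<subseteq> M" "id_blinfun \<in> M"
  shows "(unitized_map f ^^ n) (dsum 0 1) = dsum (id_blinfun - (f ^^ n) id_blinfun) 1"
proof (induction n)
  case (Suc n)
  show ?case
    by (simp add: Suc unitized_map_dsum clinear_on_diff[OF assms(1,2)] assms(4) funpow_mem[OF assms(3)])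
qed simp

lemma dsum_eigenspace_iff:
  "dsum z 0 \<in> eigenspace_on (unitized_algebra M) (unitized_map f) w \<longleftrightarrow> z \<in> eigenspace_on M f w"
  by (simp add: eigenspace_on_def dsum_mem_unitized_iff unitized_map_dsum_zero dsum_scaleC dsum_inject)

lemma dsum_span_eigenspaces:
  assumes "z \<in> cspan (\<Union>w\<in>W. eigenspace_on M f w)"
  shows "dsum z 0 \<in> cspan (\<Union>w\<in>W. eigenspace_on (unitized_algebra M) (unitized_map f) w)"
  using assms
proof (induction rule: complex_vector.span_induct_alt)
  case base
  show ?case
    by (simp add: dsum_zero complex_vector.span_zero)
next
  case (step c x y)
  have "dsum (c *\<^sub>C x + y) 0 = c *\<^sub>C dsum x 0 + dsum y 0"
    by (simp add: dsum_scaleC dsum_add)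
  moreover have "dsum x 0 \<in> (\<Union>w\<in>W. eigenspace_on (unitized_algebra M) (unitized_map f) w)"
    using step(1) by (simp add: dsum_eigenspace_iff)
  ultimately show ?case
    using step(2) by (simp add: complex_vector.span_add complex_vector.span_scale complex_vector.span_base)
qed

lemma projection_positive:
  assumes "R \<in> clinear_ops" "op_adj R = R" "R o\<^sub>L R = R"
  shows "op_positive R"
proof -
  have "cinner h (R h) = cinner (R h) (R h)" for h
    using cinner_op_adj[OF assms(1), of h "R h"] arg_cong[OF assms(3), of "\<lambda>T. blinfun_apply T h"]
    by (simp add: assms(2))
  then show ?thesis
    using assms(1) by (simp add: op_positive_iff cinner_same)
qed

locale unitized_dilation = contractive_cp_map A \<tau>
  for A :: "('h::chilbert_space \<Rightarrow>\<^sub>L 'h) set" and \<tau> +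
  fixes V :: "'h \<Rightarrow>\<^sub>L 'k::chilbert_space" and B \<theta>
  assumes dilation: "dilation_conditions (unitized_algebra A) (unitized_map \<tau>)
            (dsum V 1) (unitized_algebra B) (unitized_map \<theta>)"
begin

sublocale U: unital_dilation "unitized_algebra A" "unitized_map \<tau>" "dsum V 1"
  "unitized_algebra B" "unitized_map \<theta>"
proof
  show "unitized_map \<tau> id_blinfun = id_blinfun"
    by (metis add.commute diff_add_cancel dsum_id scaleC_one unitized_map_dsum)
qed (rule dilation)

lemma V_clinear: "V \<in> clinear_ops"
  using U.V_clinear by (simp add: dsum_clinear_iff)

lemma V_adj_V: "op_adj V o\<^sub>L V = id_blinfun"
proof (rule isometry_adj_compose[OF V_clinear])
  show "norm (V h) = norm h" for h
    using U.V_norm[of "(h, 0)"] by (simp add: dsum_apply)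
qed

lemma B_clinear: "B \<subseteq> clinear_ops"
  using U.B_clinear[of "dsum _ 0"] by (auto simp: dsum_mem_unitized_iff dsum_clinear_iff)

lemma B_one: "id_blinfun \<in> B"
  using U.B_one unfolding dsum_id[symmetric] dsum_mem_unitized_iff .

lemma B_mult: "x \<in> B \<Longrightarrow> y \<in> B \<Longrightarrow> x o\<^sub>L y \<in> B"
  using U.B_mult[of "dsum x 0" "dsum y 0"] by (simp add: dsum_compose dsum_mem_unitized_iff)

lemma B_adj: "x \<in> B \<Longrightarrow> op_adj x \<in> B"
  using U.B_adj[of "dsum x 0"] B_clinear
  by (auto simp: op_adj_dsum dsum_mem_unitized_iff)

lemma B_subspace: "csubspace B"
  unfolding complex_vector.subspace_def
proof (intro conjI ballI allI)
  note sub = U.B_subspace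
  show "0 \<in> B"
    using complex_vector.subspace_0[OF sub] unfolding dsum_zero[symmetric] dsum_mem_unitized_iff .
  show "x + y \<in> B" if "x \<in> B" "y \<in> B" for x y
    using complex_vector.subspace_add[OF sub, of "dsum x 0" "dsum y 0"] that
    by (simp add: dsum_add dsum_mem_unitized_iff)
  show "c *\<^sub>C x \<in> B" if "x \<in> B" for c x
    using complex_vector.subspace_scale[OF sub, of "dsum x 0" c] that
    by (simp add: dsum_scaleC dsum_mem_unitized_iff)
qed

lemma \<theta>_image: "\<theta> ` B \<subseteq> B"
proof
  fix y assume "y \<in> \<theta> ` B"
  then obtain x where "x \<in> B" "y = \<theta> x" by blast
  then show "y \<in> B"
    using U.\<theta>_mem[of "dsum x 0" 1]
    by (simp add: dsum_mem_unitized_iff unitized_map_dsum_zero)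
qed

lemma \<theta>_linear: "clinear_on B \<theta>"
  unfolding clinear_on_def
proof (intro conjI ballI allI)
  show "\<theta> (x + y) = \<theta> x + \<theta> y" if "x \<in> B" "y \<in> B" for x y
    using clinear_on_add[OF U.\<theta>_linear, of "dsum x 0" "dsum y 0"] that
    by (simp add: dsum_mem_unitized_iff unitized_map_dsum_zero dsum_add dsum_inject)
  show "\<theta> (c *\<^sub>C x) = c *\<^sub>C \<theta> x" if "x \<in> B" for c x
    using clinear_on_scaleC[OF U.\<theta>_linear, of "dsum x 0" c] that
    by (simp add: dsum_mem_unitized_iff unitized_map_dsum_zero dsum_scaleC dsum_inject)
qed

lemma \<theta>_mult: "x \<in> B \<Longrightarrow> y \<in> B \<Longrightarrow> \<theta> (x o\<^sub>L y) = \<theta> x o\<^sub>L \<theta> y"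
  using U.\<theta>_mult[of "dsum x 0" "dsum y 0"]
  by (simp add: dsum_mem_unitized_iff unitized_map_dsum_zero dsum_compose dsum_inject)

lemma \<theta>_adj:
  assumes "x \<in> B"
  shows "\<theta> (op_adj x) = op_adj (\<theta> x)"
proof -
  have "x \<in> clinear_ops" "\<theta> x \<in> clinear_ops"
    using assms \<theta>_image B_clinear by auto
  then show ?thesis
    using U.\<theta>_adj[of "dsum x 0"] assms
    by (simp add: dsum_mem_unitized_iff unitized_map_dsum_zero op_adj_dsum dsum_inject)
qed

lemma compress_eigenspace:
  assumes "cmod w = 1"
  shows "compress_op V ` eigenspace_on B \<theta> w = eigenspace_on A \<tau> w"
proof
  show "compress_op V ` eigenspace_on B \<theta> w \<subseteq> eigenspace_on A \<tau> w"
  proof (rule image_subsetI)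
    fix z assume "z \<in> eigenspace_on B \<theta> w"
    then have "dsum z 0 \<in> eigenspace_on (unitized_algebra B) (unitized_map \<theta>) w"
      by (simp add: dsum_eigenspace_iff)
    then show "compress_op V z \<in> eigenspace_on A \<tau> w"
      using U.compress_eigenvector by (fastforce simp: compress_op_dsum[OF V_clinear] dsum_eigenspace_iff)
  qed
  show "eigenspace_on A \<tau> w \<subseteq> compress_op V ` eigenspace_on B \<theta> w"
  proof
    fix x assume "x \<in> eigenspace_on A \<tau> w"
    then have "dsum x 0 \<in> eigenspace_on (unitized_algebra A) (unitized_map \<tau>) w"
      by (simp add: dsum_eigenspace_iff)
    then obtain Z where Z: "Z \<in> eigenspace_on (unitized_algebra B) (unitized_map \<theta>) w"
      "compress_op (dsum V 1) Z = dsum x 0"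
      using U.lift_eigenvector[OF _ assms] by blast
    then obtain z c where zc: "Z = dsum z c"
      by (auto simp: eigenspace_on_def unitized_algebra_def)
    with Z(2) have "compress_op V z = x" "c = 0"
      by (simp_all add: compress_op_dsum[OF V_clinear] dsum_inject)
    with Z(1) zc show "x \<in> compress_op V ` eigenspace_on B \<theta> w"
      by (auto simp: dsum_eigenspace_iff)
  qed
qed

lemma compress_isometric:
  assumes "z \<in> cspan (\<Union>w\<in>{w. cmod w = 1}. eigenspace_on B \<theta> w)"
  shows "norm (compress_op V z) = norm z"
  using U.compress_isometric[OF dsum_span_eigenspaces[OF assms]]
  by (simp add: compress_op_dsum[OF V_clinear] norm_dsum_zero)

text \<open>These projections decrease. A peripheral eigenvector \<open>x = w\<^sup>-\<^sup>n \<theta>\<^sup>n(x)\<close> lies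
in the corner of each of them, which makes their limit a unit for all such \<open>x\<close>.\<close>

definition Q :: "nat \<Rightarrow> 'k \<Rightarrow>\<^sub>L 'k"
  where "Q n = (\<theta> ^^ n) id_blinfun"

lemma Q_mem: "Q n \<in> B"
  unfolding Q_def by (rule funpow_mem[OF \<theta>_image B_one])

lemma Q_iter:
  assumes "x \<in> B"
  shows "Q n o\<^sub>L (\<theta> ^^ n) x = (\<theta> ^^ n) x" "(\<theta> ^^ n) x o\<^sub>L Q n = (\<theta> ^^ n) x"
proof -
  have "(\<theta> ^^ n) (x o\<^sub>L y) = (\<theta> ^^ n) x o\<^sub>L (\<theta> ^^ n) y" if "x \<in> B" "y \<in> B" for x y
    using that by (induction n) (simp_all add: \<theta>_mult funpow_mem[OF \<theta>_image])
  from this[OF B_one assms] this[OF assms B_one]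
  show "Q n o\<^sub>L (\<theta> ^^ n) x = (\<theta> ^^ n) x" "(\<theta> ^^ n) x o\<^sub>L Q n = (\<theta> ^^ n) x"
    by (simp_all add: Q_def)
qed

lemma Q_adj: "op_adj (Q n) = Q n"
  unfolding Q_def by (induction n) (simp_all add: \<theta>_adj[symmetric] funpow_mem[OF \<theta>_image B_one])

lemma Q_decreasing: "Q n o\<^sub>L Q (Suc n) = Q (Suc n)" "Q (Suc n) o\<^sub>L Q n = Q (Suc n)"
  using Q_iter[OF subsetD[OF \<theta>_image imageI[OF B_one]], of n]
  by (simp_all add: Q_def funpow_swap1)

lemma norm_Q_le: "norm (Q n) \<le> 1"
proof -
  have "norm ((unitized_map \<theta> ^^ n) (dsum id_blinfun 0)) \<le> norm (dsum id_blinfun 0 :: ('k \<times> complex) \<Rightarrow>\<^sub>L _)"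
    by (rule U.norm_\<theta>_iter_le) (simp add: dsum_mem_unitized_iff B_one)
  then show ?thesis
    using norm_blinfun_id_le[where 'a = 'k]
    by (simp add: unitized_map_iter_dsum_zero norm_dsum_zero Q_def)
qed

lemma Q_limit:
  obtains e where "\<And>h. (\<lambda>n. Q n h) \<longlonglongrightarrow> blinfun_apply e h"
proof (rule decreasing_positive_convergent[of Q])
  fix n
  have lin: "Q n \<in> clinear_ops" for n
    using Q_mem B_clinear by blast
  have idem: "Q n o\<^sub>L Q n = Q n" for n
    using Q_iter(1)[OF B_one] by (simp add: Q_def)
  show "op_positive (Q n)"
    by (rule projection_positive[OF lin Q_adj idem])
  have "Q n - Q (Suc n) = Q n + (- 1) *\<^sub>C Q (Suc n)"
    by simp
  then have "op_adj (Q n - Q (Suc n)) = Q n - Q (Suc n)"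
    using op_adj_add[OF lin[of n], of "(- 1) *\<^sub>C Q (Suc n)"] op_adj_scaleC[OF lin[of "Suc n"], of "- 1"]
      clinear_diff[of 0 "Q (Suc n)"] lin
    by (simp add: Q_adj clinear_ops_def)
  then show "op_le (Q (Suc n)) (Q n)"
    unfolding op_le_def
    by (intro projection_positive clinear_diff lin)
      (simp_all add: compose_diff_left compose_diff_right idem Q_decreasing)
  show "norm (Q n) \<le> 1" by (rule norm_Q_le)
qed (rule that)

text \<open>The dilation property of the unitization at the corner \<open>0 \<oplus> 1\<close>, which its own lift
leaves unchanged, reads \<open>1 - \<tau>\<^sup>n(1) = V\<^sup>* (1 - \<theta>\<^sup>n(1)) V\<close> in the first component.\<close>

lemma compress_Q: "compress_op V (Q n) = (\<tau> ^^ n) id_blinfun"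
proof -
  have "lift_op V 0 = 0"
    by (simp add: lift_op_def compose_zero_left compose_zero_right)
  then have lift: "lift_op (dsum V 1) (dsum 0 1) = dsum 0 1"
    by (simp add: lift_op_dsum[OF V_clinear])
  have "dsum 0 1 \<in> unitized_algebra A"
    using complex_vector.subspace_0[OF A_subspace] by (simp add: dsum_mem_unitized_iff)
  from U.iter_\<tau>[OF this, of n]
  have "dsum (id_blinfun - (\<tau> ^^ n) id_blinfun) 1 = compress_op (dsum V 1) (dsum (id_blinfun - Q n) 1)"
    by (simp add: lift Q_def unitized_map_iter_corner[OF \<tau>_linear A_subspace \<tau>_image A_one]
        unitized_map_iter_corner[OF \<theta>_linear B_subspace \<theta>_image B_one])
  then show ?thesis
    by (simp add: compress_op_dsum[OF V_clinear] dsum_inject compress_op_diff)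
      (simp add: compress_op_def V_adj_V)
qed

text \<open>That the limit is fixed by \<open>\<theta>\<close> is seen in the unitization, where normality is given: there
the corner \<open>0 \<oplus> 1\<close> has iterates \<open>(1 - \<theta>\<^sup>n(1)) \<oplus> 1\<close>.\<close>

lemma Q_limit_unit:
  obtains e where "peripheral_dilation A \<tau> V B \<theta> e" "compress_op V e = unit_limit"
proof -
  obtain e where e: "\<And>h. (\<lambda>n. Q n h) \<longlonglongrightarrow> blinfun_apply e h"
    by (rule Q_limit) (rule that)
  define f where "f n = (unitized_map \<theta> ^^ n) (dsum 0 1)" for n
  define F where "F = dsum (id_blinfun - e) 1"
  have f_eq: "f n = dsum (id_blinfun - Q n) 1" for n
    unfolding f_def Q_def by (rule unitized_map_iter_corner[OF \<theta>_linear B_subspace \<theta>_image B_one])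
  have corner: "dsum 0 1 \<in> unitized_algebra B"
    using complex_vector.subspace_0[OF B_subspace] by (simp add: dsum_mem_unitized_iff)
  have fB: "f n \<in> unitized_algebra B" for n
    unfolding f_def by (rule U.\<theta>_mem[OF corner])
  have f_lim: "(\<lambda>n. f n v) \<longlonglongrightarrow> F v" for v
    unfolding f_eq F_def dsum_apply blinfun.diff_left by (intro tendsto_intros e)
  have FB: "F \<in> unitized_algebra B"
    by (rule von_neumann_algebra_limit[OF U.B_vN fB f_lim])
  have "unitized_map \<theta> F = F"
  proof (rule normal_on_limit[OF U.\<theta>_normal fB _ f_lim FB])
    show "norm (f n) \<le> norm (dsum 0 1 :: ('k \<times> complex) \<Rightarrow>\<^sub>L ('k \<times> complex))" for n
      unfolding f_def by (rule U.norm_\<theta>_iter_le[OF corner])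
    show "(\<lambda>n. unitized_map \<theta> (f n) v) \<longlonglongrightarrow> F v" for v
      using LIMSEQ_Suc[OF f_lim[of v]] by (simp add: f_def)
  qed
  moreover have "id_blinfun - e \<in> B"
    using FB by (simp add: F_def dsum_mem_unitized_iff)
  from complex_vector.subspace_diff[OF B_subspace B_one this] have eB: "e \<in> B"
    by simp
  ultimately have "\<theta> e = e"
    by (simp add: F_def unitized_map_dsum dsum_inject clinear_on_diff[OF \<theta>_linear B_subspace B_one])
  have "peripheral_dilation A \<tau> V B \<theta> e"
  proof
    show "e \<in> eigenspace_on B \<theta> 1"
      by (simp add: eigenspace_on_def eB \<open>\<theta> e = e\<close>)
    fix w x assume w: "cmod w = 1" and "x \<in> eigenspace_on B \<theta> w"
    then have x: "x \<in> B" "\<theta> x = w *\<^sub>C x"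
      by (auto simp: eigenspace_on_def)
    have w0: "w ^ n \<noteq> 0" for n
      using w by auto
    have "w ^ n *\<^sub>C (Q n o\<^sub>L x) = w ^ n *\<^sub>C x" "w ^ n *\<^sub>C (x o\<^sub>L Q n) = w ^ n *\<^sub>C x" for n
      using Q_iter[OF x(1), of n] subsetD[OF B_clinear Q_mem]
      by (simp_all add: funpow_eigenvector[OF \<theta>_linear x] scaleC_compose_left scaleC_compose_right)
    then have Qx: "Q n o\<^sub>L x = x" "x o\<^sub>L Q n = x" for n
      using w0 by (metis complex_vector.scale_left_imp_eq)+
    have "e (x k) = x k" "x (e k) = x k" for k
    proof -
      have "Q n (x k) = x k" "x (Q n k) = x k" for n
        using Qx[of n] by (metis blinfun_apply_blinfun_compose)+
      then show "e (x k) = x k" "x (e k) = x k"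
        using e[of "x k"] blinfun.tendsto[OF tendsto_const e[of k], of x]
        by (simp_all add: LIMSEQ_const_iff)
    qed
    then show "e o\<^sub>L x = x \<and> x o\<^sub>L e = x"
      by (auto intro: blinfun_eqI)
  qed (fact V_clinear B_clinear B_mult B_adj \<theta>_mult \<theta>_adj compress_eigenspace compress_isometric)+
  moreover have "compress_op V e = unit_limit"
  proof (rule blinfun_eqI)
    fix h
    have "(\<lambda>n. op_adj V (Q n (V h))) \<longlonglongrightarrow> op_adj V (e (V h))"
      by (rule blinfun.tendsto[OF tendsto_const e])
    moreover have "op_adj V (Q n (V h)) = (\<tau> ^^ n) id_blinfun h" for n
      unfolding compress_Q[symmetric] compress_op_def by simp
    ultimately have "(\<lambda>n. (\<tau> ^^ n) id_blinfun h) \<longlonglongrightarrow> op_adj V (e (V h))"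
      by simp
    then show "compress_op V e h = unit_limit h"
      using LIMSEQ_unique[OF _ iter_id_tendsto[of h]] by (simp add: compress_op_def)
  qed
  ultimately show ?thesis
    by (rule that)
qed

end

lemma (in contractive_cp_map) minimal_dilation_peripheral:
  assumes "minimal_dilation A \<tau> V B \<theta>"
  obtains e where "peripheral_dilation A \<tau> V B \<theta> e" "compress_op V e = unit_limit"
proof (cases "\<tau> id_blinfun = id_blinfun")
  case True
  then interpret U: unital_dilation A \<tau> V B \<theta>
    using assms by unfold_locales (simp_all add: minimal_dilation_def)
  have "peripheral_dilation A \<tau> V B \<theta> id_blinfun"
  proof
    show "B \<subseteq> clinear_ops"
      using U.B_clinear by blast
    show "id_blinfun \<in> eigenspace_on B \<theta> 1"
      by (simp add: eigenspace_on_def U.B_one U.\<theta>_one)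
  qed (fact U.V_clinear U.B_mult U.B_adj U.\<theta>_mult U.\<theta>_adj U.compress_eigenspace U.compress_isometric | simp)+
  moreover have "(\<tau> ^^ n) id_blinfun = id_blinfun" for n
    by (induction n) (simp_all add: True)
  then have "unit_limit = id_blinfun"
    unfolding unit_limit_def by (intro sot_limit_eqI) simp
  then have "compress_op V id_blinfun = unit_limit"
    by (simp add: compress_op_def U.V_adj_V)
  ultimately show ?thesis
    by (rule that)
next
  case False
  then interpret unitized_dilation A \<tau> V B \<theta>
    using assms by unfold_locales (simp_all add: minimal_dilation_def)
  show ?thesis
    by (rule Q_limit_unit) (rule that)
qed

theorem theorem3p10:
  fixes A :: "('h::chilbert_space \<Rightarrow>\<^sub>L 'h) set"
    and \<tau> :: "('h \<Rightarrow>\<^sub>L 'h) \<Rightarrow> ('h \<Rightarrow>\<^sub>L 'h)"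
    and q :: "'h \<Rightarrow>\<^sub>L 'h"
  assumes "separable_space (euclidean :: 'h topology)"
    and "von_neumann_algebra A"
    and "contractive_normal_cp A \<tau>"
    and "q = sot_limit (\<lambda>n. (\<tau> ^^ n) id_blinfun)"
  shows "limitin strong_operator_topology (\<lambda>n. (\<tau> ^^ n) id_blinfun) q sequentially \<and>
    (q \<noteq> 0 \<longleftrightarrow> (\<exists>x\<in>A. x \<noteq> 0 \<and> \<tau> x = x)) \<and>
    (q \<noteq> 0 \<longleftrightarrow> peripheral_space A \<tau> \<noteq> {0}) \<and>
    (q \<noteq> 0 \<longrightarrow> maximal_pf_eigenvector A \<tau> q \<and>
       (\<forall>x. maximal_pf_eigenvector A \<tau> x \<longrightarrow> x = q)) \<and>
    (\<forall>(V :: 'h \<Rightarrow>\<^sub>L 'k::chilbert_space) B \<theta>. minimal_dilation A \<tau> V B \<theta> \<longrightarrow>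
       (q \<noteq> 0 \<longleftrightarrow>
          cstar_algebra_on (peripheral_space A \<tau>) (choi_effros V B \<theta>) op_adj \<and>
          peripheral_space A \<tau> \<noteq> {0} \<and>
          (\<exists>u. is_unit_on (peripheral_space A \<tau>) (choi_effros V B \<theta>) u)) \<and>
       (q \<noteq> 0 \<longrightarrow> is_unit_on (peripheral_space A \<tau>) (choi_effros V B \<theta>) q))"
proof -
  interpret contractive_cp_map A \<tau>
    by unfold_locales (fact assms(2,3))+
  have q: "q = unit_limit"
    by (simp add: assms(4) unit_limit_def)
  have product: "cstar_algebra_on (peripheral_space A \<tau>) (choi_effros V B \<theta>) op_adj"
    "is_unit_on (peripheral_space A \<tau>) (choi_effros V B \<theta>) q"
    if dilation: "minimal_dilation A \<tau> V B \<theta>" for V :: "'h \<Rightarrow>\<^sub>L 'k" and B \<theta>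
  proof -
    obtain e where "peripheral_dilation A \<tau> V B \<theta> e" and e: "compress_op V e = unit_limit"
      by (rule minimal_dilation_peripheral[OF dilation])
    then interpret peripheral_dilation A \<tau> V B \<theta> e
      by simp
    show "cstar_algebra_on (peripheral_space A \<tau>) (choi_effros V B \<theta>) op_adj"
      by (rule cstar_algebra_choi_effros)
    show "is_unit_on (peripheral_space A \<tau>) (choi_effros V B \<theta>) q"
      using choi_effros_unit by (simp add: e q)
  qed
  show ?thesis
  proof (intro conjI allI impI)
    show "limitin strong_operator_topology (\<lambda>n. (\<tau> ^^ n) id_blinfun) q sequentially"
      unfolding q limitin_strong_operator_topology using iter_id_tendsto by blast
    show "q \<noteq> 0 \<longleftrightarrow> (\<exists>x\<in>A. x \<noteq> 0 \<and> \<tau> x = x)"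
      unfolding q by (rule unit_limit_nonzero_iff_fixed)
    show nonzero_iff: "q \<noteq> 0 \<longleftrightarrow> peripheral_space A \<tau> \<noteq> {0}"
      unfolding q by (rule unit_limit_nonzero_iff_peripheral)
    show max: "maximal_pf_eigenvector A \<tau> q" if "q \<noteq> 0"
      using unit_limit_maximal that by (simp add: q)
    show "x = q" if "q \<noteq> 0" "maximal_pf_eigenvector A \<tau> x" for x
      using maximal_pf_eigenvector_unique[OF that(2) max[OF that(1)]] .
    fix V :: "'h \<Rightarrow>\<^sub>L 'k" and B \<theta>
    assume "minimal_dilation A \<tau> V B \<theta>"
    note algebra = product[OF this]
    show "q \<noteq> 0 \<longleftrightarrow>
          cstar_algebra_on (peripheral_space A \<tau>) (choi_effros V B \<theta>) op_adj \<and>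
          peripheral_space A \<tau> \<noteq> {0} \<and>
          (\<exists>u. is_unit_on (peripheral_space A \<tau>) (choi_effros V B \<theta>) u)"
      using algebra nonzero_iff by blast
    show "is_unit_on (peripheral_space A \<tau>) (choi_effros V B \<theta>) q"
      by (rule algebra(2))
  qed
qed

end
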